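(* Let $\mathcal{A} \subset \mathbb{Z}$ be a finite alphabet and let $\eta \in \mathcal{A}^{\mathbb{Z}^2}$ be a low convex complexity configuration. Suppose that $\eta$ is not fully periodic and that all non-periodic configurations in $X_\eta$ have the same order. Then: (i) (Szabados's conjecture holds for $\eta$) for every $\mathbb{Z}$-minimal periodic decomposition $\eta = \eta_1+\cdots+\eta_m$ and every line $\ell \subset \mathbb{R}^2$ through the origin, $\ell$ contains a period of $\eta_i$ for some $1 \le i \le m$ if and only if $\ell \in \mathrm{NEL}(\eta)$; (ii) for every line $\ell \subset \mathbb{R}^2$ through the origin, $\ell \in \mathrm{NEL}(\eta)$ if and only if both oriented lines $\pmb{\ell}, -\pmb{\ell}$ belong to $\mathrm{ONED}(\eta)$.
   Context: The alphabet $\mathcal{A}$ is finite with at least two elements. A configuration is an element $\eta = (\eta_g)_{g\in\mathbb{Z}^2} \in \mathcal{A}^{\mathbb{Z}^2}$; for $u \in \mathbb{Z}^2$, $(T^u\eta)_g = \eta_{g+u}$. A non-zero $h \in \mathbb{Z}^2$ is a period of $\eta$ if $\eta_{g+h}=\eta_g$ for all $g$; $\eta$ is periodic if it has a period and fully periodic if it has two periods linearly independent over $\mathbb{R}$. The same terminology is used for elements of $\mathbb{Z}^{\mathbb{Z}^2}$ (possibly taking infinitely many values). For a non-empty finite $\mathcal{S} \subset \mathbb{Z}^2$, $P_\eta(\mathcal{S})$ is the number of distinct patterns $(T^u\eta)|_{\mathcal{S}}$, $u \in \mathbb{Z}^2$. A set $\mathcal{S} \subset \mathbb{Z}^2$ is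 convex if its convex hull $\mathrm{Conv}(\mathcal{S})$ in $\mathbb{R}^2$ is closed and $\mathcal{S} = \mathrm{Conv}(\mathcal{S}) \cap \mathbb{Z}^2$. $\eta$ has low convex complexity if $P_\eta(\mathcal{S}) \le |\mathcal{S}|$ for some non-empty, finite, convex $\mathcal{S} \subset \mathbb{Z}^2$. A $\mathbb{Z}$-periodic decomposition of a configuration $\vartheta$ with integer values is an expression $\vartheta = \vartheta_1+\cdots+\vartheta_m$ (pointwise sum) with each $\vartheta_i \in \mathbb{Z}^{\mathbb{Z}^2}$ periodic (possibly with infinitely many values). It is $\mathbb{Z}$-minimal if $m \le n$ for every $\mathbb{Z}$-periodic decomposition of $\vartheta$ with $n$ terms; this minimal $m$ is called the order of $\vartheta$. (If $X_\eta$ contains no non-periodic configuration, the hypothesis on orders holds vacuously.) $X_\eta = \overline{\{T^u\eta : u \in \mathbb{Z}^2\}}$ (closure in the product topology). A line $\ell$ through the origin is expansive on $X_\eta$ if there is $t>0$ such that, with $\ell^t = \{g \in \mathbb{Z}^2 : \mathrm{dist}(g,\ell) \le t\}$ (Euclidean distance), for all $x,y\in X_\eta$, $x|_{\ell^t} = y|_{\ell^t}$ implies $x=y$; otherwise it is nonexpansive. $\mathrm{NEL}(\eta)$ is the set of lines through the origin that are nonexpansive on $X_\eta$. For an oriented line $\pmb{\ell}$ through the origin with orientation vector $(u_1,u_2)\neq 0$, $\mathcal{H}(\pmb{\ell}) = \{g \in \mathbb{Z}^2 : \langle g,(-u_2,u_1)\rangle \ge 0\}$. $\pmb{\ell}$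 is a one-sided expansive direction on $X_\eta$ if for all $x,y\in X_\eta$, $x|_{\mathcal{H}(\pmb{\ell})} = y|_{\mathcal{H}(\pmb{\ell})}$ implies $x=y$; otherwise it is one-sided nonexpansive. $\mathrm{ONED}(\eta)$ is the set of oriented lines through the origin that are one-sided nonexpansive directions on $X_\eta$. For a line $\ell$, $\pmb{\ell}$ is $\ell$ with a given orientation and $-\pmb{\ell}$ is $\ell$ with the opposite orientation. *)

theory Defs
  imports "HOL-Analysis.Analysis"
begin

text \<open>Configurations are integer valued functions on the lattice. A finite alphabet is a finite
  set \<open>A\<close> of integers together with the condition \<open>\<forall>g. \<eta> g \<in> A\<close>.\<close>

type_synonym config = "int \<times> int \<Rightarrow> int"

definition emb :: "int \<times> int \<Rightarrow> real \<times> real" where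
  "emb g = (real_of_int (fst g), real_of_int (snd g))"

definition shift :: "int \<times> int \<Rightarrow> config \<Rightarrow> config" where
  "shift u \<eta> = (\<lambda>g. \<eta> (g + u))"

definition is_period :: "int \<times> int \<Rightarrow> config \<Rightarrow> bool" where
  "is_period h \<eta> \<longleftrightarrow> h \<noteq> 0 \<and> (\<forall>g. \<eta> (g + h) = \<eta> g)"

definition periodic :: "config \<Rightarrow> bool" where
  "periodic \<eta> \<longleftrightarrow> (\<exists>h. is_period h \<eta>)"

text \<open>The condition \<open>h \<noteq> k\<close> is needed because \<^const>\<open>independent\<close> is a property of sets: for
  \<open>h = k\<close> the set below is a singleton.\<close>

definition fully_periodic :: "config \<Rightarrow> bool" where
  "fully_periodic \<eta> \<longleftrightarrow>
     (\<exists>h k. is_period h \<eta> \<and> is_period k \<eta> \<and> h \<noteq> k \<and> independent {emb h, emb k})"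

definition pattern_complexity :: "config \<Rightarrow> (int \<times> int) set \<Rightarrow> nat" where
  "pattern_complexity \<eta> S = card (range (\<lambda>u. restrict (shift u \<eta>) S))"

definition lattice_convex :: "(int \<times> int) set \<Rightarrow> bool" where
  "lattice_convex S \<longleftrightarrow>
     closed (convex hull (emb ` S)) \<and> S = {g. emb g \<in> convex hull (emb ` S)}"

definition low_convex_complexity :: "config \<Rightarrow> bool" where
  "low_convex_complexity \<eta> \<longleftrightarrow>
     (\<exists>S. S \<noteq> {} \<and> finite S \<and> lattice_convex S \<and> pattern_complexity \<eta> S \<le> card S)"

text \<open>The terms of a decomposition are \<open>d 1, \<dots>, d m\<close>; the other values of \<open>d\<close> are irrelevant.\<close>

definition periodic_decomposition :: "nat \<Rightarrow> (nat \<Rightarrow> config) \<Rightarrow> config \<Rightarrow> bool" where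
  "periodic_decomposition m d \<theta> \<longleftrightarrow>
     1 \<le> m \<and> (\<forall>i\<in>{1..m}. periodic (d i)) \<and> (\<forall>g. \<theta> g = (\<Sum>i = 1..m. d i g))"

definition minimal_decomposition :: "nat \<Rightarrow> (nat \<Rightarrow> config) \<Rightarrow> config \<Rightarrow> bool" where
  "minimal_decomposition m d \<theta> \<longleftrightarrow>
     periodic_decomposition m d \<theta> \<and> (\<forall>n e. periodic_decomposition n e \<theta> \<longrightarrow> m \<le> n)"

text \<open>The order is \<open>\<infinity>\<close> for a configuration that has no periodic decomposition.\<close>

definition decomposition_order :: "config \<Rightarrow> enat" where
  "decomposition_order \<theta> = (INF m \<in> {m. \<exists>d. periodic_decomposition m d \<theta>}. enat m)"

text \<open>The closure is taken in the product topology on functions, with the discrete topology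
  on \<^typ>\<open>int\<close>. If \<open>\<eta>\<close> takes values in \<open>A\<close>, then so do all elements of the closure.\<close>

definition orbit_closure :: "config \<Rightarrow> config set" where
  "orbit_closure \<eta> = closure (range (\<lambda>u. shift u \<eta>))"

definition agree_on :: "(int \<times> int) set \<Rightarrow> config \<Rightarrow> config \<Rightarrow> bool" where
  "agree_on S x y \<longleftrightarrow> (\<forall>g\<in>S. x g = y g)"

definition line_through_origin :: "(real \<times> real) set \<Rightarrow> bool" where
  "line_through_origin L \<longleftrightarrow> subspace L \<and> dim L = 1"

definition strip :: "(real \<times> real) set \<Rightarrow> real \<Rightarrow> (int \<times> int) set" where
  "strip L t = {g. infdist (emb g) L \<le> t}"

definition expansive_on :: "config set \<Rightarrow> (real \<times> real) set \<Rightarrow> bool" where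
  "expansive_on X L \<longleftrightarrow> (\<exists>t>0. \<forall>x\<in>X. \<forall>y\<in>X. agree_on (strip L t) x y \<longrightarrow> x = y)"

definition NEL :: "config \<Rightarrow> (real \<times> real) set set" where
  "NEL \<eta> = {L. line_through_origin L \<and> \<not> expansive_on (orbit_closure \<eta>) L}"

text \<open>An oriented line through the origin is given by any of its orientation vectors \<open>u \<noteq> 0\<close>:
  its underlying line is \<open>span {u}\<close> and \<open>- u\<close> gives the opposite orientation. The half plane of
  \<open>u\<close> is unchanged when \<open>u\<close> is multiplied by a positive scalar, so membership of \<open>u\<close> in
  \<open>ONED \<eta>\<close> depends only on the oriented line.\<close>

definition half_plane :: "real \<times> real \<Rightarrow> (int \<times> int) set" where
  "half_plane u = {g. emb g \<bullet> (- snd u, fst u) \<ge> 0}"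

definition one_sided_expansive_on :: "config set \<Rightarrow> real \<times> real \<Rightarrow> bool" where
  "one_sided_expansive_on X u \<longleftrightarrow> (\<forall>x\<in>X. \<forall>y\<in>X. agree_on (half_plane u) x y \<longrightarrow> x = y)"

definition ONED :: "config \<Rightarrow> (real \<times> real) set" where
  "ONED \<eta> = {u. u \<noteq> 0 \<and> \<not> one_sided_expansive_on (orbit_closure \<eta>) u}"

end

theory Submission
  imports Defs "HOL-Library.Poly_Mapping"
begin

text \<open>Integer Laurent polynomials act on configurations, the monomial \<open>X\<^sup>h\<close> as
translation by \<open>h\<close>. By an argument of Kari and Szabados, a configuration
\<open>\<eta>\<close> of low complexity is annihilated by a product of difference operators
\<open>X\<^sup>h - 1\<close>: counting patterns gives an affine relation with integer coefficients that
all patterns satisfy, suitable dilations of it hold as well, and together they form a Vandermonde system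
(\<open>low_complexity_difference_annihilator\<close>). As \<open>\<eta>\<close> is bounded, parallel
factors can be merged, and nonparallel products of \<open>m\<close> operators correspond to periodic
decompositions with \<open>m\<close> terms. So the periods \<open>h\<^sub>1, \<dots>, h\<^sub>m\<close>
of the terms of a minimal decomposition are pairwise nonparallel, and the product of their difference
operators annihilates the orbit closure \<open>X\<close> of \<open>\<eta>\<close>.

A configuration annihilated by a product of difference operators that all move the levels of a linear
functional cannot vanish on a wide strip of that functional without vanishing everywhere. Applied to
differences of elements of \<open>X\<close>, this shows that a line containing none of the
\<open>h\<^sub>i\<close> is expansive. Since a half plane contains translates of all strips parallel to
its boundary, an orientation of an expansive line is never one-sided nonexpansive. Hence both parts of
the theorem follow once both orientations of every \<open>h = h\<^sub>i\<close> are one-sided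
nonexpansive (\<open>decomposition_direction_ambiguous\<close>).

The criterion for that is \<open>ambiguous_from_sum\<close>: it is enough to find in \<open>X\<close> a
sum \<open>y + z\<close> in which \<open>y\<close> has a period \<open>v\<close>, not parallel to
\<open>h\<close>, and \<open>z\<close> has the period \<open>h\<close> but no multiple of
\<open>v\<close> as a period. A translation by a multiple of \<open>v\<close> changes only
\<open>z\<close>, which is a one-dimensional sequence of rows, and if half planes determined the elements
of \<open>X\<close>, that sequence would be periodic.

To find such a sum, let \<open>\<phi>\<close> be the product of the operators of the other terms, so that
\<open>\<phi> x\<close> is \<open>h\<close>-periodic for all \<open>x \<in> X\<close>. Minimality says
that \<open>\<phi> \<eta> \<noteq> 0\<close>, and the hypothesis on the orders says that all elements of
\<open>X\<close> killed by \<open>\<phi>\<close> are periodic. There is a periodic \<open>x\<^sub>0 \<in>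
X\<close> (\<open>low_complexity_has_periodic\<close>): in a minimal subshift without periodic elements
some direction is one-sided nonexpansive, then so is the opposite one, and for one of the two
orientations the counting argument of Cyr and Kra makes an ambiguous configuration periodic. If all
periods of \<open>x\<^sub>0\<close> are parallel to \<open>h\<close>, it can serve as \<open>z\<close>,
with \<open>y = 0\<close>. Otherwise, after passing to a multiple of one of the directions in
\<open>\<phi>\<close>, \<open>\<phi> x\<^sub>0 = 0\<close>. Then \<open>\<phi> \<eta>\<close> has long
runs of zero rows, and at the ends of the runs there is a limit \<open>w\<close> such that \<open>\<phi>
w\<close> vanishes on a half plane but not on its boundary. Limits of \<open>w\<close> deep inside the
half plane are killed by \<open>\<phi>\<close>, hence periodic, and this rigidity forces \<open>w\<close>
to agree on the half plane with a configuration \<open>y \<in> X\<close> periodic along one direction of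
\<open>\<phi>\<close> (\<open>ambiguous_from_boundary\<close>). The sum is \<open>w = y + (w -
y)\<close>.\<close>

section \<open>Lattice vectors\<close>

definition zscale :: "int \<Rightarrow> int \<times> int \<Rightarrow> int \<times> int"  (infixr \<open>*\<^sub>Z\<close> 75) where
  "k *\<^sub>Z h = (k * fst h, k * snd h)"

text \<open>The integer \<open>cross h g\<close> measures on which row parallel to \<open>h\<close> the point \<open>g\<close> lies; the rows to the
  left of \<open>h\<close> have positive numbers.\<close>

definition cross :: "int \<times> int \<Rightarrow> int \<times> int \<Rightarrow> int" where
  "cross h g = fst h * snd g - snd h * fst g"

lemma zscale_simps [simp]:
  "fst (k *\<^sub>Z h) = k * fst h" "snd (k *\<^sub>Z h) = k * snd h"
  "0 *\<^sub>Z h = 0" "1 *\<^sub>Z h = h" "k *\<^sub>Z l *\<^sub>Z h = (k * l) *\<^sub>Z h"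
  by (auto simp: zscale_def prod_eq_iff)

lemma zscale_add: "(k + l) *\<^sub>Z h = k *\<^sub>Z h + l *\<^sub>Z h"
  and zscale_add_right: "k *\<^sub>Z (g + h) = k *\<^sub>Z g + k *\<^sub>Z h"
  and zscale_minus: "(- k) *\<^sub>Z h = - (k *\<^sub>Z h)"
  and zscale_minus_right: "k *\<^sub>Z (- h) = - (k *\<^sub>Z h)"
  and zscale_diff: "(k - l) *\<^sub>Z h = k *\<^sub>Z h - l *\<^sub>Z h"
  by (auto simp: prod_eq_iff algebra_simps)

lemma zscale_eq_0_iff [simp]: "k *\<^sub>Z h = 0 \<longleftrightarrow> k = 0 \<or> h = 0"
  by (auto simp: prod_eq_iff)

lemma cross_simps [simp]:
  "cross h (g + g') = cross h g + cross h g'" "cross h (g - g') = cross h g - cross h g'"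
  "cross h (- g) = - cross h g" "cross (- h) g = - cross h g"
  "cross h (k *\<^sub>Z g) = k * cross h g" "cross (k *\<^sub>Z h) g = k * cross h g"
  "cross h h = 0" "cross h 0 = 0" "cross 0 h = 0"
  by (auto simp: cross_def algebra_simps)

lemma cross_commute: "cross g h = - cross h g"
  by (simp add: cross_def)

lemma cross_nonzeroD: "cross h g \<noteq> 0 \<Longrightarrow> h \<noteq> 0" "cross h g \<noteq> 0 \<Longrightarrow> g \<noteq> 0"
  by (auto simp: cross_def)

lemma cramer: "cross h k *\<^sub>Z a = cross a k *\<^sub>Z h + cross h a *\<^sub>Z k"
  by (simp add: prod_eq_iff cross_def algebra_simps)

lemma parallel_common_multiple:
  assumes "cross h k = 0" "h \<noteq> 0" "k \<noteq> 0"
  obtains c d where "c > 0" "d \<noteq> 0" "c *\<^sub>Z h = d *\<^sub>Z k"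
proof -
  obtain c d where cd: "c \<noteq> 0" "d \<noteq> 0" "c *\<^sub>Z h = d *\<^sub>Z k"
  proof (cases "fst h = 0")
    case True
    then have "snd h \<noteq> 0" "fst k = 0" "snd k \<noteq> 0"
      using assms by (auto simp: cross_def prod_eq_iff)
    then show ?thesis using True by (intro that[of "snd k" "snd h"]) (auto simp: prod_eq_iff)
  next
    case False
    then have "fst k \<noteq> 0" using assms by (auto simp: cross_def prod_eq_iff)
    then show ?thesis using False assms
      by (intro that[of "fst k" "fst h"]) (auto simp: prod_eq_iff cross_def algebra_simps)
  qed
  show ?thesis
  proof (cases "c > 0")
    case True then show ?thesis using cd that by auto
  next
    case False
    then show ?thesis using cd by (intro that[of "- c" "- d"]) (auto simp: zscale_minus)
  qed
qed

lemma cross_parallel_trans: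
  assumes "cross h k = 0" "k \<noteq> 0" "cross k j = 0"
  shows "cross h j = 0"
proof -
  have "cross k j *\<^sub>Z h = cross h j *\<^sub>Z k + cross k h *\<^sub>Z j"
    by (rule cramer)
  then show ?thesis using assms cross_commute[of k h] by simp
qed

lemma exists_nonparallel:
  assumes "h \<noteq> 0" obtains v where "cross h v > 0"
proof -
  have "cross h (- snd h, fst h) > 0"
    using assms by (auto simp: cross_def prod_eq_iff sum_power2_gt_zero_iff
        simp flip: power2_eq_square)
  then show ?thesis using that by blast
qed

text \<open>Modulo \<open>h\<close>, a strip of finite width parallel to \<open>h\<close> is finite: reduce the component along \<open>h\<close>.\<close>

lemma strip_finite_mod:
  assumes "h \<noteq> 0"
  shows "\<exists>B. finite B \<and> B \<subseteq> {g. a \<le> cross h g \<and> cross h g \<le> b} \<and>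
    (\<forall>g. a \<le> cross h g \<longrightarrow> cross h g \<le> b \<longrightarrow> (\<exists>k. g + k *\<^sub>Z h \<in> B))"
proof -
  define dt where "dt = (\<lambda>g::int\<times>int. fst h * fst g + snd h * snd g)"
  define n where "n = dt h"
  have n: "n > 0"
    using assms by (auto simp: n_def dt_def prod_eq_iff sum_power2_gt_zero_iff simp flip: power2_eq_square)
  define B where "B = {g. a \<le> cross h g \<and> cross h g \<le> b \<and> 0 \<le> dt g \<and> dt g < n}"
  have inj: "inj_on (\<lambda>g. (cross h g, dt g)) B"
  proof (rule inj_onI, simp, elim conjE)
    fix x y assume "cross h x = cross h y" "dt x = dt y"
    then have "cross h (x - y) = 0" "dt (x - y) = 0" by (auto simp: dt_def algebra_simps)
    moreover have "n * fst (x - y) = fst h * dt (x - y) - snd h * cross h (x - y)"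
      and "n * snd (x - y) = snd h * dt (x - y) + fst h * cross h (x - y)"
      by (simp_all add: n_def dt_def cross_def algebra_simps)
    ultimately show "x = y" using n by (auto simp: prod_eq_iff)
  qed
  have "(\<lambda>g. (cross h g, dt g)) ` B \<subseteq> {a..b} \<times> {0..<n}" by (auto simp: B_def)
  then have "finite B" using inj by (meson finite_SigmaI finite_atLeastAtMost_int finite_atLeastLessThan_int
        finite_imageD finite_subset)
  moreover have "\<exists>k. g + k *\<^sub>Z h \<in> B" if "a \<le> cross h g" "cross h g \<le> b" for g
  proof
    have "dt (g + (- (dt g div n)) *\<^sub>Z h) = dt g - dt g div n * n"
      by (simp add: dt_def n_def algebra_simps)
    also have "\<dots> = dt g mod n" by (simp add: minus_div_mult_eq_mod)
    finally show "g + (- (dt g div n)) *\<^sub>Z h \<in> B" using that n by (auto simp: B_def)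
  qed
  ultimately show ?thesis by (intro exI[of _ B]) (auto simp: B_def)
qed

section \<open>The group ring of the lattice acting on configurations\<close>

text \<open>The Laurent polynomial \<open>\<Sum>\<^sub>s a\<^sub>s X\<^sup>s\<close> acts by \<open>(f x)\<^sub>g = \<Sum>\<^sub>s a\<^sub>s x\<^bsub>g + s\<^esub>\<close>. Products act as
  compositions, so divisibility in this commutative ring passes to annihilators.\<close>

type_synonym lpoly = "(int \<times> int) \<Rightarrow>\<^sub>0 int"

definition act :: "lpoly \<Rightarrow> config \<Rightarrow> config" where
  "act f x = (\<lambda>g. \<Sum>s\<in>Poly_Mapping.keys f. Poly_Mapping.lookup f s * x (g + s))"

definition diffop :: "int \<times> int \<Rightarrow> lpoly" where
  "diffop h = frag_of h - 1"

lemma act_superset: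
  assumes "finite S" "Poly_Mapping.keys f \<subseteq> S"
  shows "act f x g = (\<Sum>s\<in>S. Poly_Mapping.lookup f s * x (g + s))"
  unfolding act_def using assms
  by (intro sum.mono_neutral_left) (auto simp: in_keys_iff)

lemma act_add: "act (f + f') x g = act f x g + act f' x g"
proof -
  let ?S = "Poly_Mapping.keys f \<union> Poly_Mapping.keys f'"
  have "Poly_Mapping.keys (f + f') \<subseteq> ?S" by (rule Poly_Mapping.keys_add)
  then show ?thesis
    by (simp add: act_superset[of ?S] lookup_add algebra_simps sum.distrib)
qed

lemma act_uminus: "act (- f) x g = - act f x g"
  by (simp add: act_def sum_negf)

lemma act_diff: "act (f - f') x g = act f x g - act f' x g"
  using act_add[of f "- f'"] by (simp add: act_uminus)

lemma act_zero [simp]: "act 0 x g = 0"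
  by (simp add: act_def)

lemma act_frag_of [simp]: "act (frag_of h) x g = x (g + h)"
  by (simp add: act_def)

lemma act_one [simp]: "act 1 x = x"
  using act_frag_of[of 0 x] by (auto simp: single_one[symmetric] simp del: single_one)

lemma act_sum: "act (sum F I) x g = (\<Sum>i\<in>I. act (F i) x g)"
  by (induction I rule: infinite_finite_induct) (auto simp: act_add)

lemma act_diffop: "act (diffop h) x g = x (g + h) - x g"
  by (simp add: diffop_def act_diff)

lemma act_mult: "act (f * f') x = act f (act f' x)"
proof -
  have 1: "act (frag_of s * f') x g = act f' x (g + s)" for s g
    using subset_UNIV
    by (induction f' rule: frag_induction)
      (auto simp: mult_single right_diff_distrib act_diff add.assoc)
  show ?thesis
    using subset_UNIV
  proof (induction f rule: frag_induction)
    case (diff a b)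
    then show ?case by (auto simp: left_diff_distrib act_diff fun_eq_iff)
  qed (auto simp: 1)
qed

lemma act_mult_commute: "act f (act f' x) = act f' (act f x)"
  by (metis act_mult mult.commute)

lemma act_of_nat: "act (of_nat n) x g = int n * x g"
  by (induction n) (auto simp: act_add algebra_simps)

lemma act_single: "act (Poly_Mapping.single s a) x g = a * x (g + s)"
  by (cases "a = 0") (auto simp: act_def)

lemma act_linear_diff: "act f (\<lambda>g. x g - y g) g = act f x g - act f y g"
  by (simp add: act_def right_diff_distrib sum_subtractf)

lemma act_linear_sum: "act f (\<lambda>g. \<Sum>i\<in>I. x i g) g = (\<Sum>i\<in>I. act f (x i) g)"
  unfolding act_def by (simp add: sum_distrib_left) (rule sum.swap)

lemma act_zero_config [simp]: "act f (\<lambda>_. 0) g = 0"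
  by (simp add: act_def)

lemma act_shift: "act f (shift u x) = shift u (act f x)"
  by (auto simp: act_def shift_def fun_eq_iff add_ac)

lemma act_cong_on:
  assumes "\<And>s. s \<in> Poly_Mapping.keys f \<Longrightarrow> x (g + s) = y (g + s)"
  shows "act f x g = act f y g"
  unfolding act_def using assms by (intro sum.cong) auto

lemma act_bounded:
  assumes "\<And>g. \<bar>x g\<bar> \<le> B"
  shows "\<exists>C. \<forall>g. \<bar>act f x g\<bar> \<le> C"
proof (intro exI allI)
  fix g
  have "\<bar>act f x g\<bar> \<le> (\<Sum>s\<in>Poly_Mapping.keys f. \<bar>Poly_Mapping.lookup f s * x (g + s)\<bar>)"
    unfolding act_def by (rule sum_abs)
  also have "\<dots> \<le> (\<Sum>s\<in>Poly_Mapping.keys f. \<bar>Poly_Mapping.lookup f s\<bar> * B)"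
    by (intro sum_mono) (auto simp: abs_mult assms mult_left_mono)
  finally show "\<bar>act f x g\<bar> \<le> (\<Sum>s\<in>Poly_Mapping.keys f. \<bar>Poly_Mapping.lookup f s\<bar> * B)" .
qed

lemma period_multiple:
  fixes x :: config
  assumes "\<And>g. x (g + h) = x g" shows "x (g + k *\<^sub>Z h) = x g"
proof -
  have nat: "x (g + int n *\<^sub>Z h) = x g" for n g
  proof (induction n)
    case (Suc n)
    have "x (g + int (Suc n) *\<^sub>Z h) = x ((g + int n *\<^sub>Z h) + h)"
      by (simp add: zscale_add add_ac)
    then show ?case using Suc assms by simp
  qed auto
  show ?thesis
  proof (cases "k \<ge> 0")
    case True then show ?thesis using nat[of g "nat k"] by simp
  next
    case False
    then have "g = (g + k *\<^sub>Z h) + int (nat (- k)) *\<^sub>Z h"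
      by (simp add: zscale_minus)
    then show ?thesis using nat by metis
  qed
qed

lemma diffop_multiple_dvd: "diffop h dvd diffop (k *\<^sub>Z h)"
proof -
  have nat: "diffop h dvd diffop (int n *\<^sub>Z h)" for n h
  proof (induction n)
    case 0 then show ?case by (simp add: diffop_def)
  next
    case (Suc n)
    have "diffop (int (Suc n) *\<^sub>Z h) = frag_of h * diffop (int n *\<^sub>Z h) + diffop h"
      by (simp add: diffop_def zscale_add right_diff_distrib mult_single)
    then show ?case using Suc by simp
  qed
  show ?thesis
  proof (cases "k \<ge> 0")
    case True then show ?thesis using nat[of h "nat k"] by simp
  next
    case False
    have "diffop h dvd diffop (- h)"
    proof -
      have "diffop h * (- frag_of (- h)) = diffop (- h)"
        by (simp add: diffop_def algebra_simps mult_single)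
      then show ?thesis by (metis dvd_triv_left)
    qed
    then show ?thesis using nat[of "- h" "nat (- k)"] False dvd_trans
      by (fastforce simp: zscale_minus_right zscale_minus)
  qed
qed

lemma act_dvd_kills:
  assumes "f dvd f'" "\<And>g. act f x g = 0"
  shows "act f' x g = 0"
proof -
  obtain q where "f' = q * f" using assms(1) by (metis dvd_def mult.commute)
  moreover have "act f x = (\<lambda>_. 0)" using assms(2) by auto
  ultimately show ?thesis by (simp add: act_mult)
qed

text \<open>Such a sequence is affine, and a bounded affine sequence is constant.\<close>

lemma bounded_second_difference:
  fixes e :: "nat \<Rightarrow> int"
  assumes "\<And>n. e (n + 2) - 2 * e (n + 1) + e n = 0" "\<And>n. \<bar>e n\<bar> \<le> B"
  shows "e 1 = e 0"
proof (rule ccontr)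
  assume ne: "e 1 \<noteq> e 0"
  have *: "e n = e 0 + int n * (e 1 - e 0) \<and> e (n + 1) = e 0 + (int n + 1) * (e 1 - e 0)" for n
  proof (induction n)
    case (Suc n)
    have "e (Suc n + 1) = 2 * e (n + 1) - e n" using assms(1)[of n] by simp
    then show ?case using Suc by (simp add: algebra_simps)
  qed auto
  define n where "n = nat (2 * B + 1)"
  have B: "B \<ge> 0" using assms(2)[of 0] by simp
  have "\<bar>int n * (e 1 - e 0)\<bar> \<le> 2 * B"
    using *[of n] assms(2)[of n] assms(2)[of 0] by linarith
  moreover have "\<bar>int n * (e 1 - e 0)\<bar> \<ge> int n"
    using mult_left_mono[of 1 "\<bar>e 1 - e 0\<bar>" "int n"] ne by (simp add: abs_mult)
  ultimately show False using B by (simp add: n_def)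
qed

lemma bounded_double_difference:
  assumes bd: "\<And>g. \<bar>x g\<bar> \<le> B" and U: "\<And>g. g \<in> U \<Longrightarrow> g + h \<in> U"
    and kill: "\<And>g. g \<in> U \<Longrightarrow> act (diffop h) (act (diffop h) x) g = 0" and g: "g \<in> U"
  shows "act (diffop h) x g = 0"
proof -
  have inU: "g + int n *\<^sub>Z h \<in> U" for n
  proof (induction n)
    case (Suc n)
    then show ?case using U[of "g + int n *\<^sub>Z h"] by (simp add: zscale_add add_ac)
  qed (use g in auto)
  have "x (g + int 1 *\<^sub>Z h) = x (g + int 0 *\<^sub>Z h)"
  proof (rule bounded_second_difference[where e = "\<lambda>n. x (g + int n *\<^sub>Z h)"])
    fix n
    have "g + int (n + 2) *\<^sub>Z h = g + int n *\<^sub>Z h + h + h"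
      "g + int (n + 1) *\<^sub>Z h = g + int n *\<^sub>Z h + h"
      by (auto simp: prod_eq_iff algebra_simps)
    then show "x (g + int (n + 2) *\<^sub>Z h) - 2 * x (g + int (n + 1) *\<^sub>Z h) + x (g + int n *\<^sub>Z h) = 0"
      using kill[OF inU[of n]] by (simp only: act_diffop)
  qed (rule bd)
  then show ?thesis by (simp add: act_diffop)
qed

section \<open>Pointwise limits of configurations\<close>

text \<open>Quantifiers over lattice points are not split into quantifiers over coordinates, which would hide
  the group structure.\<close>

declare split_paired_All [simp del] split_paired_Ex [simp del]

text \<open>This makes the product topology on configurations first countable, so that its closed and its
  compact sets are described by sequences.\<close>

instance int :: first_countable_topology
proof
  fix x :: int
  show "\<exists>A::nat \<Rightarrow> int set. (\<forall>i. x \<in> A i \<and> open (A i)) \<and> (\<forall>S. open S \<and> x \<in> S \<longrightarrow> (\<exists>i. A i \<subseteq> S))"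
    by (intro exI[of _ "\<lambda>_. {x}"]) (auto simp: open_discrete)
qed

text \<open>Convergence in the product topology, stated for single lattice points: values in a discrete space
  converge when they are eventually constant.\<close>

definition converges :: "(nat \<Rightarrow> config) \<Rightarrow> config \<Rightarrow> bool" where
  "converges xs l \<longleftrightarrow> (\<forall>g. \<forall>\<^sub>F n in sequentially. xs n g = l g)"

lemma converges_iff_tendsto: "converges xs l \<longleftrightarrow> xs \<longlonglongrightarrow> l"
proof -
  have "xs \<longlonglongrightarrow> l \<longleftrightarrow> (\<forall>g. (\<lambda>n. xs n g) \<longlonglongrightarrow> l g)"
  proof -
    have "xs \<longlonglongrightarrow> l \<longleftrightarrow> limitin (product_topology (\<lambda>i. euclidean) UNIV) xs l sequentially"
      by (simp add: euclidean_product_topology limitin_canonical_iff)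
    then show ?thesis
      by (simp add: limitin_componentwise limitin_canonical_iff)
  qed
  moreover have "(\<lambda>n. xs n g) \<longlonglongrightarrow> l g \<longleftrightarrow> (\<forall>\<^sub>F n in sequentially. xs n g = l g)" for g
  proof
    assume "(\<lambda>n. xs n g) \<longlonglongrightarrow> l g"
    then show "\<forall>\<^sub>F n in sequentially. xs n g = l g"
      using topological_tendstoD[of _ "l g" sequentially "{l g}"] by (simp add: open_discrete)
  qed (rule tendsto_eventually)
  ultimately show ?thesis unfolding converges_def by presburger
qed

lemma convergesD: "converges xs l \<Longrightarrow> \<forall>\<^sub>F n in sequentially. xs n g = l g"
  unfolding converges_def by blast

lemma converges_finite:
  assumes "converges xs l" "finite W"
  shows "\<forall>\<^sub>F n in sequentially. \<forall>g\<in>W. xs n g = l g"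
  using assms convergesD by (simp add: eventually_ball_finite_distrib)

lemma converges_subseq: "converges xs l \<Longrightarrow> strict_mono r \<Longrightarrow> converges (xs \<circ> r) l"
  unfolding converges_iff_tendsto by (rule LIMSEQ_subseq_LIMSEQ)

lemma shift_apply: "shift u x g = x (g + u)"
  by (simp add: shift_def)

lemma converges_shift: "converges xs l \<Longrightarrow> converges (\<lambda>n. shift u (xs n)) (shift u l)"
  unfolding converges_def shift_def by blast

lemma converges_act:
  assumes "converges xs l" shows "\<forall>\<^sub>F n in sequentially. act f (xs n) g = act f l g"
proof -
  have "\<forall>\<^sub>F n in sequentially. \<forall>g'\<in>(+) g ` Poly_Mapping.keys f. xs n g' = l g'"
    by (intro converges_finite assms) auto
  then show ?thesis by eventually_elim (auto intro: act_cong_on)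
qed

lemma converges_zero_on:
  assumes "converges xs l" "\<forall>\<^sub>F n in sequentially. act f (xs n) g = 0" shows "act f l g = 0"
proof -
  have "\<forall>\<^sub>F n in sequentially. act f l g = 0"
    using converges_act[OF assms(1), of f g] assms(2) by eventually_elim auto
  then show ?thesis by simp
qed

lemma converges_in_closed: "closed X \<Longrightarrow> (\<And>n. xs n \<in> X) \<Longrightarrow> converges xs l \<Longrightarrow> l \<in> X"
  unfolding converges_iff_tendsto by (metis closed_sequentially)

lemma closed_iff_converges:
  "closed X \<longleftrightarrow> (\<forall>xs l. (\<forall>n. xs n \<in> X) \<longrightarrow> converges xs l \<longrightarrow> l \<in> X)"
  unfolding converges_iff_tendsto by (metis closed_sequential_limits)

lemma compact_configs: "finite A \<Longrightarrow> compact {x::config. \<forall>g. x g \<in> A}"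
proof -
  assume A: "finite A"
  have "compactin (product_topology (\<lambda>i::int\<times>int. euclidean::int topology) UNIV) (\<Pi>\<^sub>E i\<in>UNIV. A)"
    unfolding compactin_PiE using A by (auto simp: finite_imp_compact)
  then have "compact (\<Pi>\<^sub>E i\<in>(UNIV::(int\<times>int) set). A)"
    by (simp add: euclidean_product_topology)
  moreover have "(\<Pi>\<^sub>E i\<in>(UNIV::(int\<times>int) set). A) = {x. \<forall>g. x g \<in> A}"
    by (auto simp: PiE_def)
  ultimately show ?thesis by simp
qed

lemma convergent_subsequence:
  assumes "finite A" "\<And>n g. xs n g \<in> A"
  obtains r l where "strict_mono (r::nat \<Rightarrow> nat)" "converges (xs \<circ> r) l"
proof -
  have "seq_compact {x::config. \<forall>g. x g \<in> A}"
    by (rule compact_imp_seq_compact[OF compact_configs[OF assms(1)]])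
  then obtain l r where "strict_mono (r::nat \<Rightarrow> nat)" "(xs \<circ> r) \<longlonglongrightarrow> l"
    using assms(2) unfolding seq_compact_def by blast
  then show ?thesis using that by (simp add: converges_iff_tendsto)
qed

definition window :: "nat \<Rightarrow> (int \<times> int) set" where
  "window n = {- int n..int n} \<times> {- int n..int n}"

lemma finite_window [simp]: "finite (window n)"
  by (simp add: window_def)

lemma window_mono: "n \<le> m \<Longrightarrow> window n \<subseteq> window m"
  by (auto simp: window_def)

lemma eventually_window: "\<forall>\<^sub>F n in sequentially. g \<in> window n"
proof -
  have "g \<in> window n" if "n \<ge> nat (max \<bar>fst g\<bar> \<bar>snd g\<bar>)" for n
    using that by (cases g) (auto simp: window_def)
  then show ?thesis by (auto simp: eventually_sequentially)
qed

lemma converges_windowI: "(\<And>n. agree_on (window n) (xs n) l) \<Longrightarrow> converges xs l"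
  unfolding converges_def agree_on_def
proof
  fix g assume "\<And>n. \<forall>g\<in>window n. xs n g = l g"
  then show "\<forall>\<^sub>F n in sequentially. xs n g = l g"
    by (intro eventually_mono[OF eventually_window[of g]]) blast
qed

lemma approximable_in_closed:
  assumes "closed X" "\<And>W. finite W \<Longrightarrow> \<exists>y\<in>X. agree_on W y x"
  shows "x \<in> X"
proof -
  obtain ys where ys: "\<And>n. ys n \<in> X" "\<And>n. agree_on (window n) (ys n) x"
    using assms(2)[OF finite_window] by metis
  then show ?thesis using converges_in_closed[OF assms(1) ys(1) converges_windowI[OF ys(2)]] by simp
qed

lemma closure_approximable:
  assumes "x \<in> closure Y" "finite W" shows "\<exists>y\<in>Y. agree_on W y x"
proof -
  obtain ys where "\<And>n. ys n \<in> Y" "converges ys x"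
    using assms(1) unfolding closure_sequential converges_iff_tendsto by auto
  moreover have "\<forall>\<^sub>F n in sequentially. \<forall>g\<in>W. ys n g = x g"
    using converges_finite calculation assms by blast
  ultimately show ?thesis by (auto simp: eventually_sequentially agree_on_def)
qed

section \<open>Subshifts\<close>

definition subshift :: "int set \<Rightarrow> config set \<Rightarrow> bool" where
  "subshift A X \<longleftrightarrow> finite A \<and> closed X \<and> (\<forall>x\<in>X. (\<forall>g. x g \<in> A) \<and> (\<forall>u. shift u x \<in> X))"


lemma shift_shift [simp]: "shift u (shift v x) = shift (u + v) x"
  by (simp add: shift_def fun_eq_iff add_ac)

lemma shift_0 [simp]: "shift 0 x = x"
  by (simp add: shift_def)

lemma shift_eq_iff [simp]: "shift u x = shift u y \<longleftrightarrow> x = y"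
  by (metis diff_add_cancel add.right_neutral add.commute shift_0 shift_shift)

lemma subshiftD:
  assumes "subshift A X"
  shows "finite A" "closed X" "x \<in> X \<Longrightarrow> x g \<in> A" "x \<in> X \<Longrightarrow> shift u x \<in> X"
  using assms by (auto simp: subshift_def)

lemma subshift_bounded:
  assumes "subshift A X" shows "\<exists>B. \<forall>x\<in>X. \<forall>g. \<bar>x g\<bar> \<le> B"
proof (intro exI ballI allI)
  fix x g assume "x \<in> X"
  then have "\<bar>x g\<bar> \<in> abs ` A" "finite (abs ` A)" using assms by (auto simp: subshift_def)
  then show "\<bar>x g\<bar> \<le> Max (abs ` A)" by simp
qed

lemma subshift_limit:
  assumes "subshift A X" "\<And>n. xs n \<in> X"
  obtains r l where "strict_mono (r::nat \<Rightarrow> nat)" "converges (xs \<circ> r) l" "l \<in> X"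
proof -
  obtain r l where rl: "strict_mono (r::nat \<Rightarrow> nat)" "converges (xs \<circ> r) l"
    using convergent_subsequence[of A xs] assms by (auto simp: subshift_def)
  moreover have "l \<in> X"
    by (rule converges_in_closed[OF _ _ rl(2)]) (use assms in \<open>auto simp: subshift_def\<close>)
  ultimately show ?thesis using that by blast
qed

lemma subshift_orbit_closure:
  assumes "finite A" "\<And>g. \<eta> g \<in> A" shows "subshift A (orbit_closure \<eta>)"
proof -
  have "x g \<in> A" if x: "x \<in> orbit_closure \<eta>" for x g
  proof -
    obtain u where "agree_on {g} (shift u \<eta>) x"
      using closure_approximable[of x _ "{g}"] x unfolding orbit_closure_def by blast
    then show ?thesis using assms(2)[of "g + u"] by (auto simp: agree_on_def shift_def)
  qed
  moreover have "shift u x \<in> orbit_closure \<eta>" if x: "x \<in> orbit_closure \<eta>" for u x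
  proof (rule approximable_in_closed)
    fix W :: "(int\<times>int) set" assume "finite W"
    then obtain v where "agree_on ((\<lambda>g. g + u) ` W) (shift v \<eta>) x"
      using closure_approximable[of x _ "(\<lambda>g. g + u) ` W"] x unfolding orbit_closure_def by blast
    then have "agree_on W (shift (u + v) \<eta>) (shift u x)"
      by (auto simp: agree_on_def shift_def add_ac)
    then show "\<exists>y\<in>orbit_closure \<eta>. agree_on W y (shift u x)"
      unfolding orbit_closure_def by (meson closure_subset rangeI subsetD)
  qed (simp add: orbit_closure_def)
  ultimately show ?thesis using assms by (auto simp: subshift_def orbit_closure_def)
qed

lemma orbit_closure_approx:
  "x \<in> orbit_closure \<eta> \<Longrightarrow> finite W \<Longrightarrow> \<exists>u. agree_on W (shift u \<eta>) x"
  unfolding orbit_closure_def using closure_approximable[of x "range (\<lambda>u. shift u \<eta>)" W] by blast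

lemma in_orbit_closure: "\<eta> \<in> orbit_closure \<eta>"
  unfolding orbit_closure_def by (metis closure_subset rangeI shift_0 subsetD)

lemma orbit_closure_kills:
  assumes "\<And>g. act f \<eta> g = 0" "x \<in> orbit_closure \<eta>" shows "act f x g = 0"
proof -
  obtain u where u: "agree_on ((+) g ` Poly_Mapping.keys f) (shift u \<eta>) x"
    using orbit_closure_approx[OF assms(2)] by (meson finite_imageI finite_keys)
  have "act f x g = act f (shift u \<eta>) g"
    using u by (intro act_cong_on) (auto simp: agree_on_def)
  also have "\<dots> = act f \<eta> (g + u)" by (simp add: act_shift shift_apply)
  finally show ?thesis by (simp add: assms(1))
qed

text \<open>Zorn's lemma, applied to the complements; a chain of nonempty closed invariant sets has a nonempty
  intersection by compactness. The translations \<open>\<Gamma>\<close> are those of the whole lattice or those along a line.\<close>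

lemma minimal_invariant:
  assumes X: "closed X" "X \<noteq> {}" "finite A" "\<And>x g. x \<in> X \<Longrightarrow> x g \<in> A"
    and inv: "\<And>x u. x \<in> X \<Longrightarrow> u \<in> \<Gamma> \<Longrightarrow> shift u x \<in> X"
  shows "\<exists>M. closed M \<and> M \<noteq> {} \<and> M \<subseteq> X \<and> (\<forall>x\<in>M. \<forall>u\<in>\<Gamma>. shift u x \<in> M) \<and>
    (\<forall>N. closed N \<longrightarrow> N \<noteq> {} \<longrightarrow> N \<subseteq> M \<longrightarrow> (\<forall>x\<in>N. \<forall>u\<in>\<Gamma>. shift u x \<in> N) \<longrightarrow> N = M)"
proof -
  define \<F> where "\<F> = {N. closed N \<and> N \<noteq> {} \<and> N \<subseteq> X \<and> (\<forall>x\<in>N. \<forall>u\<in>\<Gamma>. shift u x \<in> N)}"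
  have cX: "compact X"
  proof -
    have "X = {x. \<forall>g. x g \<in> A} \<inter> X" using X by auto
    then show ?thesis using compact_Int_closed[OF compact_configs[OF X(3)] X(1)] by simp
  qed
  have XF: "X \<in> \<F>" using X inv by (auto simp: \<F>_def)
  have "\<exists>M\<in>\<F>. \<forall>N\<in>\<F>. N \<subseteq> M \<longrightarrow> N = M"
  proof -
    have "\<exists>M\<in>uminus ` \<F>. \<forall>N\<in>uminus ` \<F>. M \<subseteq> N \<longrightarrow> N = M"
    proof (rule subset_Zorn_nonempty)
      show "uminus ` \<F> \<noteq> {}" using XF by auto
    next
      fix C assume C: "C \<noteq> {}" "subset.chain (uminus ` \<F>) C"
      define D where "D = uminus ` C"
      have D: "D \<subseteq> \<F>" "D \<noteq> {}" using C by (auto simp: D_def subset.chain_def)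
      have ch: "N \<subseteq> N' \<or> N' \<subseteq> N" if NN: "N \<in> D" "N' \<in> D" for N N'
      proof -
        obtain x y where "x \<in> C" "N = - x" "y \<in> C" "N' = - y" using NN unfolding D_def by blast
        moreover from this have "x \<subseteq> y \<or> y \<subseteq> x" using C(2) unfolding subset.chain_def by blast
        ultimately show ?thesis by blast
      qed
      have "X \<inter> \<Inter>D \<noteq> {}"
      proof (rule compact_imp_fip[OF cX])
        fix T assume "T \<in> D" then show "closed T" using D by (auto simp: \<F>_def)
      next
        fix F' assume F': "finite F'" "F' \<subseteq> D"
        show "X \<inter> \<Inter>F' \<noteq> {}"
        proof (cases "F' = {}")
          case False
          have "\<Inter>F' \<in> F'"
            using F'(1) False F'(2)
          proof (induction F' rule: finite_ne_induct)
            case (insert T F')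
            then have "\<Inter>F' \<in> D" "T \<in> D" by auto
            then have "T \<inter> \<Inter>F' = T \<or> T \<inter> \<Inter>F' = \<Inter>F'" using ch by blast
            then show ?case using insert by auto
          qed auto
          then have "\<Inter>F' \<in> \<F>" using F' D by auto
          then show ?thesis by (auto simp: \<F>_def)
        qed (use X in auto)
      qed
      then have "\<Inter>D \<in> \<F>" using D unfolding \<F>_def by blast
      moreover have "\<Union>C = - \<Inter>D" by (auto simp: D_def)
      ultimately show "\<Union>C \<in> uminus ` \<F>" by blast
    qed
    then obtain K where K: "K \<in> uminus ` \<F>" "\<forall>N\<in>uminus ` \<F>. K \<subseteq> N \<longrightarrow> N = K" ..
    obtain M where M: "M \<in> \<F>" "K = - M" using K(1) ..
    have "N = M" if N: "N \<in> \<F>" "N \<subseteq> M" for N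
    proof -
      have "- N = K" using K(2) N M(2) by (simp add: image_iff)
      then show ?thesis using M(2) by simp
    qed
    then show ?thesis using M(1) by blast
  qed
  then obtain M where M: "M \<in> \<F>" "\<And>N. N \<in> \<F> \<Longrightarrow> N \<subseteq> M \<Longrightarrow> N = M" by blast
  have "N = M" if N: "closed N" "N \<noteq> {}" "N \<subseteq> M" "\<forall>x\<in>N. \<forall>u\<in>\<Gamma>. shift u x \<in> N" for N
    using M N by (intro M(2)) (auto simp: \<F>_def)
  then show ?thesis using M(1) unfolding \<F>_def by (intro exI[of _ M]) simp
qed

section \<open>Determinism\<close>

text \<open>Compactness: if for every \<open>n\<close> two elements agree on the part of \<open>D\<close> in the \<open>n\<close>-th window and differ at
  \<open>g0\<close>, then their limits agree on \<open>D\<close> and differ at \<open>g0\<close>.\<close>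

lemma finite_determination:
  assumes X: "subshift A X"
    and det: "\<And>x y. x \<in> X \<Longrightarrow> y \<in> X \<Longrightarrow> agree_on D x y \<Longrightarrow> x g0 = y g0"
  shows "\<exists>F. finite F \<and> F \<subseteq> D \<and> (\<forall>x\<in>X. \<forall>y\<in>X. agree_on F x y \<longrightarrow> x g0 = y g0)"
proof (rule ccontr)
  assume no: "\<not> ?thesis"
  have "\<forall>n. \<exists>x y. x \<in> X \<and> y \<in> X \<and> agree_on (D \<inter> window n) x y \<and> x g0 \<noteq> y g0"
  proof
    fix n show "\<exists>x y. x \<in> X \<and> y \<in> X \<and> agree_on (D \<inter> window n) x y \<and> x g0 \<noteq> y g0"
      using no by (metis finite_Int finite_window inf_le1)
  qed
  from choice[OF this] obtain xs
    where "\<forall>n. \<exists>y. xs n \<in> X \<and> y \<in> X \<and> agree_on (D \<inter> window n) (xs n) y \<and> xs n g0 \<noteq> y g0" ..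
  from choice[OF this] obtain ys where
    xy': "\<forall>n. xs n \<in> X \<and> ys n \<in> X \<and> agree_on (D \<inter> window n) (xs n) (ys n) \<and> xs n g0 \<noteq> ys n g0" ..
  then have xy: "\<And>n. xs n \<in> X" "\<And>n. ys n \<in> X"
    "\<And>n. agree_on (D \<inter> window n) (xs n) (ys n)" "\<And>n. xs n g0 \<noteq> ys n g0"
    by blast+
  obtain r x where r: "strict_mono (r::nat \<Rightarrow> nat)" "converges (xs \<circ> r) x" "x \<in> X"
    by (rule subshift_limit[OF X, of xs, OF xy(1)])
  obtain s y where s: "strict_mono (s::nat \<Rightarrow> nat)" "converges ((ys \<circ> r) \<circ> s) y" "y \<in> X"
    by (rule subshift_limit[OF X, of "ys \<circ> r"]) (simp add: xy(2))
  have rs: "strict_mono (r \<circ> s)" using r(1) s(1) by (simp add: strict_mono_o)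
  have x: "converges ((xs \<circ> r) \<circ> s) x" by (rule converges_subseq[OF r(2) s(1)])
  have "x g = y g" if g: "g \<in> D" for g
  proof -
    have "\<forall>\<^sub>F n in sequentially. g \<in> window ((r \<circ> s) n)"
      by (rule eventually_subseq[OF rs eventually_window])
    then have "\<forall>\<^sub>F n in sequentially. x g = y g"
      using convergesD[OF x, of g] convergesD[OF s(2), of g]
    proof eventually_elim
      case (elim n)
      then show ?case using xy(3)[of "(r \<circ> s) n"] g by (auto simp: agree_on_def)
    qed
    then show ?thesis by simp
  qed
  then have "x g0 = y g0" using det[OF r(3) s(3)] by (auto simp: agree_on_def)
  moreover have "\<forall>\<^sub>F n in sequentially. x g0 \<noteq> y g0"
    using convergesD[OF x, of g0] convergesD[OF s(2), of g0]
  proof eventually_elim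
    case (elim n)
    then show ?case using xy(4)[of "(r \<circ> s) n"] by auto
  qed
  ultimately show False by simp
qed

text \<open>A function killed by difference operators that all move the level of \<open>\<lambda>\<close> cannot vanish on
  a wide strip or half plane of \<open>\<lambda>\<close> without vanishing everywhere: peel off one operator at a time,
  each time getting a periodic function that vanishes on a strip wider than its period.\<close>

lemma zero_on_strip_imp_zero:
  fixes lam :: "int \<times> int \<Rightarrow> real"
  assumes lam: "\<And>g h. lam (g + h) = lam g + lam h"
    and "finite J" "\<And>j. j \<in> J \<Longrightarrow> lam j \<noteq> 0"
    and "\<And>g. a \<le> lam g \<Longrightarrow> lam g \<le> b \<Longrightarrow> x g = 0" "b - a \<ge> (\<Sum>j\<in>J. \<bar>lam j\<bar>)"
    and "\<And>g. act (\<Prod>j\<in>J. diffop j) x g = 0"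
  shows "x g = 0"
  using assms(2-6)
proof (induction J arbitrary: x a b g rule: finite_induct)
  case (insert j J)
  have lam0: "lam 0 = 0" using lam[of 0 0] by simp
  have lamn: "lam (- h) = - lam h" for h using lam[of h "- h"] lam0 by simp
  have lamk: "lam (k *\<^sub>Z h) = real_of_int k * lam h" for k h
  proof -
    have nat: "lam (int n *\<^sub>Z h) = real n * lam h" for n h
      by (induction n) (auto simp: lam0 zscale_add lam algebra_simps)
    show ?thesis
    proof (cases "k \<ge> 0")
      case True then show ?thesis using nat[of "nat k" h] by simp
    next
      case False then show ?thesis using nat[of "nat (- k)" "- h"] by (simp add: lamn zscale_minus zscale_minus_right)
    qed
  qed
  define y where "y = act (diffop j) x"
  define l where "l = lam j"
  have l: "l \<noteq> 0" using insert by (auto simp: l_def)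
  have y0: "y g = 0" for g
  proof (rule insert.IH[of "a + max 0 (- l)" "b - max 0 l" y])
    fix g assume "a + max 0 (- l) \<le> lam g" "lam g \<le> b - max 0 l"
    then show "y g = 0" using insert.prems(2)[of g] insert.prems(2)[of "g + j"]
      by (auto simp: y_def act_diffop lam l_def[symmetric])
  next
    show "(\<Sum>j\<in>J. \<bar>lam j\<bar>) \<le> b - max 0 l - (a + max 0 (- l))"
      using insert by (auto simp: l_def)
  next
    fix g show "act (prod diffop J) y g = 0"
      using insert.prems(4)[of g] insert.hyps by (simp add: y_def mult.commute flip: act_mult)
  qed (use insert in auto)
  then have per: "x (g + j) = x g" for g by (auto simp: y_def act_diffop)
  have ba: "\<bar>l\<bar> \<le> b - a"
  proof -
    have "\<bar>l\<bar> + (\<Sum>j\<in>J. \<bar>lam j\<bar>) \<le> b - a" using insert.prems(3) insert.hyps by (simp add: l_def)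
    moreover have "0 \<le> (\<Sum>j\<in>J. \<bar>lam j\<bar>)" by (simp add: sum_nonneg)
    ultimately show ?thesis by linarith
  qed
  define k where "k = (if l > 0 then - \<lfloor>(lam g - a) / l\<rfloor> else - \<lceil>(lam g - a) / l\<rceil>)"
  have "lam (g + k *\<^sub>Z j) = lam g + k * l" by (simp add: lam lamk l_def)
  moreover have "a \<le> lam g + k * l \<and> lam g + k * l \<le> a + \<bar>l\<bar>"
  proof -
    define t where "t = (lam g - a) / l"
    have t: "lam g = a + t * l" using l by (simp add: t_def)
    show ?thesis
    proof (cases "l > 0")
      case True
      have "0 \<le> t - \<lfloor>t\<rfloor>" "t - \<lfloor>t\<rfloor> \<le> 1" by linarith+
      then have "0 \<le> (t - \<lfloor>t\<rfloor>) * l \<and> (t - \<lfloor>t\<rfloor>) * l \<le> l"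
        using True by (simp add: mult_left_le_one_le)
      then show ?thesis using True t by (simp add: k_def t_def[symmetric] algebra_simps)
    next
      case False
      have "0 \<le> \<lceil>t\<rceil> - t" "\<lceil>t\<rceil> - t \<le> 1" by linarith+
      then have "0 \<le> (\<lceil>t\<rceil> - t) * (- l) \<and> (\<lceil>t\<rceil> - t) * (- l) \<le> - l"
        using False l by (simp add: mult_left_le_one_le zero_le_mult_iff mult_nonneg_nonpos)
      then show ?thesis using False t by (simp add: k_def t_def[symmetric] algebra_simps)
    qed
  qed
  ultimately have "x (g + k *\<^sub>Z j) = 0" using ba by (intro insert.prems(2)) auto
  then show ?case using period_multiple[of x j g k] per by simp
qed auto

lemma zero_above_imp_zero:
  assumes "finite J" "\<And>j. j \<in> J \<Longrightarrow> cross h j \<noteq> 0"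
    and "\<And>g. c \<le> cross h g \<Longrightarrow> x g = 0"
    and "\<And>g. act (\<Prod>j\<in>J. diffop j) x g = 0"
  shows "x g = 0"
proof (rule zero_on_strip_imp_zero[where lam = "\<lambda>g. real_of_int (cross h g)" and J = J
      and a = "real_of_int c" and b = "real_of_int c + (\<Sum>j\<in>J. \<bar>real_of_int (cross h j)\<bar>)"])
  fix g assume "real_of_int c \<le> real_of_int (cross h g)"
  then show "x g = 0" using assms(3) by simp
next
  show "act (\<Prod>j\<in>J. diffop j) x g = 0" for g by (rule assms(4))
next
  show "real_of_int (cross h j) \<noteq> 0" if "j \<in> J" for j using assms(2)[OF that] by simp
qed (use assms(1) in simp_all)

section \<open>Annihilators of configurations of low complexity\<close>

text \<open>Gaussian elimination without division: one unknown and one equation are eliminated at a time.\<close>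

lemma integer_relation:
  fixes V :: "('i \<Rightarrow> int) set"
  assumes "finite I" "finite V" "card V < card I"
  shows "\<exists>c. (\<exists>i\<in>I. c i \<noteq> 0) \<and> (\<forall>v\<in>V. (\<Sum>i\<in>I. c i * v i) = 0)"
  using assms
proof (induction "card V" arbitrary: V I rule: less_induct)
  case less
  show ?case
  proof (cases "\<exists>v\<in>V. \<exists>i\<in>I. v i \<noteq> 0")
    case False
    moreover obtain i where "i \<in> I" using less.prems by (cases "I = {}") auto
    ultimately show ?thesis by (intro exI[of _ "\<lambda>_. 1"]) auto
  next
    case True
    then obtain v j where v: "v \<in> V" "j \<in> I" "v j \<noteq> 0" by blast
    define V' where "V' = (\<lambda>w i. v j * w i - w j * v i) ` (V - {v})"
    define I' where "I' = I - {j}"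
    have cV: "card (V - {v}) < card V" by (rule psubset_card_mono) (use v less.prems in auto)
    have cV': "card V' \<le> card (V - {v})" unfolding V'_def using less.prems by (intro card_image_le) auto
    have "card I' = card I - 1" using v less.prems by (simp add: I'_def)
    then have "card V' < card V" "card V' < card I'"
      using cV cV' less.prems v(1) by (auto simp: card_Diff_singleton)
    then obtain c where c: "\<exists>i\<in>I'. c i \<noteq> 0" "\<And>w. w \<in> V' \<Longrightarrow> (\<Sum>i\<in>I'. c i * w i) = 0"
      using less.hyps[of V' I'] less.prems by (auto simp: V'_def I'_def)
    define d where "d = (\<lambda>i. if i = j then - (\<Sum>i\<in>I'. c i * v i) else v j * c i)"
    have sum: "(\<Sum>i\<in>I. d i * w i) = v j * (\<Sum>i\<in>I'. c i * w i) - w j * (\<Sum>i\<in>I'. c i * v i)" for w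
    proof -
      have "(\<Sum>i\<in>I. d i * w i) = d j * w j + (\<Sum>i\<in>I'. d i * w i)"
        using v less.prems by (simp add: I'_def sum.remove)
      also have "(\<Sum>i\<in>I'. d i * w i) = v j * (\<Sum>i\<in>I'. c i * w i)"
        unfolding sum_distrib_left by (intro sum.cong) (auto simp: d_def I'_def)
      finally show ?thesis by (simp add: d_def mult.commute)
    qed
    have "(\<Sum>i\<in>I. d i * w i) = 0" if "w \<in> V" for w
    proof (cases "w = v")
      case False
      then have "(\<Sum>i\<in>I'. c i * (v j * w i - w j * v i)) = 0"
        using that by (intro c(2)) (auto simp: V'_def)
      then show ?thesis unfolding sum
        by (simp add: right_diff_distrib sum_subtractf sum_distrib_left mult_ac)
    qed (simp add: sum)
    moreover have "\<exists>i\<in>I. d i \<noteq> 0" using c(1) v by (auto simp: d_def I'_def)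
    ultimately show ?thesis by blast
  qed
qed

text \<open>At most \<open>|S|\<close> patterns on \<open>S\<close> satisfy a common affine relation, since together with the
  constant term there are \<open>|S| + 1\<close> unknown coefficients.\<close>

lemma low_complexity_relation:
  assumes S: "finite S" and X: "X \<noteq> {}" "finite A" "\<And>x s. x \<in> X \<Longrightarrow> x s \<in> A"
    and P: "card ((\<lambda>x. restrict x S) ` X) \<le> card S"
  obtains a c where "\<exists>s\<in>S. a s \<noteq> 0" "\<And>x. x \<in> X \<Longrightarrow> (\<Sum>s\<in>S. a s * x s) = (c::int)"
proof -
  let ?P = "(\<lambda>x. restrict x S) ` X"
  define E where "E = (\<lambda>(p::'a \<Rightarrow> int) i. case i of None \<Rightarrow> 1 | Some s \<Rightarrow> p s)"
  define I where "I = insert None (Some ` S)"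
  have "?P \<subseteq> (\<Pi>\<^sub>E s\<in>S. A)" using X by auto
  then have fP: "finite ?P" using S X(2) by (meson finite_PiE finite_subset)
  have "card I = Suc (card S)" using S by (simp add: I_def card_image)
  moreover have "card (E ` ?P) \<le> card ?P" using fP by (rule card_image_le)
  ultimately have "card (E ` ?P) < card I" using P by simp
  then obtain b where b: "\<exists>i\<in>I. b i \<noteq> 0" "\<And>v. v \<in> E ` ?P \<Longrightarrow> (\<Sum>i\<in>I. b i * v i) = 0"
    using integer_relation[of I "E ` ?P"] fP S by (auto simp: I_def)
  have rel: "b None + (\<Sum>s\<in>S. b (Some s) * x s) = 0" if "x \<in> X" for x
  proof -
    have "(\<Sum>i\<in>I. b i * E (restrict x S) i) = 0" using that by (intro b(2)) auto
    then show ?thesis using S by (simp add: I_def E_def sum.reindex)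
  qed
  have "\<exists>s\<in>S. b (Some s) \<noteq> 0"
  proof (rule ccontr)
    assume no: "\<not> ?thesis"
    obtain x where "x \<in> X" using X by auto
    then have "b None = 0" using rel[of x] no by simp
    then show False using b(1) no by (auto simp: I_def)
  qed
  moreover have "(\<Sum>s\<in>S. b (Some s) * x s) = - b None" if "x \<in> X" for x
    using rel[OF that] by simp
  ultimately show ?thesis by (rule that[of "\<lambda>s. b (Some s)"])
qed

lemma prime_dvd_binomial_remainder:
  fixes x y :: "'a::comm_ring_1"
  assumes p: "prime p"
  shows "of_nat p dvd (x + y) ^ p - x ^ p - y ^ p"
proof -
  have p0: "p > 0" using p by (simp add: prime_gt_0_nat)
  have split: "{..p} = insert 0 (insert p {0<..<p})" using p0 by auto
  have "(x + y) ^ p = (\<Sum>k\<le>p. of_nat (p choose k) * x ^ k * y ^ (p - k))"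
    by (rule binomial_ring)
  also have "\<dots> = y ^ p + x ^ p + (\<Sum>k\<in>{0<..<p}. of_nat (p choose k) * x ^ k * y ^ (p - k))"
    unfolding split using p0 by (subst sum.insert, simp, simp)+ simp
  finally have "(x + y) ^ p - x ^ p - y ^ p = (\<Sum>k\<in>{0<..<p}. of_nat (p choose k) * x ^ k * y ^ (p - k))"
    by simp
  moreover have "of_nat p dvd (of_nat (p choose k) :: 'a)" if "k \<in> {0<..<p}" for k
  proof -
    have "p dvd p choose k" using that p by (intro dvd_choose_prime) auto
    then obtain q where "p choose k = p * q" by (rule dvdE)
    then show ?thesis by simp
  qed
  ultimately show ?thesis by (auto intro!: dvd_sum dvd_mult2)
qed

lemma prime_dvd_sum_power_remainder:
  fixes c :: "'i \<Rightarrow> 'a::comm_ring_1"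
  assumes p: "prime p" and "finite S"
  shows "of_nat p dvd (\<Sum>s\<in>S. c s) ^ p - (\<Sum>s\<in>S. c s ^ p)"
  using assms(2)
proof (induction S rule: finite_induct)
  case empty
  then show ?case using p by (simp add: prime_gt_0_nat power_0_left)
next
  case (insert s S)
  have "(\<Sum>s\<in>insert s S. c s) ^ p - (\<Sum>s\<in>insert s S. c s ^ p)
    = ((c s + sum c S) ^ p - c s ^ p - sum c S ^ p) + (sum c S ^ p - (\<Sum>s\<in>S. c s ^ p))"
    using insert by simp
  then show ?case using insert.IH prime_dvd_binomial_remainder[OF p] by (metis dvd_add)
qed

lemma fermat_int:
  assumes p: "prime p" shows "int p dvd a ^ p - a"
proof -
  define n where "n = nat (a mod int p)"
  have p0: "p > 0" using p by (simp add: prime_gt_0_nat)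
  have n: "int n = a mod int p" using p0 by (simp add: n_def)
  have "int p dvd int n ^ p - int n"
    using prime_dvd_sum_power_remainder[OF p, of "{..<n}" "\<lambda>_. 1::int"] by simp
  then have "int n ^ p mod int p = int n mod int p"
    by (simp only: mod_eq_dvd_iff)
  then have "a ^ p mod int p = a mod int p"
    by (simp add: n power_mod)
  then show ?thesis by (simp only: mod_eq_dvd_iff)
qed

lemma single_power: "Poly_Mapping.single (s::int\<times>int) (a::int) ^ n = Poly_Mapping.single (int n *\<^sub>Z s) (a ^ n)"
  by (induction n) (auto simp: mult_single zscale_add)

lemma frag_of_power: "frag_of s ^ n = frag_of (int n *\<^sub>Z s)"
  using single_power[of s 1 n] by simp

definition const_config :: "config \<Rightarrow> bool" where
  "const_config x \<longleftrightarrow> (\<forall>g g'. x g = x g')"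

lemma const_config_act: "const_config x \<Longrightarrow> const_config (act f x)"
  unfolding const_config_def act_def by (intro allI sum.cong) auto

lemma const_config_act_diff:
  assumes "const_config (act f x)" "const_config (act f' x)"
  shows "const_config (act (f - f') x)"
  unfolding const_config_def
proof (intro allI)
  fix g g'
  have "act f x g = act f x g'" "act f' x g = act f' x g'"
    using assms unfolding const_config_def by blast+
  then show "act (f - f') x g = act (f - f') x g'" by (simp add: act_diff)
qed

lemma small_multiple_eq_0:
  fixes d :: int
  assumes "p dvd d" "\<bar>d\<bar> < p" shows "d = 0"
proof (rule ccontr)
  assume "d \<noteq> 0"
  then have "\<bar>p\<bar> \<le> \<bar>d\<bar>" using assms(1) by (rule dvd_imp_le_int)
  then show False using assms(2) by linarith
qed

text \<open>Kari and Szabados: if \<open>\<Sum>\<^sub>s a\<^sub>s X\<^sup>s\<close> maps a bounded integer configuration to a constant, then so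
  does \<open>\<Sum>\<^sub>s a\<^sub>s X\<^bsup>ps\<^esup>\<close> for every large prime \<open>p\<close>. It differs from the \<open>p\<close>-th power of the given
  polynomial by a multiple of \<open>p\<close>, so its values are congruent modulo \<open>p\<close>, and they are so small that
  congruent values are equal.\<close>

lemma constant_prime_dilation:
  assumes S: "finite S" and p: "prime p" and B: "\<And>g. \<bar>x g\<bar> \<le> B"
    and large: "int p > 2 * (\<Sum>s\<in>S. \<bar>a s\<bar> * B)"
    and const: "const_config (act (\<Sum>s\<in>S. Poly_Mapping.single (\<iota> s) (a s)) x)"
  shows "const_config (act (\<Sum>s\<in>S. Poly_Mapping.single (int p *\<^sub>Z \<iota> s) (a s)) x)"
proof -
  let ?f = "\<Sum>s\<in>S. Poly_Mapping.single (\<iota> s) (a s)"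
  let ?F = "\<Sum>s\<in>S. Poly_Mapping.single (int p *\<^sub>Z \<iota> s) (a s)"
  have "of_nat p dvd ?f ^ p - (\<Sum>s\<in>S. Poly_Mapping.single (int p *\<^sub>Z \<iota> s) (a s ^ p))"
    using prime_dvd_sum_power_remainder[OF p S, of "\<lambda>s. Poly_Mapping.single (\<iota> s) (a s)"]
    by (simp add: single_power)
  moreover have "of_nat p dvd (\<Sum>s\<in>S. Poly_Mapping.single (int p *\<^sub>Z \<iota> s) (a s ^ p)) - ?F"
  proof -
    have "of_nat p dvd Poly_Mapping.single (int p *\<^sub>Z \<iota> s) (a s ^ p) - Poly_Mapping.single (int p *\<^sub>Z \<iota> s) (a s)" for s
    proof -
      obtain b where "a s ^ p - a s = int p * b" using fermat_int[OF p] by (meson dvdE)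
      then have "Poly_Mapping.single (int p *\<^sub>Z \<iota> s) (a s ^ p) - Poly_Mapping.single (int p *\<^sub>Z \<iota> s) (a s)
        = of_nat p * Poly_Mapping.single (int p *\<^sub>Z \<iota> s) b"
        by (simp add: mult_single flip: single_diff single_of_nat)
      then show ?thesis by simp
    qed
    then show ?thesis by (auto simp flip: sum_subtractf intro!: dvd_sum)
  qed
  ultimately have "of_nat p dvd (?f ^ p - (\<Sum>s\<in>S. Poly_Mapping.single (int p *\<^sub>Z \<iota> s) (a s ^ p)))
      + ((\<Sum>s\<in>S. Poly_Mapping.single (int p *\<^sub>Z \<iota> s) (a s ^ p)) - ?F)"
    by (rule dvd_add)
  then have "of_nat p dvd ?f ^ p - ?F" by simp
  then obtain q where q: "?f ^ p - ?F = of_nat p * q" by (meson dvdE)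
  have "p > 0" using p by (simp add: prime_gt_0_nat)
  then have "?f ^ p = ?f ^ (p - 1) * ?f" by (rule power_minus_mult[symmetric])
  then have cp: "const_config (act (?f ^ p) x)" by (simp only: act_mult const_config_act[OF const])
  have F: "act ?F x g = act (?f ^ p) x g - int p * act q x g" for g
  proof -
    have "?F = ?f ^ p - of_nat p * q" unfolding q[symmetric] by simp
    then show ?thesis by (simp only: act_diff act_mult act_of_nat)
  qed
  have bound: "\<bar>act ?F x g\<bar> \<le> (\<Sum>s\<in>S. \<bar>a s\<bar> * B)" for g
  proof -
    have "act ?F x g = (\<Sum>s\<in>S. a s * x (g + int p *\<^sub>Z \<iota> s))" by (simp add: act_sum act_single)
    also have "\<bar>\<dots>\<bar> \<le> (\<Sum>s\<in>S. \<bar>a s * x (g + int p *\<^sub>Z \<iota> s)\<bar>)" by (rule sum_abs)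
    also have "\<dots> \<le> (\<Sum>s\<in>S. \<bar>a s\<bar> * B)" by (intro sum_mono) (simp add: abs_mult B mult_left_mono)
    finally show ?thesis .
  qed
  show ?thesis unfolding const_config_def
  proof (intro allI)
    fix g g'
    have "act (?f ^ p) x g = act (?f ^ p) x g'" using cp unfolding const_config_def by blast
    then have "act ?F x g - act ?F x g' = int p * (act q x g' - act q x g)"
      by (simp add: F right_diff_distrib)
    then have "int p dvd act ?F x g - act ?F x g'" by simp
    moreover have "\<bar>act ?F x g - act ?F x g'\<bar> < int p" using bound[of g] bound[of g'] large by linarith
    ultimately have "act ?F x g - act ?F x g' = 0" by (rule small_multiple_eq_0)
    then show "act ?F x g = act ?F x g'" by simp
  qed
qed

lemma constant_dilation:
  assumes S: "finite S" and B: "\<And>g. \<bar>x g\<bar> \<le> B"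
    and const: "const_config (act (\<Sum>s\<in>S. Poly_Mapping.single s (a s)) x)"
    and n: "n > 0" "\<And>p. prime p \<Longrightarrow> p dvd n \<Longrightarrow> int p > 2 * (\<Sum>s\<in>S. \<bar>a s\<bar> * B)"
  shows "const_config (act (\<Sum>s\<in>S. Poly_Mapping.single (int n *\<^sub>Z s) (a s)) x)"
  using n
proof (induction n rule: less_induct)
  case (less n)
  show ?case
  proof (cases "n = 1")
    case False
    then obtain p where p: "prime p" "p dvd n" using prime_factor_nat by blast
    then obtain k where k: "n = p * k" by blast
    have "k < n" "k > 0" using less.prems(1) k prime_gt_1_nat[OF p(1)] by auto
    then have "const_config (act (\<Sum>s\<in>S. Poly_Mapping.single (int k *\<^sub>Z s) (a s)) x)"
      by (intro less.IH) (use less.prems k in auto)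
    then show ?thesis
      using constant_prime_dilation[OF S p(1) B less.prems(2)[OF p], of "\<lambda>s. int k *\<^sub>Z s"]
      by (simp add: k)
  qed (use const in simp)
qed

text \<open>The dilations by \<open>1 + ir\<close> form a Vandermonde system in the monomials \<open>X\<^bsup>rs\<^esup>\<close>; eliminating all
  monomials but one leaves a product of difference operators.\<close>

lemma constant_vandermonde:
  assumes W: "finite W"
    and const: "\<And>i. const_config (act (\<Sum>s\<in>S. c s * y s ^ i) x)"
  shows "const_config (act (\<Sum>s\<in>S. c s * y s ^ i * (\<Prod>w\<in>W. y s - y w)) x)"
  using W
proof (induction W arbitrary: i rule: finite_induct)
  case (insert v W)
  let ?G = "\<lambda>i. \<Sum>s\<in>S. c s * y s ^ i * (\<Prod>w\<in>W. y s - y w)"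
  have "(\<Sum>s\<in>S. c s * y s ^ i * (\<Prod>w\<in>insert v W. y s - y w)) = ?G (Suc i) - y v * ?G i"
    using insert by (simp add: sum_distrib_left algebra_simps flip: sum_subtractf)
  moreover have "const_config (act (?G (Suc i)) x)" by (rule insert.IH)
  moreover have "const_config (act (y v * ?G i) x)"
    unfolding act_mult by (rule const_config_act[OF insert.IH])
  ultimately show ?case by (simp only: const_config_act_diff)
qed (use const in simp)

text \<open>For \<open>r = N!\<close> all prime factors of \<open>1 + ir\<close> exceed \<open>N\<close>, so these dilations of the relation are
  relations too. The Vandermonde elimination leaves a product of differences that maps \<open>\<eta>\<close> to a constant;
  one more difference, in the direction \<open>(1, 0)\<close>, annihilates it.\<close>

lemma low_complexity_difference_annihilator:
  assumes A: "finite A" "\<And>g. \<eta> g \<in> A" and low: "low_convex_complexity \<eta>"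
  obtains hs where "0 \<notin> set hs" "\<And>g. act (prod_list (map diffop hs)) \<eta> g = 0"
proof -
  obtain S where S: "S \<noteq> {}" "finite S" "pattern_complexity \<eta> S \<le> card S"
    using low by (auto simp: low_convex_complexity_def)
  have P: "card ((\<lambda>x. restrict x S) ` range (\<lambda>u. shift u \<eta>)) \<le> card S"
    using S(3) by (simp add: pattern_complexity_def image_image)
  obtain a c where a: "\<exists>s\<in>S. a s \<noteq> 0"
    and rel: "\<And>x. x \<in> range (\<lambda>u. shift u \<eta>) \<Longrightarrow> (\<Sum>s\<in>S. a s * x s) = c"
    by (rule low_complexity_relation[OF S(2) _ A(1) _ P]) (auto simp: A shift_apply)
  obtain s0 where s0: "s0 \<in> S" "a s0 \<noteq> 0" using a by auto
  have const: "const_config (act (\<Sum>s\<in>S. Poly_Mapping.single s (a s)) \<eta>)"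
  proof -
    have "act (\<Sum>s\<in>S. Poly_Mapping.single s (a s)) \<eta> g = c" for g
      using rel[of "shift g \<eta>"] by (simp add: act_sum act_single shift_apply add.commute)
    then show ?thesis by (simp add: const_config_def)
  qed
  obtain B where B: "\<And>g. \<bar>\<eta> g\<bar> \<le> B"
  proof
    fix g show "\<bar>\<eta> g\<bar> \<le> Max (abs ` A)" using A by (intro Max_ge) auto
  qed
  define N where "N = nat (2 * (\<Sum>s\<in>S. \<bar>a s\<bar> * B))"
  define r where "r = (fact N :: nat)"
  have dil: "const_config (act (\<Sum>s\<in>S. Poly_Mapping.single (int (1 + i * r) *\<^sub>Z s) (a s)) \<eta>)" for i
  proof (rule constant_dilation[OF S(2) B const])
    fix p assume p: "prime p" "p dvd 1 + i * r"
    have "\<not> p \<le> N"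
    proof
      assume "p \<le> N"
      then have "p dvd r" using p(1) by (simp add: r_def prime_dvd_fact_iff)
      then have "p dvd 1" using p(2) by (metis dvd_add_left_iff dvd_mult)
      then show False using p(1) by simp
    qed
    then show "2 * (\<Sum>s\<in>S. \<bar>a s\<bar> * B) < int p" by (simp add: N_def)
  qed simp
  define y where "y = (\<lambda>s. frag_of (int r *\<^sub>Z s))"
  have "(\<Sum>s\<in>S. Poly_Mapping.single (int (1 + i * r) *\<^sub>Z s) (a s)) = (\<Sum>s\<in>S. Poly_Mapping.single s (a s) * y s ^ i)" for i
    by (simp add: y_def frag_of_power mult_single zscale_add)
  then have "const_config (act (\<Sum>s\<in>S. Poly_Mapping.single s (a s) * y s ^ i) \<eta>)" for i
    using dil by simp
  then have "const_config (act (\<Sum>s\<in>S. Poly_Mapping.single s (a s) * y s ^ 0 * (\<Prod>w\<in>S - {s0}. y s - y w)) \<eta>)"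
    by (intro constant_vandermonde) (use S in auto)
  also have "(\<Sum>s\<in>S. Poly_Mapping.single s (a s) * y s ^ 0 * (\<Prod>w\<in>S - {s0}. y s - y w))
    = Poly_Mapping.single s0 (a s0) * (\<Prod>w\<in>S - {s0}. y s0 - y w)"
  proof -
    have "(\<Prod>w\<in>S - {s0}. y s - y w) = 0" if "s \<in> S - {s0}" for s
      using that S(2) by (intro prod_zero) auto
    then show ?thesis using S(2) s0(1) by (subst sum.remove[of _ s0]) auto
  qed
  finally have c1: "const_config (act (Poly_Mapping.single s0 (a s0) * (\<Prod>w\<in>S - {s0}. y s0 - y w)) \<eta>)" .
  let ?D = "\<Prod>w\<in>S - {s0}. diffop (int r *\<^sub>Z (s0 - w))"
  have "finite (S - {s0})" using S by simp
  then obtain ws where ws: "set ws = S - {s0}" "distinct ws" using finite_distinct_list by metis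
  have "\<exists>u. (\<Prod>w\<in>T. y s0 - y w) = frag_of u * (\<Prod>w\<in>T. diffop (int r *\<^sub>Z (s0 - w)))" if "finite T" for T
    using that
  proof (induction T rule: finite_induct)
    case empty show ?case by (rule exI[of _ 0]) simp
  next
    case (insert w T)
    then obtain u where u: "(\<Prod>w\<in>T. y s0 - y w) = frag_of u * (\<Prod>w\<in>T. diffop (int r *\<^sub>Z (s0 - w)))" by blast
    have "y s0 - y w = y w * diffop (int r *\<^sub>Z (s0 - w))"
      by (simp add: y_def diffop_def right_diff_distrib mult_single flip: zscale_add_right)
    then have "(\<Prod>w\<in>insert w T. y s0 - y w)
      = (y w * frag_of u) * (\<Prod>w\<in>insert w T. diffop (int r *\<^sub>Z (s0 - w)))"
      using insert u by (simp add: mult_ac)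
    then show ?case by (auto simp: y_def mult_single)
  qed
  then obtain u where u: "(\<Prod>w\<in>S - {s0}. y s0 - y w) = frag_of u * ?D" using S by blast
  have e: "act (Poly_Mapping.single s0 (a s0) * (\<Prod>w\<in>S - {s0}. y s0 - y w)) \<eta> g
    = a s0 * act ?D \<eta> (g + s0 + u)" for g
    unfolding u act_mult act_single act_frag_of by simp
  have Dc: "act ?D \<eta> (g + s0 + u) = act ?D \<eta> (g' + s0 + u)" for g g'
  proof -
    have "a s0 * act ?D \<eta> (g + s0 + u) = a s0 * act ?D \<eta> (g' + s0 + u)"
      using c1 unfolding const_config_def e by blast
    then show ?thesis using s0 by simp
  qed
  have D0: "act ?D \<eta> g = act ?D \<eta> g'" for g g'
    using Dc[of "g - s0 - u" "g' - s0 - u"] by (simp add: add_ac)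
  define hs where "hs = (1, 0) # map (\<lambda>w. int r *\<^sub>Z (s0 - w)) ws"
  have "prod_list (map diffop hs) = diffop (1, 0) * ?D"
    using ws by (simp add: hs_def prod.distinct_set_conv_list[symmetric] o_def flip: ws(1))
  then have "act (prod_list (map diffop hs)) \<eta> g = 0" for g
    using D0[of "g + (1, 0)" g] by (simp add: act_mult act_diffop)
  moreover have "0 \<notin> set hs"
  proof -
    have "r > 0" unfolding r_def by (rule fact_gt_zero)
    then have "int r *\<^sub>Z (s0 - w) \<noteq> 0" if "w \<in> set ws" for w
      using that ws(1) by auto
    moreover have "(1, 0) \<noteq> (0 :: int \<times> int)" by (simp add: prod_eq_iff)
    ultimately show ?thesis unfolding hs_def by force
  qed
  ultimately show ?thesis using that by blast
qed

definition nonparallel :: "(int \<times> int) set \<Rightarrow> bool" where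
  "nonparallel J \<longleftrightarrow> finite J \<and> 0 \<notin> J \<and> (\<forall>h\<in>J. \<forall>k\<in>J. h \<noteq> k \<longrightarrow> cross h k \<noteq> 0)"

abbreviation "diffprod J \<equiv> \<Prod>j\<in>J. diffop j"

lemma diffop_square_kills:
  assumes "\<And>g. \<bar>x g\<bar> \<le> B" "\<And>g. act (diffop k * diffop k * f) x g = 0"
  shows "act (diffop k * f) x g = 0"
proof -
  obtain C where "\<And>g. \<bar>act f x g\<bar> \<le> C" using act_bounded[of x B, OF assms(1)] by blast
  then show ?thesis
    using bounded_double_difference[of "act f x" C UNIV k g] assms(2) by (simp add: act_mult)
qed

text \<open>Both parallel factors divide the difference operator of a common multiple, so their product divides
  its square, and on bounded configurations the square has the same kernel as the operator.\<close>

lemma merge_parallel_differences: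
  assumes bd: "\<And>g. \<bar>x g\<bar> \<le> B" and k: "k = c *\<^sub>Z h" "k = d *\<^sub>Z j"
    and kill: "\<And>g. act (diffop h * diffop j * f) x g = 0"
  shows "act (diffop k * f) x g = 0"
proof (rule diffop_square_kills[OF bd])
  fix g
  have "diffop h dvd diffop k" unfolding k(1) by (rule diffop_multiple_dvd)
  moreover have "diffop j dvd diffop k" unfolding k(2) by (rule diffop_multiple_dvd)
  ultimately have "diffop h * diffop j * f dvd diffop k * diffop k * f"
    by (intro mult_dvd_mono) auto
  then show "act (diffop k * diffop k * f) x g = 0" using kill by (rule act_dvd_kills)
qed

lemma nonparallel_annihilator:
  assumes "\<And>g. \<bar>x g\<bar> \<le> B" "0 \<notin> set hs" "\<And>g. act (prod_list (map diffop hs)) x g = 0"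
  shows "\<exists>J. nonparallel J \<and> card J \<le> length hs \<and> (\<forall>g. act (diffprod J) x g = 0)"
  using assms
proof (induction hs arbitrary: x B)
  case Nil
  then show ?case by (intro exI[of _ "{}"]) (auto simp: nonparallel_def)
next
  case (Cons h hs)
  obtain C where C: "\<And>g. \<bar>act (diffop h) x g\<bar> \<le> C" using act_bounded[of x B, OF Cons.prems(1)] by blast
  have "act (prod_list (map diffop hs)) (act (diffop h) x) g = 0" for g
    using Cons.prems(3)[of g] by (simp add: mult.commute flip: act_mult)
  then have "\<exists>J. nonparallel J \<and> card J \<le> length hs \<and> (\<forall>g. act (diffprod J) (act (diffop h) x) g = 0)"
    using Cons.prems(2) by (intro Cons.IH[of "act (diffop h) x" C] C) auto
  then obtain J where J: "nonparallel J" "card J \<le> length hs" "\<And>g. act (diffprod J) (act (diffop h) x) g = 0"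
    by blast
  have h0: "h \<noteq> 0" using Cons.prems(2) by auto
  have finJ: "finite J" using J(1) by (simp add: nonparallel_def)
  have kill: "act (diffop h * diffprod J) x g = 0" for g
    using J(3)[of g] by (simp add: mult.commute flip: act_mult)
  show ?case
  proof (cases "\<exists>j\<in>J. cross h j = 0")
    case False
    then have "h \<notin> J" by auto
    then have "act (diffprod (insert h J)) x g = 0" for g using kill finJ by simp
    moreover have "nonparallel (insert h J)"
      using False J(1) h0 cross_commute[of h] by (auto simp: nonparallel_def)
    ultimately show ?thesis using J(2) finJ \<open>h \<notin> J\<close> by (intro exI[of _ "insert h J"]) auto
  next
    case True
    then obtain j where j: "j \<in> J" "cross h j = 0" by blast
    have j0: "j \<noteq> 0" using j J(1) by (auto simp: nonparallel_def)
    obtain c d where cd: "c > 0" "d \<noteq> 0" "c *\<^sub>Z h = d *\<^sub>Z j"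
      using parallel_common_multiple[OF j(2) h0 j0] .
    define k where "k = d *\<^sub>Z j"
    have k0: "k \<noteq> 0" using cd j0 by (simp add: k_def)
    have ck: "cross k l \<noteq> 0" "cross l k \<noteq> 0" if "l \<in> J - {j}" for l
    proof -
      have "cross j l \<noteq> 0" "cross l j \<noteq> 0" using that j J(1) by (auto simp: nonparallel_def)
      then show "cross k l \<noteq> 0" "cross l k \<noteq> 0" using cd(2) by (auto simp: k_def)
    qed
    then have kJ: "k \<notin> J - {j}" by fastforce
    have "act (diffop h * diffop j * diffprod (J - {j})) x g = 0" for g
      using kill finJ j(1) by (simp add: prod.remove mult.assoc)
    then have "act (diffop k * diffprod (J - {j})) x g = 0" for g
      using merge_parallel_differences[OF Cons.prems(1), of k c h d j] cd by (simp add: k_def)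
    then have "act (diffprod (insert k (J - {j}))) x g = 0" for g using kJ finJ by simp
    moreover have "nonparallel (insert k (J - {j}))"
      using J(1) ck k0 by (auto simp: nonparallel_def)
    moreover have "card (insert k (J - {j})) = card J"
      using kJ finJ j(1) by (metis card.insert card_Suc_Diff1 finite_Diff)
    ultimately show ?thesis using J(2) by (intro exI[of _ "insert k (J - {j})"]) auto
  qed
qed

section \<open>Annihilators and periodic decompositions\<close>

text \<open>Indefinite summation over the integers.\<close>

definition antidifference :: "(int \<Rightarrow> int) \<Rightarrow> int \<Rightarrow> int" where
  "antidifference e n = (if n \<ge> 0 then \<Sum>i\<in>{0..<n}. e i else - (\<Sum>i\<in>{n..<0}. e i))"

lemma antidifference: "antidifference e (n + 1) = antidifference e n + e n"
proof (cases "n \<ge> 0")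
  case True
  have "{0..<n + 1} = insert n {0..<n}" using True by auto
  then show ?thesis using True by (simp add: antidifference_def)
next
  case False
  have "{n..<0} = insert n {n + 1..<0}" using False by auto
  then show ?thesis using False by (cases "n = -1") (auto simp: antidifference_def)
qed

text \<open>The solution sums \<open>c\<close> along \<open>h\<close>, starting near the line through \<open>j\<close>. The number of steps \<open>\<alpha> g\<close> is the
  integer part of the coordinate of \<open>g\<close> along \<open>h\<close> in the basis \<open>h\<close>, \<open>j\<close>; it does not change when \<open>j\<close> is
  added, and so neither does the sum.\<close>

lemma solve_difference:
  assumes hj: "cross h j \<noteq> 0" and c: "\<And>g. c (g + j) = c g"
  obtains d where "\<And>g. d (g + j) = d g" "\<And>g. act (diffop h) d g = c g"
proof -
  define \<alpha> where "\<alpha> = (\<lambda>g. cross j g div cross j h)"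
  define d where "d = (\<lambda>g. antidifference (\<lambda>i. c (g - \<alpha> g *\<^sub>Z h + i *\<^sub>Z h)) (\<alpha> g))"
  have jh: "cross j h \<noteq> 0" using hj cross_commute[of j h] by simp
  have ah: "\<alpha> (g + h) = \<alpha> g + 1" and aj: "\<alpha> (g + j) = \<alpha> g" for g
    using jh by (auto simp: \<alpha>_def)
  have "d (g + j) = d g" for g
  proof -
    have "c (g + j - \<alpha> g *\<^sub>Z h + i *\<^sub>Z h) = c (g - \<alpha> g *\<^sub>Z h + i *\<^sub>Z h)" for i
      using c[of "g - \<alpha> g *\<^sub>Z h + i *\<^sub>Z h"] by (simp add: algebra_simps)
    then show ?thesis by (simp add: d_def aj)
  qed
  moreover have "act (diffop h) d g = c g" for g
  proof -
    have "g + h - (\<alpha> g + 1) *\<^sub>Z h = g - \<alpha> g *\<^sub>Z h" by (simp add: zscale_add)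
    then have "d (g + h) = d g + c (g - \<alpha> g *\<^sub>Z h + \<alpha> g *\<^sub>Z h)"
      by (simp only: d_def ah antidifference)
    then show ?thesis by (simp add: act_diffop)
  qed
  ultimately show ?thesis using that by blast
qed

text \<open>By induction \<open>(X\<^sup>h - 1) x\<close> is a sum of periodic configurations. Each of them is integrated along \<open>h\<close>,
  and what remains of \<open>x\<close> is \<open>h\<close>-periodic.\<close>

lemma annihilator_decomposition:
  assumes "nonparallel J" "J \<noteq> {}" "\<And>g. act (diffprod J) x g = 0"
  shows "\<exists>c. (\<forall>j\<in>J. \<forall>g. c j (g + j) = c j g) \<and> (\<forall>g. x g = (\<Sum>j\<in>J. c j g))"
proof -
  have "finite J" using assms by (simp add: nonparallel_def)
  then show ?thesis using assms(2,1,3)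
  proof (induction J arbitrary: x rule: finite_ne_induct)
    case (singleton j)
    then show ?case by (intro exI[of _ "\<lambda>_. x"]) (auto simp: act_diffop)
  next
    case (insert h J)
    have "nonparallel J" using insert.prems by (auto simp: nonparallel_def)
    moreover have "act (diffprod J) (act (diffop h) x) g = 0" for g
      using insert.prems(2)[of g] insert.hyps by (simp add: mult.commute flip: act_mult)
    ultimately obtain c where c: "\<And>j g. j \<in> J \<Longrightarrow> c j (g + j) = c j g"
      "\<And>g. act (diffop h) x g = (\<Sum>j\<in>J. c j g)"
      using insert.IH[of "act (diffop h) x"] by blast
    have "\<forall>j\<in>J. \<exists>d. (\<forall>g. d (g + j) = d g) \<and> (\<forall>g. act (diffop h) d g = c j g)"
    proof
      fix j assume j: "j \<in> J"
      then have hj: "cross h j \<noteq> 0" using insert by (auto simp: nonparallel_def)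
      show "\<exists>d. (\<forall>g. d (g + j) = d g) \<and> (\<forall>g. act (diffop h) d g = c j g)"
        by (rule solve_difference[OF hj, of "c j"], rule c(1)[OF j]) blast
    qed
    from bchoice[OF this] obtain d where
      d': "\<forall>j\<in>J. (\<forall>g. d j (g + j) = d j g) \<and> (\<forall>g. act (diffop h) (d j) g = c j g)" ..
    then have d: "\<And>j g. j \<in> J \<Longrightarrow> d j (g + j) = d j g"
      "\<And>j g. j \<in> J \<Longrightarrow> act (diffop h) (d j) g = c j g"
      by auto
    define d' where "d' = d(h := (\<lambda>g. x g - (\<Sum>j\<in>J. d j g)))"
    have "act (diffop h) (\<lambda>g. x g - (\<Sum>j\<in>J. d j g)) g = 0" for g
      by (simp add: act_linear_diff act_linear_sum c(2) d(2) cong: sum.cong)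
    then have "d' h (g + h) = d' h g" for g by (simp add: d'_def act_diffop)
    moreover have "d' j = d j" if "j \<in> J" for j using that insert.hyps by (auto simp: d'_def)
    ultimately have "\<forall>j\<in>insert h J. \<forall>g. d' j (g + j) = d' j g" using d(1) by auto
    moreover have "\<forall>g. x g = (\<Sum>j\<in>insert h J. d' j g)"
      using insert.hyps \<open>\<And>j. j \<in> J \<Longrightarrow> d' j = d j\<close> by (simp add: d'_def cong: sum.cong)
    ultimately show ?case by blast
  qed
qed

lemma annihilator_imp_periodic_decomposition:
  assumes J: "nonparallel J" "J \<noteq> {}" "\<And>g. act (diffprod J) x g = 0"
  obtains d where "periodic_decomposition (card J) d x"
proof -
  obtain c where c: "\<And>j g. j \<in> J \<Longrightarrow> c j (g + j) = c j g" "\<And>g. x g = (\<Sum>j\<in>J. c j g)"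
    using annihilator_decomposition[OF assms] by blast
  have fin: "finite J" using J by (simp add: nonparallel_def)
  then obtain b where b: "bij_betw b {1..card J} J" using ex_bij_betw_nat_finite_1 by blast
  have "periodic (c (b i))" if i: "i \<in> {1..card J}" for i
  proof -
    have "b i \<in> J" using b i by (meson bij_betwE)
    then have "is_period (b i) (c (b i))" using c(1) J(1) by (auto simp: is_period_def nonparallel_def)
    then show ?thesis by (auto simp: periodic_def)
  qed
  moreover have "x g = (\<Sum>i = 1..card J. c (b i) g)" for g
    using sum.reindex_bij_betw[OF b, of "\<lambda>j. c j g"] c(2) by simp
  moreover have "1 \<le> card J" using fin J(2) by (simp add: Suc_leI card_gt_0_iff)
  ultimately have "periodic_decomposition (card J) (\<lambda>i. c (b i)) x"
    by (auto simp: periodic_decomposition_def)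
  then show ?thesis using that by blast
qed

lemma decomposition_annihilator:
  assumes "finite I" "\<And>i. i \<in> I \<Longrightarrow> is_period (H i) (d i)" "\<And>g. x g = (\<Sum>i\<in>I. d i g)"
  shows "act (\<Prod>i\<in>I. diffop (H i)) x g = 0"
proof -
  have "act (\<Prod>i\<in>I. diffop (H i)) (d i) g = 0" if i: "i \<in> I" for i
  proof (rule act_dvd_kills)
    show "diffop (H i) dvd (\<Prod>i\<in>I. diffop (H i))" using assms(1) i by (rule dvd_prodI)
    show "act (diffop (H i)) (d i) g = 0" for g
      using assms(2)[OF i] by (simp add: act_diffop is_period_def)
  qed
  moreover have "x = (\<lambda>g. \<Sum>i\<in>I. d i g)" using assms(3) by auto
  ultimately show ?thesis by (simp add: act_linear_sum)
qed

lemma minimal_decomposition_le: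
  assumes min: "minimal_decomposition m d x" and J: "nonparallel J" "\<And>g. act (diffprod J) x g = 0"
  shows "m \<le> max 1 (card J)"
proof (cases "J = {}")
  case True
  then have "x g = 0" for g using J(2) by simp
  then have "periodic_decomposition 1 (\<lambda>_ _. 0) x"
    by (auto simp: periodic_decomposition_def periodic_def is_period_def zero_prod_def intro!: exI[of _ "(1,0)"])
  then have "m \<le> 1" using min unfolding minimal_decomposition_def by blast
  then show ?thesis by simp
next
  case False
  then obtain e where "periodic_decomposition (card J) e x"
    using annihilator_imp_periodic_decomposition J by metis
  then have "m \<le> card J" using min unfolding minimal_decomposition_def by blast
  then show ?thesis by simp
qed

text \<open>The periods of the terms of a minimal decomposition are pairwise non-parallel, since two
  terms with parallel periods could be merged.\<close>

lemma minimal_decomposition_nonparallel: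
  assumes min: "minimal_decomposition m d x" and bd: "\<And>g. \<bar>x g\<bar> \<le> B"
    and H: "\<And>i. i \<in> {1..m} \<Longrightarrow> is_period (H i) (d i)"
  shows "inj_on H {1..m}" "nonparallel (H ` {1..m})" "\<And>g. act (diffprod (H ` {1..m})) x g = 0"
proof -
  have kill: "act (\<Prod>i\<in>{1..m}. diffop (H i)) x g = 0" for g
    using min by (intro decomposition_annihilator[of _ H d] H)
      (auto simp: minimal_decomposition_def periodic_decomposition_def)
  have H0: "H i \<noteq> 0" if "i \<in> {1..m}" for i using H[OF that] by (simp add: is_period_def)
  have nonpar: "cross (H i) (H j) \<noteq> 0" if ij: "i \<in> {1..m}" "j \<in> {1..m}" "i \<noteq> j" for i j
  proof
    assume "cross (H i) (H j) = 0"
    then obtain c e where ce: "c > 0" "e \<noteq> 0" "c *\<^sub>Z H i = e *\<^sub>Z H j"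
      using parallel_common_multiple H0 ij by metis
    define k where "k = c *\<^sub>Z H i"
    define I where "I = {1..m} - {i, j}"
    obtain ks where ks: "set ks = I" "distinct ks"
      using finite_distinct_list[of I] by (auto simp: I_def)
    have "{1..m} = insert i (insert j I)" "i \<notin> insert j I" "j \<notin> I" "finite I"
      using ij by (auto simp: I_def)
    then have "(\<Prod>i\<in>{1..m}. diffop (H i)) = diffop (H i) * diffop (H j) * (\<Prod>i\<in>I. diffop (H i))"
      by (simp only: prod.insert finite_insert mult.assoc simp_thms not_False_eq_True)
    then have "act (diffop (H i) * diffop (H j) * (\<Prod>i\<in>I. diffop (H i))) x g = 0" for g
      using kill by simp
    then have "act (diffop k * (\<Prod>i\<in>I. diffop (H i))) x g = 0" for g
      using merge_parallel_differences[OF bd, of k c "H i" e "H j"] ce by (simp add: k_def)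
    moreover have "prod_list (map diffop (k # map H ks)) = diffop k * (\<Prod>i\<in>I. diffop (H i))"
      using ks by (simp add: prod.distinct_set_conv_list[symmetric] o_def flip: ks(1))
    moreover have "0 \<notin> set (k # map H ks)"
      using ce H0 ij ks by (auto simp: k_def I_def)
    ultimately have "\<exists>J. nonparallel J \<and> card J \<le> length (k # map H ks) \<and> (\<forall>g. act (diffprod J) x g = 0)"
      by (intro nonparallel_annihilator[of x B "k # map H ks"] bd) simp_all
    then obtain J where J: "nonparallel J" "card J \<le> length (k # map H ks)"
      "\<And>g. act (diffprod J) x g = 0"
      by blast
    have "length ks = m - 2" using distinct_card[OF ks(2)] ij by (simp add: ks I_def card_Diff_subset)
    moreover have "m \<ge> 2" using ij by auto
    ultimately show False using minimal_decomposition_le[OF min J(1,3)] J(2) by auto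
  qed
  show inj: "inj_on H {1..m}"
    by (rule inj_onI) (metis cross_simps(7) nonpar)
  show "nonparallel (H ` {1..m})" using H0 nonpar by (fastforce simp: nonparallel_def)
  show "act (diffprod (H ` {1..m})) x g = 0" for g
    unfolding prod.reindex[OF inj] o_def by (rule kill)
qed

section \<open>One-sided nonexpansive rational directions\<close>

text \<open>One-sided nonexpansiveness of the direction \<open>h\<close>, for an integer vector \<open>h\<close>.\<close>

definition ambiguous_above :: "config set \<Rightarrow> int \<times> int \<Rightarrow> bool" where
  "ambiguous_above X h \<longleftrightarrow> (\<exists>x\<in>X. \<exists>y\<in>X. x \<noteq> y \<and> agree_on {g. cross h g \<ge> 0} x y)"

lemma not_ambiguousD:
  assumes X: "subshift A X" and na: "\<not> ambiguous_above X h" and h: "h \<noteq> 0"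
    and xy: "x \<in> X" "y \<in> X" "agree_on {g. cross h g > a} x y"
  shows "x = y"
proof -
  obtain v where v: "cross h v > 0" using exists_nonparallel[OF h] .
  define u where "u = (\<bar>a\<bar> + 1) *\<^sub>Z v"
  have "\<bar>a\<bar> + 1 \<le> (\<bar>a\<bar> + 1) * cross h v"
    using mult_left_mono[of 1 "cross h v" "\<bar>a\<bar> + 1"] v by simp
  then have u: "cross h u > a" unfolding u_def cross_simps by linarith
  have "agree_on {g. cross h g \<ge> 0} (shift u x) (shift u y)"
    using xy(3) u by (auto simp: agree_on_def shift_apply)
  then have "shift u x = shift u y"
    using na xy X unfolding ambiguous_above_def by (meson subshiftD(4))
  then show ?thesis by simp
qed

text \<open>By compactness the value at a point is determined by finitely many points above it; \<open>N\<close> is their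
  largest height. So the rows below a strip of \<open>N\<close> rows are determined one after the other.\<close>

lemma strip_determines_below:
  assumes X: "subshift A X" and na: "\<not> ambiguous_above X h" and h: "h \<noteq> 0"
  shows "\<exists>N>0. \<forall>x\<in>X. \<forall>y\<in>X. \<forall>a g. agree_on {g. a < cross h g \<and> cross h g \<le> a + N} x y \<longrightarrow>
       cross h g \<le> a + N \<longrightarrow> x g = y g"
proof -
  have det: "x 0 = y 0" if "x \<in> X" "y \<in> X" "agree_on {g. cross h g > 0} x y" for x y
    using not_ambiguousD[OF X na h that] by simp
  have "\<exists>F. finite F \<and> F \<subseteq> {g. cross h g > 0} \<and> (\<forall>x\<in>X. \<forall>y\<in>X. agree_on F x y \<longrightarrow> x 0 = y 0)"
    by (rule finite_determination[OF X]) (rule det)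
  then obtain F where F: "finite F" "F \<subseteq> {g. cross h g > 0}"
    "\<forall>x\<in>X. \<forall>y\<in>X. agree_on F x y \<longrightarrow> x 0 = y 0"
    by blast
  define N where "N = Max (insert 1 (cross h ` F))"
  have N: "N > 0" "\<And>f. f \<in> F \<Longrightarrow> cross h f \<le> N"
    using F(1) by (auto simp: N_def intro: Max_ge order.strict_trans2[of 0 1])
  have "x g = y g" if xy: "x \<in> X" "y \<in> X" and ag: "agree_on {g. a < cross h g \<and> cross h g \<le> a + N} x y"
    and g: "cross h g \<le> a + N" for x y a g
    using g
  proof (induction "nat (a + N - cross h g)" arbitrary: g rule: less_induct)
    case less
    show ?case
    proof (cases "a < cross h g")
      case True
      then show ?thesis using ag less.prems by (auto simp: agree_on_def)
    next
      case False
      have "agree_on F (shift g x) (shift g y)"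
        unfolding agree_on_def
      proof
        fix f assume f: "f \<in> F"
        have "cross h (f + g) \<le> a + N" using N(2)[OF f] False by simp
        moreover have "cross h f > 0" using F(2) f by auto
        then have "nat (a + N - cross h (f + g)) < nat (a + N - cross h g)" using less.prems False N(1) by simp
        ultimately show "shift g x f = shift g y f" using less.hyps by (simp add: shift_apply)
      qed
      then have "shift g x 0 = shift g y 0"
        by (intro F(3)[rule_format]) (use xy X in \<open>auto simp: subshiftD\<close>)
      then show ?thesis by (simp add: shift_apply)
    qed
  qed
  then show ?thesis using N(1) by blast
qed

text \<open>Translations by multiples of \<open>v\<close> move only \<open>z\<close>, and \<open>z\<close> is given by its values on one period of each
  row, so there are finitely many possibilities for \<open>N\<close> rows of \<open>z\<close>. If \<open>N\<close> rows determined the rows below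
  them, two equal blocks of rows of \<open>z\<close> would make \<open>z\<close> periodic along \<open>v\<close> below them. The lemma applies to
  \<open>h\<close> and to \<open>- h\<close> alike.\<close>

lemma ambiguous_from_sum:
  assumes X: "subshift A X" and h: "h \<noteq> 0" and v: "cross h v \<noteq> 0"
    and y: "\<And>g. y (g + v) = y g" "\<And>g. \<bar>y g\<bar> \<le> B" and z: "\<And>g. z (g + h) = z g"
    and sum: "(\<lambda>g. y g + z g) \<in> X"
    and aper: "\<And>k. k > 0 \<Longrightarrow> \<exists>g. z (g + k *\<^sub>Z v) \<noteq> z g"
  shows "ambiguous_above X h"
proof (rule ccontr)
  assume na: "\<not> ambiguous_above X h"
  obtain N where N: "N > 0"
    "\<forall>x\<in>X. \<forall>y\<in>X. \<forall>a g. agree_on {g. a < cross h g \<and> cross h g \<le> a + N} x y \<longrightarrow>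
       cross h g \<le> a + N \<longrightarrow> x g = y g"
    using strip_determines_below[OF X na h] by blast
  obtain C where C: "\<forall>x\<in>X. \<forall>g. \<bar>x g\<bar> \<le> C" using subshift_bounded[OF X] by blast
  define w where "w = (if cross h v > 0 then v else - v)"
  have w: "cross h w > 0" using v by (auto simp: w_def)
  have yw: "y (g + w) = y g" for g
    using y(1)[of g] y(1)[of "g - v"] by (auto simp: w_def)
  define D where "D = C + B"
  have zD: "\<bar>z g\<bar> \<le> D" for g
  proof -
    have "\<bar>y g + z g\<bar> \<le> C" using bspec[OF C sum] by simp
    then show ?thesis using y(2)[of g] by (simp add: D_def)
  qed
  obtain E where E: "finite E" "E \<subseteq> {g. 1 \<le> cross h g \<and> cross h g \<le> N}"
    "\<And>g. 1 \<le> cross h g \<Longrightarrow> cross h g \<le> N \<Longrightarrow> \<exists>k. g + k *\<^sub>Z h \<in> E"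
    using strip_finite_mod[OF h, of 1 N] by blast
  \<comment> \<open>There are at most \<open>Q\<close> blocks, so all the periods found by the pigeonhole principle divide \<open>Q!\<close>.\<close>
  define Q where "Q = card (\<Pi>\<^sub>E e\<in>E. {- D..D})"
  define r where "r = (\<lambda>k::nat. restrict (\<lambda>e. z (e + int k *\<^sub>Z w)) E)"
  have fin: "finite (\<Pi>\<^sub>E e\<in>E. {- D..D})" using E(1) by (simp add: finite_PiE)
  have r: "r k \<in> (\<Pi>\<^sub>E e\<in>E. {- D..D})" for k
  proof -
    have "- D \<le> z g \<and> z g \<le> D" for g using zD[of g] by linarith
    then show ?thesis by (auto simp: r_def)
  qed
  have per: "z (g + int (fact Q) *\<^sub>Z w) = z g" for g
  proof -
    \<comment> \<open>Equal blocks are sought above \<open>g\<close>, at a height that leaves room for \<open>Q!\<close> steps.\<close>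
    define K :: nat where "K = nat \<bar>cross h g\<bar> + fact Q"
    have "\<not> inj_on r {K..K + Q}"
    proof
      assume "inj_on r {K..K + Q}"
      then have "card {K..K + Q} \<le> Q" unfolding Q_def
        by (rule card_inj_on_le) (use r fin in auto)
      then show False by simp
    qed
    then obtain k' l' where "k' \<in> {K..K + Q}" "l' \<in> {K..K + Q}" "r k' = r l'" "k' \<noteq> l'"
      unfolding inj_on_def by blast
    then obtain k l where kl: "K \<le> k" "k < l" "l \<le> K + Q" "r k = r l"
    proof (cases "k' < l'")
      case True
      then show thesis using that[of k' l'] \<open>k' \<in> _\<close> \<open>l' \<in> _\<close> \<open>r k' = r l'\<close> by simp
    next
      case False
      then show thesis using that[of l' k'] \<open>k' \<in> _\<close> \<open>l' \<in> _\<close> \<open>r k' = r l'\<close> \<open>k' \<noteq> l'\<close> by simp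
    qed
    have eq: "z (g' + int k *\<^sub>Z w) = z (g' + int l *\<^sub>Z w)" if g': "cross h g' \<le> N" for g'
    proof -
      have "agree_on {g. 0 < cross h g \<and> cross h g \<le> 0 + N}
          (shift (int k *\<^sub>Z w) (\<lambda>g. y g + z g)) (shift (int l *\<^sub>Z w) (\<lambda>g. y g + z g))"
        unfolding agree_on_def
      proof
        fix b assume "b \<in> {g. 0 < cross h g \<and> cross h g \<le> 0 + N}"
        then obtain i where i: "b + i *\<^sub>Z h \<in> E" using E(3)[of b] by auto
        have "z (b + i *\<^sub>Z h + int k *\<^sub>Z w) = z (b + i *\<^sub>Z h + int l *\<^sub>Z w)"
          using fun_cong[OF kl(4), of "b + i *\<^sub>Z h"] i by (simp add: r_def)
        moreover have "z (b + i *\<^sub>Z h + n *\<^sub>Z w) = z (b + n *\<^sub>Z w)" for n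
          using period_multiple[of z h "b + n *\<^sub>Z w" i] z by (simp add: add_ac)
        ultimately show "shift (int k *\<^sub>Z w) (\<lambda>g. y g + z g) b = shift (int l *\<^sub>Z w) (\<lambda>g. y g + z g) b"
          using period_multiple[of y w b] yw by (simp add: shift_apply)
      qed
      then have "shift (int k *\<^sub>Z w) (\<lambda>g. y g + z g) g' = shift (int l *\<^sub>Z w) (\<lambda>g. y g + z g) g'"
        using N(2)[rule_format, of "shift (int k *\<^sub>Z w) (\<lambda>g. y g + z g)" "shift (int l *\<^sub>Z w) (\<lambda>g. y g + z g)" 0 g']
          sum X g' by (simp add: subshiftD)
      then show ?thesis using period_multiple[of y w g'] yw by (simp add: shift_apply)
    qed
    define p where "p = l - k"
    have p: "p > 0" "p \<le> Q" using kl by (auto simp: p_def)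
    have low: "z (g' + int p *\<^sub>Z w) = z g'" if "cross h g' \<le> int k * cross h w" for g'
    proof -
      have "z (g' - int k *\<^sub>Z w + int k *\<^sub>Z w) = z (g' - int k *\<^sub>Z w + int l *\<^sub>Z w)"
        using that N(1) by (intro eq) simp
      moreover have "g' - int k *\<^sub>Z w + int l *\<^sub>Z w = g' + int p *\<^sub>Z w"
        using kl by (simp add: p_def of_nat_diff zscale_diff)
      ultimately show ?thesis by simp
    qed
    have step: "z (g + int (i * p) *\<^sub>Z w) = z g" if "i * p \<le> fact Q" for i
      using that
    proof (induction i)
      case (Suc i)
      have "cross h g + int (i * p) * cross h w \<le> int (K - fact Q) * cross h w + int (fact Q) * cross h w"
      proof (rule add_mono)
        have "cross h g \<le> int (K - fact Q)" by (simp add: K_def)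
        also have "\<dots> \<le> int (K - fact Q) * cross h w"
          using mult_left_mono[of 1 "cross h w" "int (K - fact Q)"] w by simp
        finally show "cross h g \<le> int (K - fact Q) * cross h w" .
        have "int (i * p) \<le> int (fact Q)" using Suc.prems by (simp only: of_nat_le_iff) simp
        then show "int (i * p) * cross h w \<le> int (fact Q) * cross h w"
          using w by (intro mult_right_mono) auto
      qed
      also have "\<dots> = int K * cross h w" by (simp add: K_def algebra_simps)
      also have "\<dots> \<le> int k * cross h w" using kl(1) w by simp
      finally have 1: "z (g + int (i * p) *\<^sub>Z w + int p *\<^sub>Z w) = z (g + int (i * p) *\<^sub>Z w)"
        by (intro low) simp
      have 2: "z (g + int (i * p) *\<^sub>Z w) = z g" using Suc by simp
      have 3: "g + int (i * p) *\<^sub>Z w + int p *\<^sub>Z w = g + int (Suc i * p) *\<^sub>Z w"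
        by (simp add: prod_eq_iff algebra_simps)
      show ?case by (rule trans[OF 1[unfolded 3] 2])
    qed simp
    have "p dvd fact Q" using p by (simp add: dvd_fact)
    then obtain i where "fact Q = p * i" by (rule dvdE)
    then show ?thesis using step[of i] by (simp add: mult.commute)
  qed
  have "z (g + int (fact Q) *\<^sub>Z v) = z g" for g
    using per[of g] per[of "g + int (fact Q) *\<^sub>Z v"] by (auto simp: w_def zscale_minus_right split: if_splits)
  moreover have "int (fact Q) > 0" by simp
  ultimately show False using aper by blast
qed

section \<open>Expansive directions\<close>

text \<open>If in every real direction \<open>\<theta>\<close> an open half plane determines its boundary point, then by
  compactness of the circle a lattice point far from the origin is determined by points
  strictly closer to the origin, so a large disc determines everything.\<close>

lemma all_directions_deterministic_imp_disc:
  assumes X: "subshift A X"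
    and det: "\<And>\<theta> x y. \<theta> \<noteq> 0 \<Longrightarrow> x \<in> X \<Longrightarrow> y \<in> X \<Longrightarrow> agree_on {g. emb g \<bullet> \<theta> < 0} x y \<Longrightarrow> x 0 = y 0"
  shows "\<exists>W. finite W \<and> (\<forall>x\<in>X. \<forall>y\<in>X. agree_on W x y \<longrightarrow> x = y)"
proof -
  have "\<forall>\<theta>\<in>sphere 0 1. \<exists>F. finite F \<and> F \<subseteq> {g. emb g \<bullet> \<theta> < 0} \<and>
      (\<forall>x\<in>X. \<forall>y\<in>X. agree_on F x y \<longrightarrow> x 0 = y 0)"
  proof
    fix \<theta> :: "real \<times> real" assume "\<theta> \<in> sphere 0 1"
    then have "\<theta> \<noteq> 0" by auto
    then have d: "x 0 = y 0" if "x \<in> X" "y \<in> X" "agree_on {g. emb g \<bullet> \<theta> < 0} x y" for x y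
      using det that by blast
    show "\<exists>F. finite F \<and> F \<subseteq> {g. emb g \<bullet> \<theta> < 0} \<and> (\<forall>x\<in>X. \<forall>y\<in>X. agree_on F x y \<longrightarrow> x 0 = y 0)"
      by (rule finite_determination[OF X]) (rule d)
  qed
  from bchoice[OF this] obtain F where FF: "\<forall>\<theta>\<in>sphere 0 1. finite (F \<theta>) \<and> F \<theta> \<subseteq> {g. emb g \<bullet> \<theta> < 0} \<and>
      (\<forall>x\<in>X. \<forall>y\<in>X. agree_on (F \<theta>) x y \<longrightarrow> x 0 = y 0)" ..
  have F: "finite (F \<theta>)" "\<And>g. g \<in> F \<theta> \<Longrightarrow> emb g \<bullet> \<theta> < 0"
    "\<And>x y. x \<in> X \<Longrightarrow> y \<in> X \<Longrightarrow> agree_on (F \<theta>) x y \<Longrightarrow> x 0 = y 0" if "\<theta> \<in> sphere 0 1" for \<theta>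
    using bspec[OF FF that] by blast+
  define c where "c = (\<lambda>\<theta>. Max (insert (- 1) ((\<lambda>g. emb g \<bullet> \<theta>) ` F \<theta>)))"
  have c: "c \<theta> < 0" "\<And>g. g \<in> F \<theta> \<Longrightarrow> emb g \<bullet> \<theta> \<le> c \<theta>" if "\<theta> \<in> sphere 0 1" for \<theta>
    using F(1,2)[OF that] by (auto simp: c_def)
  define V where "V = (\<lambda>\<theta>. {t. \<forall>g\<in>F \<theta>. emb g \<bullet> t < c \<theta> / 2})"
  have oV: "open (V \<theta>)" if "\<theta> \<in> sphere 0 1" for \<theta>
  proof -
    have "V \<theta> = (\<Inter>g\<in>F \<theta>. {t. emb g \<bullet> t < c \<theta> / 2})" by (auto simp: V_def)
    then show ?thesis using F(1)[OF that] by (auto intro!: open_INT open_Collect_less continuous_intros)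
  qed
  have "\<theta> \<in> V \<theta>" if "\<theta> \<in> sphere 0 1" for \<theta>
    using c[OF that] by (force simp: V_def)
  then have cov: "sphere 0 1 \<subseteq> (\<Union>\<theta>\<in>sphere 0 1. V \<theta>)" by blast
  obtain C where C: "C \<subseteq> sphere 0 1" "finite C" "sphere 0 1 \<subseteq> (\<Union>\<theta>\<in>C. V \<theta>)"
    by (rule compactE_image[OF compact_sphere[of 0 1] oV cov])
  define \<epsilon> where "\<epsilon> = Min (insert 1 ((\<lambda>\<theta>. - c \<theta> / 2) ` C))"
  have e: "\<epsilon> > 0" "\<And>\<theta>. \<theta> \<in> C \<Longrightarrow> \<epsilon> \<le> - c \<theta> / 2"
    using C(1,2) c(1) by (auto simp: \<epsilon>_def)
  define G where "G = (\<Union>\<theta>\<in>C. F \<theta>)"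
  have G: "finite G" using C F(1) by (auto simp: G_def)
  define M where "M = Max (insert 0 ((\<lambda>g. (norm (emb g))\<^sup>2) ` G))"
  have M: "M \<ge> 0" "\<And>g. g \<in> G \<Longrightarrow> (norm (emb g))\<^sup>2 \<le> M"
    using G by (auto simp: M_def)
  define R where "R = M / \<epsilon>"
  have R0: "R \<ge> 0" using M(1) e(1) by (simp add: R_def)
  define q where "q = (\<lambda>g::int\<times>int. (fst g)\<^sup>2 + (snd g)\<^sup>2)"
  have q: "real_of_int (q g) = (norm (emb g))\<^sup>2" for g
    by (simp add: q_def emb_def norm_Pair)
  define W where "W = {g. norm (emb g) \<le> R}"
  have "finite W"
  proof (rule finite_subset)
    show "W \<subseteq> window (nat \<lceil>R\<rceil>)"
    proof
      fix g assume "g \<in> W"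
      then have "norm (emb g) \<le> R" by (simp add: W_def)
      then have "\<bar>real_of_int (fst g)\<bar> \<le> R" "\<bar>real_of_int (snd g)\<bar> \<le> R"
        using norm_fst_le[of "real_of_int (fst g)" "real_of_int (snd g)"]
          norm_snd_le[of "real_of_int (snd g)" "real_of_int (fst g)"] by (auto simp: emb_def)
      then have "\<bar>fst g\<bar> \<le> \<lceil>R\<rceil>" "\<bar>snd g\<bar> \<le> \<lceil>R\<rceil>" by linarith+
      then show "g \<in> window (nat \<lceil>R\<rceil>)" using R0 by (cases g) (auto simp: window_def abs_le_iff)
    qed
  qed simp
  moreover have "x = y" if xy: "x \<in> X" "y \<in> X" "agree_on W x y" for x y
  proof
    fix g show "x g = y g"
    proof (induction "nat (q g)" arbitrary: g rule: less_induct)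
      case less
      show ?case
      proof (cases "norm (emb g) \<le> R")
        case True then show ?thesis using xy(3) by (auto simp: agree_on_def W_def)
      next
        case False
        define n where "n = norm (emb g)"
        have n: "n > R" "n > 0" using False M(1) e(1) by (auto simp: n_def R_def intro: le_less_trans[rotated])
        define t where "t = (1 / n) *\<^sub>R emb g"
        have "t \<in> sphere 0 1" using n by (simp add: t_def n_def)
        then obtain \<theta> where th: "\<theta> \<in> C" "t \<in> V \<theta>" using C(3) by blast
        have th1: "\<theta> \<in> sphere 0 1" using th(1) C(1) by blast
        have "agree_on (F \<theta>) (shift g x) (shift g y)" unfolding agree_on_def
        proof
          fix f assume f: "f \<in> F \<theta>"
          have "emb f \<bullet> t < c \<theta> / 2" using th(2) f by (auto simp: V_def)
          then have "emb f \<bullet> t < - \<epsilon>" using e(2)[OF th(1)] by simp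
          then have "n * (emb f \<bullet> t) < n * (- \<epsilon>)" using n(2) by (intro mult_strict_left_mono)
          then have ip: "emb f \<bullet> emb g < - (n * \<epsilon>)" using n(2) by (simp add: t_def)
          have "M < n * \<epsilon>" using n(1) e(1) by (simp add: R_def pos_divide_less_eq)
          moreover have "(norm (emb f))\<^sup>2 \<le> M" using M(2)[of f] f th(1) unfolding G_def by blast
          moreover have "emb (f + g) = emb f + emb g" by (simp add: emb_def)
          ultimately have "(norm (emb (f + g)))\<^sup>2 < (norm (emb g))\<^sup>2"
            using ip M(1) by (simp add: power2_norm_eq_inner inner_add_left inner_add_right inner_commute)
          then have "q (f + g) < q g" by (simp flip: q)
          moreover have "q (f + g) \<ge> 0" by (simp add: q_def)
          ultimately show "shift g x f = shift g y f" using less by (simp add: shift_apply)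
        qed
        then have "shift g x 0 = shift g y 0"
          by (intro F(3)[OF th1]) (use xy X in \<open>auto simp: subshiftD\<close>)
        then show ?thesis by (simp add: shift_apply)
      qed
    qed
  qed
  ultimately show ?thesis by blast
qed

text \<open>Pigeonhole: two horizontal translates of \<open>x\<close> agree on \<open>W\<close>.\<close>

lemma disc_determined_imp_periodic:
  assumes X: "subshift A X" and W: "finite W"
    and det: "\<And>x y. x \<in> X \<Longrightarrow> y \<in> X \<Longrightarrow> agree_on W x y \<Longrightarrow> x = y"
    and x: "x \<in> X"
  shows "periodic x"
proof -
  define r where "r = (\<lambda>n::nat. restrict (shift (int n, 0) x) W)"
  have "r n \<in> (\<Pi>\<^sub>E w\<in>W. A)" for n
    using X x by (auto simp: r_def subshiftD)
  then have "finite (range r)"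
    using W X by (meson finite_PiE finite_subset image_subsetI subshiftD(1))
  then have "\<not> inj r" using finite_imageD by fastforce
  then obtain m n where mn: "r m = r n" "m \<noteq> n" by (auto simp: inj_def)
  have "agree_on W (shift (int m, 0) x) (shift (int n, 0) x)"
    unfolding agree_on_def
  proof
    fix g assume "g \<in> W"
    then show "shift (int m, 0) x g = shift (int n, 0) x g" using fun_cong[OF mn(1), of g] by (simp add: r_def)
  qed
  then have eq: "shift (int m, 0) x = shift (int n, 0) x" using det X x by (simp add: subshiftD)
  have "is_period ((int m, 0) - (int n, 0)) x"
    unfolding is_period_def
  proof (intro conjI allI)
    show "(int m, 0) - (int n, 0) \<noteq> (0 :: int \<times> int)" using mn(2) by (simp add: prod_eq_iff)
    fix g :: "int \<times> int"
    have "g - (int n, 0) + (int m, 0) = g + ((int m, 0) - (int n, 0))" by (cases g) simp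
    then show "x (g + ((int m, 0) - (int n, 0))) = x g"
      using fun_cong[OF eq, of "g - (int n, 0)"] by (simp only: shift_apply diff_add_cancel)
  qed
  then show ?thesis by (auto simp: periodic_def)
qed

text \<open>If no direction in \<open>J\<close> is ambiguous, then all real directions are deterministic: those with a
  vector of \<open>J\<close> on the boundary by assumption, and all the others because a difference of two elements is
  killed by operators that move the levels of the functional. So a disc determines the elements.\<close>

lemma periodic_or_ambiguous:
  assumes X: "subshift A X" "X \<noteq> {}" and J: "nonparallel J"
    and kill: "\<And>x g. x \<in> X \<Longrightarrow> act (diffprod J) x g = 0"
  shows "(\<exists>x\<in>X. periodic x) \<or> (\<exists>j\<in>J. ambiguous_above X j \<or> ambiguous_above X (- j))"
proof (rule disjCI)
  assume na: "\<not> (\<exists>j\<in>J. ambiguous_above X j \<or> ambiguous_above X (- j))"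
  have lin: "emb (g + g') \<bullet> \<theta> = emb g \<bullet> \<theta> + emb g' \<bullet> \<theta>" for g g' \<theta>
  proof -
    have "emb (g + g') = emb g + emb g'" by (simp add: emb_def)
    then show ?thesis by (simp only: inner_add_left)
  qed
  have det: "x 0 = y 0" if th: "\<theta> \<noteq> 0" and xy: "x \<in> X" "y \<in> X" "agree_on {g. emb g \<bullet> \<theta> < 0} x y"
    for \<theta> x y
  proof (cases "\<exists>j\<in>J. emb j \<bullet> \<theta> = 0")
    case False
    define b where "b = (- 1 :: real)"
    have "x 0 - y 0 = 0"
    proof (rule zero_on_strip_imp_zero[where lam = "\<lambda>g. emb g \<bullet> \<theta>" and x = "\<lambda>g. x g - y g"
          and J = J and b = b and a = "b - (\<Sum>j\<in>J. \<bar>emb j \<bullet> \<theta>\<bar>)"])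
      show "act (diffprod J) (\<lambda>g. x g - y g) g = 0" for g
        using kill xy by (simp add: act_linear_diff)
      show "x g - y g = 0" if "emb g \<bullet> \<theta> \<le> b" for g
        using xy(3) that by (auto simp: agree_on_def b_def)
    qed (use False J lin in \<open>auto simp: nonparallel_def\<close>)
    then show ?thesis by simp
  next
    case True
    then obtain j where j: "j \<in> J" "emb j \<bullet> \<theta> = 0" by blast
    have j0: "j \<noteq> 0" using j J by (auto simp: nonparallel_def)
    obtain a b where ab: "j = (a, b)" by fastforce
    obtain p q where pq: "\<theta> = (p, q)" by fastforce
    have e: "real_of_int a * p + real_of_int b * q = 0" using j(2) by (simp add: ab pq emb_def)
    have "\<exists>s::real. s \<noteq> 0 \<and> p = - s * real_of_int b \<and> q = s * real_of_int a"
    proof (cases "a = 0")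
      case True
      then have "b \<noteq> 0" using j0 by (auto simp: ab prod_eq_iff)
      then show ?thesis using e True th pq by (intro exI[of _ "- p / b"]) (auto simp: zero_prod_def)
    next
      case False
      then have "p = - (q / real_of_int a) * real_of_int b" using e by (simp add: field_simps)
      moreover from this have "q \<noteq> 0" using th pq by (auto simp: zero_prod_def)
      ultimately show ?thesis using False by (intro exI[of _ "q / a"]) auto
    qed
    then obtain s where s: "s \<noteq> 0" "p = - s * real_of_int b" "q = s * real_of_int a" by blast
    have ip: "emb g \<bullet> \<theta> = s * real_of_int (cross j g)" for g
      by (simp add: emb_def pq s ab cross_def algebra_simps)
    define k where "k = (if s < 0 then j else - j)"
    have k: "k \<noteq> 0" "\<not> ambiguous_above X k" using na j j0 by (auto simp: k_def)
    have "emb g \<bullet> \<theta> < 0" if "cross k g > 0" for g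
      using that s(1) by (auto simp: ip k_def mult_less_0_iff split: if_splits)
    then have "agree_on {g. cross k g > 0} x y" using xy(3) by (auto simp: agree_on_def)
    then show ?thesis using not_ambiguousD[OF X(1) k(2,1) xy(1,2), of 0] by simp
  qed
  have "\<exists>W. finite W \<and> (\<forall>x\<in>X. \<forall>y\<in>X. agree_on W x y \<longrightarrow> x = y)"
    by (rule all_directions_deterministic_imp_disc[OF X(1)]) (rule det)
  then obtain W where W: "finite W" "\<forall>x\<in>X. \<forall>y\<in>X. agree_on W x y \<longrightarrow> x = y" by blast
  obtain x where x: "x \<in> X" using X(2) by blast
  have "periodic x"
  proof (rule disc_determined_imp_periodic[OF X(1) W(1) _ x])
    show "y = y'" if "y \<in> X" "y' \<in> X" "agree_on W y y'" for y y' using W(2) that by blast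
  qed
  then show "\<exists>x\<in>X. periodic x" using x by blast
qed

section \<open>Periodicity of one-dimensional sequences\<close>

definition factor :: "(int \<Rightarrow> 'a) \<Rightarrow> nat \<Rightarrow> int \<Rightarrow> 'a list" where
  "factor a l k = map (\<lambda>i. a (k + int i)) [0..<l]"

lemma length_factor [simp]: "length (factor a l k) = l"
  by (simp add: factor_def)

lemma factor_Suc: "factor a (Suc l) k = factor a l k @ [a (k + int l)]"
  by (simp add: factor_def)

lemma factor_Suc': "factor a (Suc l) k = a k # factor a l (k + 1)"
  by (simp add: factor_def map_upt_Suc add_ac del: upt_Suc)

text \<open>Two equal factors exist by the pigeonhole principle, and the equality propagates in both directions.\<close>

lemma deterministic_sequence_periodic:
  assumes fin: "finite (range (factor a l))" "card (range (factor a l)) \<le> C"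
    and det: "\<And>k k'. factor a l k = factor a l k' \<Longrightarrow> a (k + int l) = a (k' + int l) \<and> a (k - 1) = a (k' - 1)"
  shows "\<exists>p\<in>{1..C}. \<forall>k. a (k + int p) = a k"
proof -
  have "\<not> inj_on (\<lambda>n. factor a l (int n)) {0..C}"
  proof
    assume "inj_on (\<lambda>n. factor a l (int n)) {0..C}"
    then have "card {0..C} \<le> card (range (factor a l))"
      by (rule card_inj_on_le) (use fin in auto)
    then show False using fin by simp
  qed
  then obtain m' n' where mn': "m' \<le> C" "n' \<le> C" "m' \<noteq> n'" "factor a l (int m') = factor a l (int n')"
    unfolding inj_on_def by auto
  obtain m n where mn: "m < n" "n \<le> C" "factor a l (int m) = factor a l (int n)"
  proof (cases "m' < n'")
    case True then show thesis using that[of m' n'] mn' by simp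
  next
    case False then show thesis using that[of n' m'] mn' by simp
  qed
  have right: "factor a l (int m + int i) = factor a l (int n + int i)" for i
  proof (induction i)
    case (Suc i)
    have "factor a (Suc l) (int m + int i) = factor a (Suc l) (int n + int i)"
      using Suc det[OF Suc] by (simp add: factor_Suc)
    then show ?case by (simp add: factor_Suc' add_ac)
  qed (use mn in simp)
  have left: "factor a l (int m - int i) = factor a l (int n - int i)" for i
  proof (induction i)
    case (Suc i)
    have "factor a (Suc l) (int m - int i - 1) = factor a (Suc l) (int n - int i - 1)"
      using Suc det[OF Suc] by (simp add: factor_Suc')
    then show ?case by (simp add: factor_Suc algebra_simps)
  qed (use mn in simp)
  have all: "factor a l (int m + i) = factor a l (int n + i)" for i
    using right[of "nat i"] left[of "nat (- i)"] by (cases "i \<ge> 0") auto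
  have "a (k + int (n - m)) = a k" for k
  proof -
    have "a (int m + (k - int m - int l) + int l) = a (int n + (k - int m - int l) + int l)"
      using det[OF all[of "k - int m - int l"]] by simp
    then show ?thesis using mn by (simp add: of_nat_diff algebra_simps)
  qed
  moreover have "n - m \<in> {1..C}" using mn by auto
  ultimately show ?thesis by blast
qed

text \<open>Morse and Hedlund: if there are at most \<open>n\<close> factors of length \<open>n\<close>, then for some smaller length
  every factor extends uniquely to both sides.\<close>

lemma Morse_Hedlund:
  assumes n: "n > 0" and fin: "finite (range (factor a n))" and card: "card (range (factor a n)) \<le> n"
  shows "\<exists>p\<in>{1..n}. \<forall>k. a (k + int p) = a k"
proof -
  have butl: "butlast ` range (factor a (Suc l)) = range (factor a l)" for l
    by (auto simp: factor_Suc image_image)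
  have tll: "tl ` range (factor a (Suc l)) = range (factor a l)" for l
  proof -
    have "surj (\<lambda>k::int. k + 1)" by (rule surjI[of _ "\<lambda>k. k - 1"]) simp
    then have "factor a l ` range (\<lambda>k. k + 1) = range (factor a l)" by simp
    moreover have "tl ` range (factor a (Suc l)) = factor a l ` range (\<lambda>k. k + 1)"
      unfolding image_image by (simp add: factor_Suc')
    ultimately show ?thesis by simp
  qed
  have fl: "finite (range (factor a l)) \<and> card (range (factor a l)) \<le> card (range (factor a n))"
    if "l \<le> n" for l
    using that
  proof (induction l rule: inc_induct)
    case (step l)
    then show ?case using butl[of l] card_image_le[of "range (factor a (Suc l))" butlast]
      by (metis finite_imageI order_trans)
  qed (use fin in simp)
  have "\<exists>l<n. card (range (factor a l)) = card (range (factor a (Suc l)))"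
  proof (rule ccontr)
    assume no: "\<not> ?thesis"
    have "l < card (range (factor a l))" if "l \<le> n" for l
      using that
    proof (induction l)
      case 0
      have "range (factor a 0) = {[]}" by (auto simp: factor_def)
      then show ?case by simp
    next
      case (Suc l)
      have "card (range (factor a l)) \<le> card (range (factor a (Suc l)))"
        using butl[of l] card_image_le[of "range (factor a (Suc l))" butlast] fl[OF Suc.prems] by metis
      moreover have "card (range (factor a l)) \<noteq> card (range (factor a (Suc l)))" using no Suc.prems by auto
      ultimately show ?case using Suc by simp
    qed
    then have "n < card (range (factor a n))" by simp
    then show False using card by simp
  qed
  then obtain l where l: "l < n" "card (range (factor a l)) = card (range (factor a (Suc l)))" by blast
  have fs: "finite (range (factor a (Suc l)))" using fl[of "Suc l"] l by simp
  have ib: "inj_on butlast (range (factor a (Suc l)))" and it: "inj_on tl (range (factor a (Suc l)))"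
    using fs l(2) butl[of l] tll[of l] by (auto intro!: eq_card_imp_inj_on)
  have "\<exists>p\<in>{1..card (range (factor a l))}. \<forall>k. a (k + int p) = a k"
  proof (rule deterministic_sequence_periodic)
    fix k k' assume eq: "factor a l k = factor a l k'"
    have "factor a (Suc l) k = factor a (Suc l) k'"
      by (rule inj_onD[OF ib _ rangeI rangeI]) (simp add: factor_Suc eq)
    moreover have "factor a (Suc l) (k - 1) = factor a (Suc l) (k' - 1)"
      by (rule inj_onD[OF it _ rangeI rangeI]) (simp add: factor_Suc' eq)
    ultimately show "a (k + int l) = a (k' + int l) \<and> a (k - 1) = a (k' - 1)"
      by (simp add: factor_Suc[of a l k] factor_Suc[of a l k'] factor_Suc'[of a l "k - 1"] factor_Suc'[of a l "k' - 1"])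
  qed (use fl[of l] l in auto)
  moreover have "card (range (factor a l)) \<le> n" using fl[of l] l card by auto
  ultimately show ?thesis by force
qed

text \<open>The recurrence can be solved for its first and for its last term, so \<open>l\<close> consecutive values determine
  a sequence on both sides, and the number of such blocks of bounded values is finite. A common period of
  all solutions is the factorial of that number.\<close>

lemma bounded_recurrence_periodic:
  fixes c :: "int \<Rightarrow> int"
  assumes I: "finite I" "I \<noteq> {}" "\<And>i. i \<in> I \<Longrightarrow> c i \<noteq> 0"
  shows "\<exists>Q>0. \<forall>z. (\<forall>k. \<bar>z k\<bar> \<le> B) \<longrightarrow> (\<forall>k. (\<Sum>i\<in>I. c i * z (k + i)) = 0) \<longrightarrow> (\<forall>k. z (k + int Q) = z k)"
proof -
  define lo hi where "lo = Min I" and "hi = Max I"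
  have lohi: "lo \<in> I" "hi \<in> I" "\<And>i. i \<in> I \<Longrightarrow> lo \<le> i \<and> i \<le> hi"
    using I by (auto simp: lo_def hi_def)
  define l where "l = nat (hi - lo)"
  have l: "int l = hi - lo" using lohi by (simp add: l_def)
  define L where "L = {xs. set xs \<subseteq> {- B..B} \<and> length xs = l}"
  have L: "finite L" unfolding L_def by (rule finite_lists_length_eq) simp
  have per: "z (k + int (fact (card L))) = z k"
    if z: "\<And>k. \<bar>z k\<bar> \<le> B" "\<And>k. (\<Sum>i\<in>I. c i * z (k + i)) = 0" for z k
  proof -
    have "- B \<le> z k \<and> z k \<le> B" for k using z(1)[of k] by linarith
    then have "range (factor z l) \<subseteq> L" by (auto simp: L_def factor_def)
    then have R: "finite (range (factor z l))" "card (range (factor z l)) \<le> card L"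
      using L by (auto intro: finite_subset card_mono)
    have "\<exists>p\<in>{1..card L}. \<forall>k. z (k + int p) = z k"
    proof (rule deterministic_sequence_periodic[OF R])
      fix k k' assume "factor z l k = factor z l k'"
      then have A: "\<forall>i\<in>{0..<l}. z (k + int i) = z (k' + int i)" by (simp add: factor_def)
      have eq: "z (k + j) = z (k' + j)" if "0 \<le> j" "j < int l" for j
        using bspec[OF A, of "nat j"] that by (simp add: nat_less_iff)
      have "c hi * z (k + int l) = c hi * z (k' + int l)"
      proof -
        have e: "c hi * z (q + int l) = - (\<Sum>i\<in>I - {hi}. c i * z (q - lo + i))" for q
        proof -
          have idx: "q - lo + hi = q + int l" using l by simp
          have "c hi * z (q - lo + hi) + (\<Sum>i\<in>I - {hi}. c i * z (q - lo + i)) = 0"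
            using z(2)[of "q - lo"] sum.remove[OF I(1) lohi(2), of "\<lambda>i. c i * z (q - lo + i)"] by simp
          then show ?thesis unfolding idx by linarith
        qed
        have "(\<Sum>i\<in>I - {hi}. c i * z (k - lo + i)) = (\<Sum>i\<in>I - {hi}. c i * z (k' - lo + i))"
        proof (rule sum.cong)
          fix i assume "i \<in> I - {hi}"
          then have "0 \<le> i - lo" "i - lo < int l" using lohi(3)[of i] l by auto
          then show "c i * z (k - lo + i) = c i * z (k' - lo + i)"
            using eq[of "i - lo"] by (simp add: algebra_simps)
        qed simp
        then show ?thesis by (simp add: e)
      qed
      moreover have "c lo * z (k - 1) = c lo * z (k' - 1)"
      proof -
        have e: "c lo * z (q - 1) = - (\<Sum>i\<in>I - {lo}. c i * z (q - 1 - lo + i))" for q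
        proof -
          have "c lo * z (q - 1 - lo + lo) + (\<Sum>i\<in>I - {lo}. c i * z (q - 1 - lo + i)) = 0"
            using z(2)[of "q - 1 - lo"] sum.remove[OF I(1) lohi(1), of "\<lambda>i. c i * z (q - 1 - lo + i)"] by simp
          then show ?thesis by simp
        qed
        have "(\<Sum>i\<in>I - {lo}. c i * z (k - 1 - lo + i)) = (\<Sum>i\<in>I - {lo}. c i * z (k' - 1 - lo + i))"
        proof (rule sum.cong)
          fix i assume "i \<in> I - {lo}"
          then have "0 \<le> i - 1 - lo" "i - 1 - lo < int l" using lohi(3)[of i] l by auto
          then show "c i * z (k - 1 - lo + i) = c i * z (k' - 1 - lo + i)"
            using eq[of "i - 1 - lo"] by (simp add: algebra_simps)
        qed simp
        then show ?thesis by (simp add: e)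
      qed
      ultimately show "z (k + int l) = z (k' + int l) \<and> z (k - 1) = z (k' - 1)"
        using I(3) lohi by simp
    qed
    then obtain p where p: "p \<in> {1..card L}" "\<And>k. z (k + int p) = z k" by blast
    have mult: "z (k + int (i * p)) = z k" for i k
    proof (induction i)
      case (Suc i)
      have "z (k + int (Suc i * p)) = z (k + int (i * p) + int p)" by (simp add: algebra_simps)
      then show ?case using p(2) Suc by simp
    qed simp
    have "p dvd fact (card L)" using p by (intro dvd_fact) auto
    then obtain i where "fact (card L) = p * i" by (rule dvdE)
    then show ?thesis using mult[of k i] by (simp add: mult.commute)
  qed
  show ?thesis
  proof (intro exI[of _ "fact (card L)"] conjI allI impI)
    fix z k assume "\<forall>k. \<bar>z k\<bar> \<le> B" "\<forall>k. (\<Sum>i\<in>I. c i * z (k + i)) = 0"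
    then show "z (k + int (fact (card L))) = z k" by (intro per) auto
  qed simp
qed

section \<open>Convex windows with few patterns\<close>

text \<open>In this section the direction of interest is horizontal.\<close>

text \<open>If the relation involves only one row with unknown values, it is a recurrence for that row. One
  \<open>Q\<close> serves all configurations and rows, so that it can be fixed before the rows are processed.\<close>

lemma row_recurrence:
  fixes a :: "int \<times> int \<Rightarrow> int"
  assumes S: "finite S" and d: "\<exists>s\<in>S. snd s = d \<and> a s \<noteq> 0"
  shows "\<exists>Q>0. \<forall>z \<rho>. (\<forall>g. \<bar>z g\<bar> \<le> B) \<longrightarrow> (\<forall>g. (\<Sum>s\<in>S. a s * z (g + s)) = 0) \<longrightarrow>
    (\<forall>s\<in>S. a s \<noteq> 0 \<longrightarrow> snd s \<noteq> d \<longrightarrow> (\<forall>i. z (i, \<rho> - d + snd s) = 0)) \<longrightarrow>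
    (\<forall>i. z (i + int Q, \<rho>) = (z (i, \<rho>) :: int))"
proof -
  define I where "I = {i. (i, d) \<in> S \<and> a (i, d) \<noteq> 0}"
  have fI: "finite I"
  proof (rule finite_subset)
    show "I \<subseteq> fst ` S" by (force simp: I_def)
  qed (use S in simp)
  have I0: "I \<noteq> {}" using d by (auto simp: I_def)
  have "\<exists>Q>0. \<forall>z. (\<forall>k. \<bar>z k\<bar> \<le> B) \<longrightarrow> (\<forall>k. (\<Sum>i\<in>I. a (i, d) * z (k + i)) = 0) \<longrightarrow> (\<forall>k. z (k + int Q) = z k)"
    by (rule bounded_recurrence_periodic[OF fI I0]) (simp add: I_def)
  then obtain Q where Q: "Q > 0" "\<forall>z. (\<forall>k. \<bar>z k\<bar> \<le> B) \<longrightarrow> (\<forall>k. (\<Sum>i\<in>I. a (i, d) * z (k + i)) = 0) \<longrightarrow> (\<forall>k. z (k + int Q) = z k)"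
    by (elim exE conjE) (rule that)
  have "z (i + int Q, \<rho>) = z (i, \<rho>)"
    if z: "\<forall>g. \<bar>z g\<bar> \<le> B" "\<forall>g. (\<Sum>s\<in>S. a s * z (g + s)) = 0"
      "\<forall>s\<in>S. a s \<noteq> 0 \<longrightarrow> snd s \<noteq> d \<longrightarrow> (\<forall>i. z (i, \<rho> - d + snd s) = 0)" for z :: "int \<times> int \<Rightarrow> int" and \<rho> i
  proof -
    have "(\<Sum>i\<in>I. a (i, d) * z (k + i, \<rho>)) = 0" for k
    proof -
      have "(\<Sum>s\<in>S. a s * z ((k, \<rho> - d) + s)) = (\<Sum>s\<in>(\<lambda>i. (i, d)) ` I. a s * z ((k, \<rho> - d) + s))"
      proof (rule sum.mono_neutral_right)
        show "\<forall>s\<in>S - (\<lambda>i. (i, d)) ` I. a s * z ((k, \<rho> - d) + s) = 0"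
        proof
          fix s assume s: "s \<in> S - (\<lambda>i. (i, d)) ` I"
          obtain p q where pq: "s = (p, q)" by fastforce
          show "a s * z ((k, \<rho> - d) + s) = 0"
          proof (cases "a s = 0 \<or> q = d")
            case True then show ?thesis using s by (auto simp: pq I_def image_iff)
          next
            case False then show ?thesis using z(3) s by (auto simp: pq)
          qed
        qed
      qed (use S in \<open>auto simp: I_def\<close>)
      also have "\<dots> = (\<Sum>i\<in>I. a (i, d) * z (k + i, \<rho>))"
        by (subst sum.reindex) (auto simp: inj_on_def)
      finally show ?thesis using z(2) by simp
    qed
    then show ?thesis using Q(2)[rule_format, of "\<lambda>k. z (k, \<rho>)" i] z(1) by simp
  qed
  then show ?thesis using Q(1) by (intro exI[of _ Q]) simp
qed

text \<open>Once a strip as high as the support of an affine relation is periodic, the relation propagates a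
  period to all rows: the difference \<open>z = x(\<cdot> + P) - x\<close> vanishes on the strip, so on the next row it
  satisfies a recurrence, hence is periodic there, and by boundedness of \<open>x\<close> it vanishes there too.\<close>

lemma periodic_strip_imp_periodic:
  fixes x :: config and a :: "int \<times> int \<Rightarrow> int"
  assumes S: "finite S" "\<exists>s\<in>S. a s \<noteq> 0" "\<And>s. s \<in> S \<Longrightarrow> c0 \<le> snd s \<and> snd s \<le> c1"
    and bd: "\<And>g. \<bar>x g\<bar> \<le> B" and rel: "\<And>g. (\<Sum>s\<in>S. a s * x (g + s)) = (c::int)"
    and q: "q > 0" and strip: "\<And>i j. r < j \<Longrightarrow> j \<le> r + (c1 - c0) \<Longrightarrow> x (i + int q, j) = x (i, j)"
  shows "\<exists>P>0. \<forall>g. x (g + (int P, 0)) = x g"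
proof -
  define D where "D = snd ` {s \<in> S. a s \<noteq> 0}"
  have D: "finite D" "D \<noteq> {}" using S(1,2) by (auto simp: D_def)
  define d0 d1 where "d0 = Min D" and "d1 = Max D"
  have "d0 \<in> D" "d1 \<in> D" using D by (auto simp: d0_def d1_def)
  then have d0: "\<exists>s\<in>S. snd s = d0 \<and> a s \<noteq> 0" and d1: "\<exists>s\<in>S. snd s = d1 \<and> a s \<noteq> 0"
    unfolding D_def by blast+
  have dD: "d0 \<le> snd s \<and> snd s \<le> d1" if "s \<in> S" "a s \<noteq> 0" for s
    using that D(1) by (auto simp: d0_def d1_def D_def)
  have hd: "d1 - d0 \<le> c1 - c0"
  proof -
    obtain s s' where "s \<in> S" "snd s = d0" "s' \<in> S" "snd s' = d1" using d0 d1 by blast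
    then show ?thesis using S(3)[of s] S(3)[of s'] by linarith
  qed
  have hd0: "d0 \<le> d1" using d0 dD by auto
  obtain Q0 where Q0: "Q0 > 0" "\<forall>z \<rho>. (\<forall>g. \<bar>z g\<bar> \<le> 2 * B) \<longrightarrow> (\<forall>g. (\<Sum>s\<in>S. a s * z (g + s)) = 0) \<longrightarrow>
    (\<forall>s\<in>S. a s \<noteq> 0 \<longrightarrow> snd s \<noteq> d0 \<longrightarrow> (\<forall>i. z (i, \<rho> - d0 + snd s) = 0)) \<longrightarrow>
    (\<forall>i. z (i + int Q0, \<rho>) = (z (i, \<rho>) :: int))"
    using row_recurrence[OF S(1) d0, of "2 * B"] by (elim exE conjE) (rule that)
  obtain Q1 where Q1: "Q1 > 0" "\<forall>z \<rho>. (\<forall>g. \<bar>z g\<bar> \<le> 2 * B) \<longrightarrow> (\<forall>g. (\<Sum>s\<in>S. a s * z (g + s)) = 0) \<longrightarrow>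
    (\<forall>s\<in>S. a s \<noteq> 0 \<longrightarrow> snd s \<noteq> d1 \<longrightarrow> (\<forall>i. z (i, \<rho> - d1 + snd s) = 0)) \<longrightarrow>
    (\<forall>i. z (i + int Q1, \<rho>) = (z (i, \<rho>) :: int))"
    using row_recurrence[OF S(1) d1, of "2 * B"] by (elim exE conjE) (rule that)
  define P where "P = q * Q0 * Q1"
  have P: "P > 0" using q Q0 Q1 by (simp add: P_def)
  define z where "z = (\<lambda>g. x (g + (int P, 0)) - x g)"
  have zB: "\<forall>g. \<bar>z g\<bar> \<le> 2 * B"
  proof
    fix g show "\<bar>z g\<bar> \<le> 2 * B" using bd[of g] bd[of "g + (int P, 0)"] by (simp add: z_def)
  qed
  have zrel: "\<forall>g. (\<Sum>s\<in>S. a s * z (g + s)) = 0"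
  proof
    fix g
    have "(\<Sum>s\<in>S. a s * z (g + s)) = (\<Sum>s\<in>S. a s * x (g + (int P, 0) + s)) - (\<Sum>s\<in>S. a s * x (g + s))"
      by (simp add: z_def right_diff_distrib sum_subtractf add_ac)
    then show "(\<Sum>s\<in>S. a s * z (g + s)) = 0" by (simp add: rel)
  qed
  have rowmult: "w (i + int (n * k), \<rho>) = (w (i, \<rho>)::int)" if "\<And>i. w (i + int k, \<rho>) = w (i, \<rho>)" for w n k i \<rho>
  proof (induction n)
    case (Suc n)
    have "w (i + int (Suc n * k), \<rho>) = w ((i + int (n * k)) + int k, \<rho>)" by (simp add: algebra_simps)
    then show ?case using that Suc by simp
  qed simp
  have kill: "z (i, \<rho>) = 0" if zP: "\<And>i. z (i + int P, \<rho>) = z (i, \<rho>)" for \<rho> i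
  proof -
    have "act (diffop (int P, 0)) x (i, \<rho>) = 0"
    proof (rule bounded_double_difference[OF bd, where U = "{g. snd g = \<rho>}"])
      fix g :: "int \<times> int" assume "g \<in> {g. snd g = \<rho>}"
      then obtain k where "g = (k, \<rho>)" by (cases g) auto
      then show "act (diffop (int P, 0)) (act (diffop (int P, 0)) x) g = 0"
        using zP[of k] by (simp add: act_diffop z_def)
    qed auto
    then show ?thesis by (simp add: act_diffop z_def)
  qed
  have zstrip: "z (i, j) = 0" if "r < j" "j \<le> r + (c1 - c0)" for i j
    using rowmult[of x q j i "Q0 * Q1"] strip[OF that] by (simp add: z_def P_def mult_ac)
  have up: "\<forall>i j. r < j \<longrightarrow> j \<le> r + (c1 - c0) + int m \<longrightarrow> z (i, j) = 0" for m
  proof (induction m)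
    case 0 then show ?case using zstrip by simp
  next
    case (Suc m)
    show ?case
    proof (intro allI impI)
      fix i j assume j: "r < j" "j \<le> r + (c1 - c0) + int (Suc m)"
      show "z (i, j) = 0"
      proof (cases "j \<le> r + (c1 - c0) + int m")
        case True then show ?thesis using Suc j by blast
      next
        case False
        have "\<forall>s\<in>S. a s \<noteq> 0 \<longrightarrow> snd s \<noteq> d1 \<longrightarrow> (\<forall>i. z (i, j - d1 + snd s) = 0)"
        proof (intro ballI impI allI)
          fix s i assume "s \<in> S" "a s \<noteq> 0" "snd s \<noteq> d1"
          then have "d0 \<le> snd s" "snd s < d1" using dD[of s] by auto
          then have "r < j - d1 + snd s" "j - d1 + snd s \<le> r + (c1 - c0) + int m"
            using hd j False by auto
          then show "z (i, j - d1 + snd s) = 0" using Suc by blast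
        qed
        then have "\<forall>i. z (i + int Q1, j) = z (i, j)" using Q1(2)[rule_format, of z j] zB zrel by simp
        then show ?thesis using rowmult[of z Q1 j _ "q * Q0"] by (intro kill) (simp add: P_def)
      qed
    qed
  qed
  have down: "\<forall>i j. r - int m < j \<longrightarrow> j \<le> r + (c1 - c0) \<longrightarrow> z (i, j) = 0" for m
  proof (induction m)
    case 0 then show ?case using zstrip by simp
  next
    case (Suc m)
    show ?case
    proof (intro allI impI)
      fix i j assume j: "r - int (Suc m) < j" "j \<le> r + (c1 - c0)"
      show "z (i, j) = 0"
      proof (cases "r - int m < j")
        case True then show ?thesis using Suc j by blast
      next
        case False
        have "\<forall>s\<in>S. a s \<noteq> 0 \<longrightarrow> snd s \<noteq> d0 \<longrightarrow> (\<forall>i. z (i, j - d0 + snd s) = 0)"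
        proof (intro ballI impI allI)
          fix s i assume "s \<in> S" "a s \<noteq> 0" "snd s \<noteq> d0"
          then have "d0 < snd s" "snd s \<le> d1" using dD[of s] by auto
          then have "r - int m < j - d0 + snd s" "j - d0 + snd s \<le> r + (c1 - c0)"
            using hd j False by auto
          then show "z (i, j - d0 + snd s) = 0" using Suc by blast
        qed
        then have "\<forall>i. z (i + int Q0, j) = z (i, j)" using Q0(2)[rule_format, of z j] zB zrel by simp
        then show ?thesis using rowmult[of z Q0 j _ "q * Q1"] by (intro kill) (simp add: P_def mult_ac)
      qed
    qed
  qed
  have "z g = 0" for g
  proof (cases g)
    case (Pair i j)
    show ?thesis
    proof (cases "r < j")
      case True
      then have "z (i, j) = 0" using up[of "nat (j - r)"] hd hd0 by simp
      then show ?thesis by (simp add: Pair)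
    next
      case False
      then have "z (i, j) = 0" using down[of "nat (r - j) + 1"] hd hd0 by simp
      then show ?thesis by (simp add: Pair)
    qed
  qed
  then show ?thesis using P by (auto simp: z_def)
qed

definition patterns :: "config set \<Rightarrow> (int \<times> int) set \<Rightarrow> config set" where
  "patterns M S = (\<lambda>x. restrict x S) ` M"

text \<open>For finite sets this is the same as \<open>lattice_convex\<close>, as their convex hulls are closed.\<close>

definition hull_convex :: "(int \<times> int) set \<Rightarrow> bool" where
  "hull_convex S \<longleftrightarrow> (\<forall>g. emb g \<in> convex hull (emb ` S) \<longrightarrow> g \<in> S)"

text \<open>Removing a vertex or an edge from a minimal window must break the inequality between the number
  of patterns and the number of points. So adding a vertex back adds no pattern, and adding an edge of
  \<open>k\<close> points adds fewer than \<open>k\<close> patterns.\<close>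

definition minimal_window :: "config set \<Rightarrow> (int \<times> int) set \<Rightarrow> bool" where
  "minimal_window M S \<longleftrightarrow> finite S \<and> S \<noteq> {} \<and> hull_convex S \<and> card (patterns M S) \<le> card S \<and>
     (\<forall>T. T \<subset> S \<longrightarrow> T \<noteq> {} \<longrightarrow> hull_convex T \<longrightarrow> card T < card (patterns M T))"

lemma exists_minimal_window:
  assumes "finite S" "S \<noteq> {}" "hull_convex S" "card (patterns M S) \<le> card S"
  shows "\<exists>S. minimal_window M S"
proof -
  let ?P = "\<lambda>S. finite S \<and> S \<noteq> {} \<and> hull_convex S \<and> card (patterns M S) \<le> card S"
  obtain S0 where S0: "?P S0" "\<And>T. ?P T \<Longrightarrow> card S0 \<le> card T"
    using ex_has_least_nat[of ?P S card] assms by blast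
  have "card T < card (patterns M T)" if "T \<subset> S0" "T \<noteq> {}" "hull_convex T" for T
  proof (rule ccontr)
    assume "\<not> ?thesis"
    then have "card S0 \<le> card T" using that S0(1) by (intro S0(2)) (auto intro: finite_subset)
    moreover have "card T < card S0" using that S0(1) by (intro psubset_card_mono) auto
    ultimately show False by simp
  qed
  then show ?thesis using S0(1) by (auto simp: minimal_window_def)
qed

lemma finite_patterns:
  assumes "finite A" "\<And>x g. x \<in> M \<Longrightarrow> x g \<in> A" "finite S"
  shows "finite (patterns M S)"
proof (rule finite_subset)
  show "patterns M S \<subseteq> (\<Pi>\<^sub>E s\<in>S. A)" using assms(2) by (auto simp: patterns_def)
  show "finite (\<Pi>\<^sub>E s\<in>S. A)" using assms by (simp add: finite_PiE)
qed

lemma restrict_eq_iff_agree: "restrict x S = restrict y S \<longleftrightarrow> agree_on S x y"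
  by (auto simp: agree_on_def restrict_def fun_eq_iff)

lemma patterns_restrict: "T \<subseteq> S \<Longrightarrow> (\<lambda>p. restrict p T) ` patterns M S = patterns M T"
  by (simp add: patterns_def image_image Int_absorb1 restrict_restrict)

lemma pattern_extension_unique:
  assumes fin: "finite (patterns M S)" and T: "T \<subseteq> S" and card: "card (patterns M S) \<le> card (patterns M T)"
    and xy: "x \<in> M" "y \<in> M" "agree_on T x y"
  shows "agree_on S x y"
proof -
  have "card (patterns M T) \<le> card (patterns M S)"
    using card_image_le[OF fin, of "\<lambda>p. restrict p T"] by (simp add: patterns_restrict[OF T])
  then have "inj_on (\<lambda>p. restrict p T) (patterns M S)"
    using card patterns_restrict[OF T, of M] by (intro eq_card_imp_inj_on[OF fin]) simp
  moreover have "restrict (restrict x S) T = restrict (restrict y S) T"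
    using xy(3) T by (simp add: restrict_restrict Int_absorb1 restrict_eq_iff_agree)
  ultimately have "restrict x S = restrict y S"
    using xy unfolding inj_on_def patterns_def by blast
  then show ?thesis by (simp add: restrict_eq_iff_agree)
qed

text \<open>Every pattern on \<open>T\<close> has an extension to \<open>S\<close>, and those in \<open>K\<close> have at least two.\<close>

lemma card_ambiguous_patterns:
  assumes fin: "finite (patterns M S)" and T: "T \<subseteq> S"
    and K: "K \<subseteq> patterns M T"
    and amb: "\<And>q. q \<in> K \<Longrightarrow> \<exists>x\<in>M. \<exists>y\<in>M. restrict x T = q \<and> restrict y T = q \<and> restrict x S \<noteq> restrict y S"
  shows "card (patterns M T) + card K \<le> card (patterns M S)"
proof -
  let ?r = "\<lambda>p. restrict p T"
  have rS: "?r ` patterns M S = patterns M T" by (rule patterns_restrict[OF T])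
  have finT: "finite (patterns M T)" using fin rS by (metis finite_imageI)
  have "\<forall>q\<in>patterns M T. \<exists>p. p \<in> patterns M S \<and> ?r p = q"
  proof
    fix q assume "q \<in> patterns M T"
    then have "q \<in> ?r ` patterns M S" by (simp only: rS)
    then show "\<exists>p. p \<in> patterns M S \<and> ?r p = q" by (elim imageE) (intro exI conjI, auto)
  qed
  from bchoice[OF this] obtain s where s: "\<forall>q\<in>patterns M T. s q \<in> patterns M S \<and> ?r (s q) = q" ..
  have "\<forall>q\<in>K. \<exists>p. p \<in> patterns M S \<and> ?r p = q \<and> p \<noteq> s q"
  proof
    fix q assume "q \<in> K"
    then obtain x y where xy: "x \<in> M" "y \<in> M" "restrict x T = q" "restrict y T = q" "restrict x S \<noteq> restrict y S"
      using amb by blast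
    have "?r (restrict x S) = q" "?r (restrict y S) = q"
      using xy T by (simp_all add: restrict_restrict Int_absorb1)
    moreover have "restrict x S \<in> patterns M S" "restrict y S \<in> patterns M S" using xy by (auto simp: patterns_def)
    ultimately show "\<exists>p. p \<in> patterns M S \<and> ?r p = q \<and> p \<noteq> s q" using xy(5) by metis
  qed
  from bchoice[OF this] obtain t where t: "\<forall>q\<in>K. t q \<in> patterns M S \<and> ?r (t q) = q \<and> t q \<noteq> s q" ..
  have inj_s: "inj_on s (patterns M T)" using s by (metis inj_onI)
  have inj_t: "inj_on t K" using t by (metis inj_onI)
  have disj: "s ` patterns M T \<inter> t ` K = {}"
  proof (rule ccontr)
    assume "s ` patterns M T \<inter> t ` K \<noteq> {}"
    then obtain q q' where "q \<in> patterns M T" "q' \<in> K" "s q = t q'" by blast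
    moreover from this have "q = q'" using s t by metis
    ultimately show False using t by metis
  qed
  have "card (patterns M T) + card K = card (s ` patterns M T \<union> t ` K)"
    using disj finT finite_subset[OF K finT] by (simp add: card_Un_disjoint card_image inj_s inj_t)
  also have "\<dots> \<le> card (patterns M S)" using fin s t by (intro card_mono) auto
  finally show ?thesis .
qed

lemma hull_convex_halfspace:
  assumes "hull_convex S"
  shows "hull_convex {g \<in> S. \<alpha> * real_of_int (fst g) + \<beta> * real_of_int (snd g) > c}"
  unfolding hull_convex_def
proof (intro allI impI)
  fix g assume g: "emb g \<in> convex hull (emb ` {g \<in> S. \<alpha> * real_of_int (fst g) + \<beta> * real_of_int (snd g) > c})"
    (is "_ \<in> convex hull (emb ` ?S')")
  have "convex hull (emb ` ?S') \<subseteq> convex hull (emb ` S)" by (intro hull_mono) auto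
  then have "g \<in> S" using g assms by (auto simp: hull_convex_def)
  moreover have "convex hull (emb ` ?S') \<subseteq> {p. inner (\<alpha>, \<beta>) p > c}"
    by (intro hull_minimal convex_halfspace_gt) (auto simp: emb_def)
  then have "inner (\<alpha>, \<beta>) (emb g) > c" using g by auto
  then have "\<alpha> * real_of_int (fst g) + \<beta> * real_of_int (snd g) > c" by (simp add: emb_def)
  ultimately show "g \<in> ?S'" by simp
qed

lemma hull_convex_row:
  assumes S: "hull_convex S" and ik: "(i, j) \<in> S" "(k, j) \<in> S" "i \<le> l" "l \<le> k"
  shows "(l, j) \<in> S"
proof (cases "i = k")
  case False
  define t where "t = real_of_int (l - i) / real_of_int (k - i)"
  have t: "0 \<le> t" "t \<le> 1" "t * real_of_int (k - i) = real_of_int (l - i)"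
    using ik False by (auto simp: t_def)
  have "(1 - t) *\<^sub>R emb (i, j) + t *\<^sub>R emb (k, j) \<in> convex hull (emb ` S)"
    by (intro convexD_alt[OF convex_convex_hull]) (use ik t in \<open>auto intro: hull_inc\<close>)
  moreover have "(1 - t) *\<^sub>R emb (i, j) + t *\<^sub>R emb (k, j) = emb (l, j)"
    using t(3) by (simp add: emb_def algebra_simps)
  ultimately show ?thesis using S by (simp add: hull_convex_def)
qed (use ik in auto)

text \<open>A convex set with two horizontal sections of length \<open>n\<close> has real sections of length at least \<open>n\<close>
  in between, and these contain at least \<open>n\<close> consecutive lattice points.\<close>

lemma hull_convex_middle_row:
  assumes S: "hull_convex S" and n: "n > 0"
    and bot: "(a, c0) \<in> S" "(a + int n, c0) \<in> S" and top: "(a', c1) \<in> S" "(a' + int n, c1) \<in> S"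
    and j: "c0 \<le> j" "j \<le> c1" "c0 < c1"
  shows "\<exists>\<alpha>. \<forall>i<n. (\<alpha> + int i, j) \<in> S"
proof -
  define t where "t = real_of_int (j - c0) / real_of_int (c1 - c0)"
  have t: "0 \<le> t" "t \<le> 1" "t * real_of_int (c1 - c0) = real_of_int (j - c0)"
    using j by (auto simp: t_def)
  define \<beta> where "\<beta> = (1 - t) * real_of_int a + t * real_of_int a'"
  let ?H = "convex hull (emb ` S)"
  have seg: "(real_of_int b + s, real_of_int c) \<in> ?H"
    if b: "(b, c) \<in> S" "(b + int n, c) \<in> S" and s: "0 \<le> s" "s \<le> real n" for b c s
  proof -
    have "(1 - s / real n) *\<^sub>R emb (b, c) + (s / real n) *\<^sub>R emb (b + int n, c) \<in> ?H"
      by (intro convexD_alt[OF convex_convex_hull]) (use b s n in \<open>auto intro: hull_inc simp: divide_simps\<close>)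
    moreover have "(1 - s / real n) *\<^sub>R emb (b, c) + (s / real n) *\<^sub>R emb (b + int n, c) = (real_of_int b + s, real_of_int c)"
      using n by (simp add: emb_def field_simps)
    ultimately show ?thesis by simp
  qed
  have "(\<lceil>\<beta>\<rceil> + int i, j) \<in> S" if i: "i < n" for i
  proof -
    define s where "s = real_of_int (\<lceil>\<beta>\<rceil> + int i) - \<beta>"
    have s: "0 \<le> s" "s \<le> real n"
    proof -
      show "0 \<le> s" unfolding s_def by linarith
      have "real_of_int \<lceil>\<beta>\<rceil> \<le> \<beta> + 1" by linarith
      moreover have "real i + 1 \<le> real n" using i by linarith
      ultimately show "s \<le> real n" unfolding s_def of_int_add of_int_of_nat_eq by linarith
    qed
    have "(1 - t) *\<^sub>R (real_of_int a + s, real_of_int c0) + t *\<^sub>R (real_of_int a' + s, real_of_int c1) \<in> ?H"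
      by (intro convexD_alt[OF convex_convex_hull] seg bot top s t)
    moreover have "(1 - t) *\<^sub>R (real_of_int a + s, real_of_int c0) + t *\<^sub>R (real_of_int a' + s, real_of_int c1)
      = emb (\<lceil>\<beta>\<rceil> + int i, j)"
    proof -
      have "(1 - t) * (real_of_int a + s) + t * (real_of_int a' + s) = \<beta> + s" by (simp add: \<beta>_def algebra_simps)
      moreover have "(1 - t) * real_of_int c0 + t * real_of_int c1 = real_of_int j"
        using t(3) by (simp add: algebra_simps)
      ultimately show ?thesis by (simp add: emb_def s_def)
    qed
    ultimately show ?thesis using S by (simp add: hull_convex_def)
  qed
  then show ?thesis by blast
qed

text \<open>If \<open>T\<close> contains \<open>n\<close> consecutive points of a row, at most \<open>n\<close> patterns on \<open>T\<close> give at most \<open>n\<close> factors of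
  length \<open>n\<close>.\<close>

lemma row_periodic_from_patterns:
  assumes K: "finite K" "card K \<le> n" "n > 0"
    and pat: "\<And>k. restrict (shift (k, \<rho>) x) T \<in> K" and row: "\<And>i. i < n \<Longrightarrow> (\<alpha> + int i, j) \<in> T"
  shows "x (i + int (fact n), j + \<rho>) = x (i, j + \<rho>)"
proof -
  let ?a = "\<lambda>i. x (i, j + \<rho>)"
  define F where "F = (\<lambda>p::config. map (\<lambda>i. p (\<alpha> + int i, j)) [0..<n])"
  have "factor ?a n k = F (restrict (shift (k - \<alpha>, \<rho>) x) T)" for k
    using row by (auto simp: factor_def F_def shift_apply add.commute)
  then have sub: "range (factor ?a n) \<subseteq> F ` K" using pat by auto
  then have fin: "finite (range (factor ?a n))" using K(1) by (meson finite_imageI finite_subset)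
  have "card (range (factor ?a n)) \<le> card (F ` K)" using sub K(1) by (intro card_mono) auto
  also have "\<dots> \<le> n" using card_image_le[OF K(1), of F] K(2) by simp
  finally have "card (range (factor ?a n)) \<le> n" .
  then obtain p where p: "p \<in> {1..n}" "\<forall>k. ?a (k + int p) = ?a k"
    using Morse_Hedlund[OF K(3) fin] by blast
  have mult: "?a (i + int (m * p)) = ?a i" for m i
  proof (induction m)
    case (Suc m)
    have "i + int (Suc m * p) = (i + int (m * p)) + int p" by (simp add: algebra_simps)
    then show ?case using p(2) Suc by metis
  qed simp
  have "p dvd fact n" using p(1) by (intro dvd_fact) auto
  then obtain m where "fact n = p * m" by (rule dvdE)
  then show ?thesis using mult[of i m] by (simp add: mult.commute)
qed

text \<open>Cyr and Kra: let \<open>x\<close>, \<open>y\<close> agree on an upper half plane and differ on the row below it, let \<open>E\<close> be the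
  bottom row of a minimal window \<open>S\<close>, and let \<open>T\<close> be the rest of \<open>S\<close>. Since the end points of \<open>E\<close> are
  determined by the other points of \<open>S\<close>, \<open>x\<close> and \<open>y\<close> differ on every translate of \<open>E\<close> in that row, so
  every pattern of \<open>T\<close> in \<open>x\<close> just above it has two extensions. By minimality there are fewer than
  \<open>|E|\<close> such patterns. As \<open>E\<close> is not longer than the top row, all rows of \<open>T\<close> have at least \<open>|E| - 1\<close>
  points, and Morse and Hedlund's theorem makes the rows of \<open>x\<close> periodic.\<close>

lemma balanced_window_periodic:
  assumes A: "finite A" "\<And>x g. x \<in> M \<Longrightarrow> x g \<in> A" and inv: "\<And>x u. x \<in> M \<Longrightarrow> shift u x \<in> M"
    and S: "minimal_window M S"
    and bal: "card {g \<in> S. snd g = Min (snd ` S)} \<le> card {g \<in> S. snd g = Max (snd ` S)}"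
    and xy: "x \<in> M" "y \<in> M" "x \<noteq> y" "agree_on {g. snd g \<ge> 0} x y"
  shows "\<exists>P>0. \<forall>g. x (g + (int P, 0)) = x g"
proof -
  have fS: "finite S" "S \<noteq> {}" and hS: "hull_convex S" and cS: "card (patterns M S) \<le> card S"
    and minS: "\<And>T. T \<subset> S \<Longrightarrow> T \<noteq> {} \<Longrightarrow> hull_convex T \<Longrightarrow> card T < card (patterns M T)"
    using S by (auto simp: minimal_window_def)
  have fP: "finite (patterns M T)" if "finite T" for T by (intro finite_patterns[of A M T] A that)
  have bd: "\<bar>x g\<bar> \<le> Max (abs ` A)" for g using A xy(1) by (intro Max_ge) auto
  define c0 c1 where "c0 = Min (snd ` S)" and "c1 = Max (snd ` S)"
  have c01: "c0 \<in> snd ` S" "c1 \<in> snd ` S" and rows: "\<And>s. s \<in> S \<Longrightarrow> c0 \<le> snd s \<and> snd s \<le> c1"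
    using fS by (auto simp: c0_def c1_def)
  define row where "row = (\<lambda>c. {i. (i, c) \<in> S})"
  have row_iff: "i \<in> row c \<longleftrightarrow> (i, c) \<in> S" for i c by (simp add: row_def)
  have frow: "finite (row c)" for c
    by (rule finite_subset[of _ "fst ` S"]) (use fS in \<open>force simp: row_def\<close>)+
  have crow: "card {g \<in> S. snd g = c} = card (row c)" for c
  proof -
    have "{g \<in> S. snd g = c} = (\<lambda>i. (i, c)) ` row c" by (auto simp: row_def)
    then show ?thesis by (simp add: card_image inj_on_def)
  qed
  have rne: "row c0 \<noteq> {}" "row c1 \<noteq> {}" using c01 by (auto simp: row_def)
  have rint: "row c = {Min (row c)..Max (row c)}" if "row c \<noteq> {}" for c
  proof
    show "row c \<subseteq> {Min (row c)..Max (row c)}"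
    proof
      fix i assume "i \<in> row c"
      then show "i \<in> {Min (row c)..Max (row c)}" using Min_le[OF frow] Max_ge[OF frow] by simp
    qed
    have m: "(Min (row c), c) \<in> S" "(Max (row c), c) \<in> S"
      using Min_in[OF frow that] Max_in[OF frow that] by (simp_all only: row_iff)
    show "{Min (row c)..Max (row c)} \<subseteq> row c"
    proof
      fix i assume "i \<in> {Min (row c)..Max (row c)}"
      then have "(i, c) \<in> S" by (intro hull_convex_row[OF hS m]) auto
      then show "i \<in> row c" by (simp only: row_iff)
    qed
  qed
  define a b where "a = Min (row c0)" and "b = Max (row c0)"
  have row0: "row c0 = {a..b}" using rint[OF rne(1)] by (simp add: a_def b_def)
  have ab: "a \<le> b" using row0 rne(1) by auto
  define n where "n = nat (b - a)"
  have n: "int n = b - a" using ab by (simp add: n_def)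
  define a' b' where "a' = Min (row c1)" and "b' = Max (row c1)"
  have row1: "row c1 = {a'..b'}" using rint[OF rne(2)] by (simp add: a'_def b'_def)
  have bal': "b - a \<le> b' - a'" using bal crow[of c0] crow[of c1] ab by (simp add: c0_def[symmetric] c1_def[symmetric] row0 row1)
  obtain \<alpha> c where rel: "\<exists>s\<in>S. \<alpha> s \<noteq> 0" "\<And>x. x \<in> M \<Longrightarrow> (\<Sum>s\<in>S. \<alpha> s * x s) = (c::int)"
    by (rule low_complexity_relation[OF fS(1) _ A(1) _ cS[unfolded patterns_def]])
      (use xy(1) A(2) in blast)+
  have rel_x: "(\<Sum>s\<in>S. \<alpha> s * x (g + s)) = c" for g
    using rel(2)[OF inv[OF xy(1)], of g] by (simp add: shift_apply add.commute)
  have "\<exists>q>0. \<exists>r. \<forall>i j. r < j \<longrightarrow> j \<le> r + (c1 - c0) \<longrightarrow> x (i + int q, j) = x (i, j)"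
  proof (cases "c0 = c1")
    case True
    then show ?thesis by (intro exI[of _ 1]) auto
  next
    case False
    have c01': "c0 < c1" using rows c01 False by force
    \<comment> \<open>The topmost row on which the two configurations differ has number \<open>r\<close>.\<close>
    have "\<exists>k i. x (i, - 1 - int k) \<noteq> y (i, - 1 - int k)"
    proof -
      obtain g where g: "x g \<noteq> y g" using xy(3) by (meson ext)
      then have "snd g < 0" using xy(4) by (force simp: agree_on_def)
      then show ?thesis using g by (intro exI[of _ "nat (- 1 - snd g)"] exI[of _ "fst g"]) simp
    qed
    then obtain k0 where k0: "\<exists>i. x (i, - 1 - int k0) \<noteq> y (i, - 1 - int k0)"
      "\<And>k. k < k0 \<Longrightarrow> \<not> (\<exists>i. x (i, - 1 - int k) \<noteq> y (i, - 1 - int k))"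
      using exists_least_iff[of "\<lambda>k. \<exists>i. x (i, - 1 - int k) \<noteq> y (i, - 1 - int k)"] by blast
    define r where "r = - 1 - int k0"
    have differ: "\<exists>i. x (i, r) \<noteq> y (i, r)" using k0(1) by (simp add: r_def)
    have above: "x (i, j) = y (i, j)" if "j > r" for i j
    proof (cases "j \<ge> 0")
      case True then show ?thesis using xy(4) by (auto simp: agree_on_def)
    next
      case False
      then have "nat (- 1 - j) < k0" "- 1 - int (nat (- 1 - j)) = j" using that by (auto simp: r_def)
      then show ?thesis using k0(2)[of "nat (- 1 - j)"] by auto
    qed
    define u where "u = (\<lambda>k::int. (k, r - c0))"
    define T where "T = {g \<in> S. snd g > c0}"
    have T: "T \<subset> S" "T \<noteq> {}" "hull_convex T"
    proof -
      show "T \<subset> S" using c01 by (auto simp: T_def)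
      obtain s where "s \<in> S" "snd s = c1" using c01(2) by auto
      then have "s \<in> T" using c01' by (simp add: T_def)
      then show "T \<noteq> {}" by blast
      have e: "T = {g \<in> S. 0 * real_of_int (fst g) + 1 * real_of_int (snd g) > real_of_int c0}" by (auto simp: T_def)
      show "hull_convex T" unfolding e by (rule hull_convex_halfspace[OF hS])
    qed
    have agT: "agree_on T (shift (u k) x) (shift (u k) y)" for k
      unfolding agree_on_def
    proof
      fix g assume "g \<in> T"
      then show "shift (u k) x g = shift (u k) y g"
        using above[of "snd g + (r - c0)" "fst g + k"] by (cases g) (auto simp: T_def shift_apply u_def)
    qed
    \<comment> \<open>The end points of the bottom row are vertices, cut off by slightly tilted lines.\<close>
    have vertex: "x (v + k, r) = y (v + k, r)"
      if v: "v \<in> row c0" and ext: "\<sigma> \<in> {1, - 1}" "\<And>i. i \<in> row c0 \<Longrightarrow> i \<noteq> v \<Longrightarrow> \<sigma> * i > \<sigma> * v"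
        and eq: "\<And>i. i \<in> row c0 \<Longrightarrow> i \<noteq> v \<Longrightarrow> x (i + k, r) = y (i + k, r)" for v k and \<sigma> :: int
    proof -
      obtain N where N: "\<And>s. s \<in> S \<Longrightarrow> \<bar>fst s\<bar> \<le> N" using fS(1)
        by (meson Max_ge finite_imageI imageI)
      define W where "W = 2 * N + 1"
      define S' where "S' = {g \<in> S. real_of_int \<sigma> * real_of_int (fst g) + real_of_int W * real_of_int (snd g)
          > real_of_int (\<sigma> * v + W * c0)}"
      have S'_eq: "S' = S - {(v, c0)}"
      proof -
        have "real_of_int \<sigma> * real_of_int (fst g) + real_of_int W * real_of_int (snd g) > real_of_int (\<sigma> * v + W * c0)
          \<longleftrightarrow> \<sigma> * fst g + W * snd g > \<sigma> * v + W * c0" for g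
          unfolding of_int_mult[symmetric] of_int_add[symmetric] of_int_less_iff by simp
        moreover have "\<sigma> * fst g + W * snd g > \<sigma> * v + W * c0 \<longleftrightarrow> g \<noteq> (v, c0)" if g: "g \<in> S" for g
        proof (cases "snd g = c0")
          case True
          then show ?thesis using ext(2)[of "fst g"] g by (cases g) (auto simp: row_def)
        next
          case False
          have "\<bar>v\<bar> \<le> N" "\<bar>fst g\<bar> \<le> N" using N[of "(v, c0)"] N[OF g] v by (simp_all add: row_iff)
          then have "\<sigma> * v - \<sigma> * fst g < W" using ext(1) by (auto simp: W_def)
          also have "W \<le> W * (snd g - c0)"
            using mult_left_mono[of 1 "snd g - c0" W] rows[OF g] False \<open>\<bar>v\<bar> \<le> N\<close> by (simp add: W_def)
          finally show ?thesis using False by (auto simp: algebra_simps)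
        qed
        ultimately show ?thesis by (auto simp: S'_def)
      qed
      have vS: "(v, c0) \<in> S" using v by (simp add: row_def)
      have "S' \<subset> S" using vS S'_eq by auto
      moreover have "S' \<noteq> {}"
      proof -
        obtain s where "s \<in> S" "snd s = c1" using c01(2) by auto
        then have "s \<in> S'" using c01' by (auto simp: S'_eq)
        then show ?thesis by blast
      qed
      moreover have "hull_convex S'" unfolding S'_def by (rule hull_convex_halfspace[OF hS])
      ultimately have "card S' < card (patterns M S')" by (rule minS)
      moreover have "card S = Suc (card S')" unfolding S'_eq by (rule card.remove[OF fS(1) vS])
      ultimately have le: "card (patterns M S) \<le> card (patterns M S')" using cS by simp
      have "agree_on S' (shift (u k) x) (shift (u k) y)"
        unfolding agree_on_def
      proof
        fix g assume g: "g \<in> S'"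
        obtain i j where ij: "g = (i, j)" by fastforce
        show "shift (u k) x g = shift (u k) y g"
        proof (cases "j = c0")
          case True
          then show ?thesis using g eq[of i] by (auto simp: ij S'_eq row_def shift_apply u_def)
        next
          case False
          then have "g \<in> T" using g rows[of g] by (auto simp: T_def S'_eq ij)
          then show ?thesis using agT[of k] by (auto simp: agree_on_def)
        qed
      qed
      then have "agree_on S (shift (u k) x) (shift (u k) y)"
        by (intro pattern_extension_unique[OF fP[OF fS(1)] _ le] inv xy(1,2)) (use S'_eq in auto)
      then show ?thesis using vS by (force simp: agree_on_def shift_apply u_def)
    qed
    \<comment> \<open>If \<open>x\<close> and \<open>y\<close> agree on \<open>n\<close> consecutive points of row \<open>r\<close>, the vertices propagate the agreement to
      the whole row.\<close>
    define D where "D = (\<lambda>k. \<forall>i\<in>{a..<b}. x (i + k, r) = y (i + k, r))"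
    have D_right: "x (b + k, r) = y (b + k, r) \<and> D (k + 1)" if Dk: "D k" for k
    proof -
      have D': "x (i + k, r) = y (i + k, r)" if "a \<le> i" "i < b" for i
        using Dk that by (simp add: D_def)
      have e: "x (b + k, r) = y (b + k, r)"
        by (rule vertex[of b "- 1"]) (use D' ab in \<open>auto simp: row0\<close>)
      have "x (i + (k + 1), r) = y (i + (k + 1), r)" if i: "i \<in> {a..<b}" for i
      proof -
        have "x (i + 1 + k, r) = y (i + 1 + k, r)"
        proof (cases "i + 1 = b")
          case True then show ?thesis using e by (simp only:)
        next
          case False then show ?thesis using i by (intro D') auto
        qed
        moreover have "i + 1 + k = i + (k + 1)" by simp
        ultimately show ?thesis by (simp only:)
      qed
      then show ?thesis using e unfolding D_def by (intro conjI ballI)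
    qed
    have D_left: "D (k - 1)" if Dk: "D k" for k
    proof -
      have D': "x (i + (k - 1), r) = y (i + (k - 1), r)" if "a < i" "i \<le> b" for i
      proof -
        have "x (i - 1 + k, r) = y (i - 1 + k, r)" using Dk that by (simp add: D_def)
        moreover have "i - 1 + k = i + (k - 1)" by simp
        ultimately show ?thesis by (simp only:)
      qed
      have e: "x (a + (k - 1), r) = y (a + (k - 1), r)"
        by (rule vertex[of a 1]) (use D' ab in \<open>auto simp: row0\<close>)
      have "x (i + (k - 1), r) = y (i + (k - 1), r)" if i: "i \<in> {a..<b}" for i
        using D'[of i] e i by (cases "i = a") auto
      then show ?thesis unfolding D_def by (intro ballI)
    qed
    have notD: "\<not> D k" for k
    proof
      assume "D k"
      have R: "D (k + int m)" for m
      proof (induction m)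
        case (Suc m)
        then show ?case using D_right[OF Suc] by (simp add: add_ac)
      qed (use \<open>D k\<close> in simp)
      have L: "D (k - int m)" for m
      proof (induction m)
        case (Suc m)
        then show ?case using D_left[OF Suc] by (simp add: algebra_simps)
      qed (use \<open>D k\<close> in simp)
      have "D l" for l using R[of "nat (l - k)"] L[of "nat (k - l)"] by (cases "k \<le> l") auto
      then have "x (b + (i - b), r) = y (b + (i - b), r)" for i using D_right[of "i - b"] by simp
      then have "x (i, r) = y (i, r)" for i by (metis add_diff_cancel_left' add_diff_eq)
      then show False using differ by simp
    qed
    define K where "K = range (\<lambda>k. restrict (shift (u k) x) T)"
    have KT: "K \<subseteq> patterns M T" by (auto simp: K_def patterns_def intro!: imageI inv xy(1))
    have "card (patterns M T) + card K \<le> card (patterns M S)"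
    proof (rule card_ambiguous_patterns[OF fP[OF fS(1)] _ KT])
      fix q assume "q \<in> K"
      then obtain k where k: "q = restrict (shift (u k) x) T" by (auto simp: K_def)
      have "restrict (shift (u k) y) T = q" using agT[of k] by (simp add: k flip: restrict_eq_iff_agree)
      moreover have "restrict (shift (u k) x) S \<noteq> restrict (shift (u k) y) S"
      proof
        assume "restrict (shift (u k) x) S = restrict (shift (u k) y) S"
        then have ag: "agree_on S (shift (u k) x) (shift (u k) y)" by (simp add: restrict_eq_iff_agree)
        have "D k" unfolding D_def
        proof
          fix i assume "i \<in> {a..<b}"
          then have "(i, c0) \<in> S" using row0 by (auto simp: row_def)
          then show "x (i + k, r) = y (i + k, r)" using ag by (force simp: agree_on_def shift_apply u_def)
        qed
        then show False using notD by blast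
      qed
      ultimately show "\<exists>x\<in>M. \<exists>y\<in>M. restrict x T = q \<and> restrict y T = q \<and> restrict x S \<noteq> restrict y S"
        using inv[OF xy(1)] inv[OF xy(2)] k by (intro bexI[of _ "shift (u k) x"] bexI[of _ "shift (u k) y"]) auto
    qed (use T in auto)
    moreover have "card T < card (patterns M T)" using T by (intro minS)
    moreover have "card S = card T + (n + 1)"
    proof -
      have "S = T \<union> {g \<in> S. snd g = c0}" using rows by (force simp: T_def)
      moreover have "card (T \<union> {g \<in> S. snd g = c0}) = card T + card {g \<in> S. snd g = c0}"
        using fS(1) by (intro card_Un_disjoint) (auto simp: T_def)
      moreover have "card {g \<in> S. snd g = c0} = n + 1"
        unfolding crow row0 using ab by (simp add: n_def)
      ultimately show ?thesis by simp
    qed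
    ultimately have cK: "card K \<le> n" using cS by simp
    have fK: "finite K" using KT fP T fS(1) by (meson finite_subset psubset_imp_subset)
    have "K \<noteq> {}" by (simp add: K_def)
    then have n0: "n > 0" using cK fK by (metis card_gt_0_iff gr0I le_zero_eq)
    have "x (i + int (fact n), j) = x (i, j)" if j: "r < j" "j \<le> r + (c1 - c0)" for i j
    proof -
      define j0 where "j0 = j - (r - c0)"
      have j0: "c0 < j0" "j0 \<le> c1" using j by (auto simp: j0_def)
      have "\<exists>\<gamma>. \<forall>i<n. (\<gamma> + int i, j0) \<in> S"
      proof (rule hull_convex_middle_row[OF hS n0, of a c0 a' c1])
        have "a \<in> row c0" "a + int n \<in> row c0" using ab n by (auto simp: row0)
        then show "(a, c0) \<in> S" "(a + int n, c0) \<in> S" by (auto simp: row_def)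
        have "a' \<in> row c1" "a' + int n \<in> row c1" using bal' ab n by (auto simp: row1)
        then show "(a', c1) \<in> S" "(a' + int n, c1) \<in> S" by (auto simp: row_def)
      qed (use j0 c01' in auto)
      then obtain \<gamma> where "\<forall>i<n. (\<gamma> + int i, j0) \<in> S" ..
      then have g: "(\<gamma> + int i, j0) \<in> T" if "i < n" for i using that j0 by (simp add: T_def)
      have "x (i + int (fact n), j0 + (r - c0)) = x (i, j0 + (r - c0))"
        by (rule row_periodic_from_patterns[OF fK cK n0 _ g]) (auto simp: K_def u_def)
      then show ?thesis by (simp add: j0_def)
    qed
    moreover have "(fact n :: nat) > 0" by simp
    ultimately show ?thesis by blast
  qed
  then obtain q r where q: "q > 0" "\<And>i j. r < j \<Longrightarrow> j \<le> r + (c1 - c0) \<Longrightarrow> x (i + int q, j) = x (i, j)"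
    by blast
  show ?thesis
    by (rule periodic_strip_imp_periodic[OF fS(1) rel(1) rows bd rel_x q(1) q(2)])
qed

section \<open>Unimodular changes of coordinates\<close>

text \<open>For \<open>cross e f = \<plusminus>1\<close> these maps are automorphisms of the lattice. They carry the horizontal direction
  to an arbitrary primitive vector \<open>e\<close>.\<close>

definition lmap :: "int \<times> int \<Rightarrow> int \<times> int \<Rightarrow> int \<times> int \<Rightarrow> int \<times> int" where
  "lmap e f g = fst g *\<^sub>Z e + snd g *\<^sub>Z f"

lemma lmap_add: "lmap e f (g + g') = lmap e f g + lmap e f g'"
  by (simp add: lmap_def zscale_add add_ac)

lemma cross_lmap: "cross e (lmap e f g) = snd g * cross e f"
  by (simp add: lmap_def)

lemma lmap_bij:
  assumes "cross e f * cross e f = 1" shows "bij (lmap e f)"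
proof (rule bijI)
  show "inj (lmap e f)"
  proof (rule injI)
    fix g g' assume eq: "lmap e f g = lmap e f g'"
    have "snd g * cross e f = snd g' * cross e f" using arg_cong[OF eq, of "cross e"] by (simp add: cross_lmap)
    moreover have "fst g * cross f e = fst g' * cross f e"
      using arg_cong[OF eq, of "cross f"] by (simp add: lmap_def)
    moreover have "cross e f \<noteq> 0" "cross f e \<noteq> 0" using assms cross_commute[of f e] by auto
    ultimately show "g = g'" by (simp add: prod_eq_iff)
  qed
  show "surj (lmap e f)"
  proof (rule surjI)
    fix g
    have "lmap e f (cross e f * cross g f, cross e f * cross e g) = cross e f *\<^sub>Z (cross g f *\<^sub>Z e + cross e g *\<^sub>Z f)"
      by (simp add: lmap_def zscale_add_right)
    also have "\<dots> = (cross e f * cross e f) *\<^sub>Z g" by (simp flip: cramer)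
    finally show "lmap e f (cross e f * cross g f, cross e f * cross e g) = g" using assms by simp
  qed
qed

lemma hull_convex_lmap:
  assumes ef: "cross e f * cross e f = 1"
  shows "hull_convex (lmap e f ` S) \<longleftrightarrow> hull_convex S"
proof -
  define R where "R = (\<lambda>p::real\<times>real. fst p *\<^sub>R emb e + snd p *\<^sub>R emb f)"
  have lin: "linear R" by (rule linearI) (auto simp: R_def algebra_simps)
  have emb: "emb (lmap e f g) = R (emb g)" for g by (simp add: R_def lmap_def emb_def)
  have inj: "inj R"
    unfolding linear_injective_0[OF lin]
  proof (intro allI impI)
    fix p assume "R p = 0"
    then have 1: "fst p * real_of_int (fst e) + snd p * real_of_int (fst f) = 0"
      and 2: "fst p * real_of_int (snd e) + snd p * real_of_int (snd f) = 0"
      by (auto simp: R_def emb_def zero_prod_def)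
    have "real_of_int (cross e f) \<noteq> 0" using ef by auto
    moreover have "fst p * real_of_int (cross e f)
        = real_of_int (snd f) * (fst p * real_of_int (fst e) + snd p * real_of_int (fst f))
          - real_of_int (fst f) * (fst p * real_of_int (snd e) + snd p * real_of_int (snd f))"
      and "snd p * real_of_int (cross e f)
        = real_of_int (fst e) * (fst p * real_of_int (snd e) + snd p * real_of_int (snd f))
          - real_of_int (snd e) * (fst p * real_of_int (fst e) + snd p * real_of_int (fst f))"
      by (simp_all add: cross_def algebra_simps)
    ultimately show "p = 0" unfolding 1 2 by (simp add: prod_eq_iff)
  qed
  have bij: "bij (lmap e f)" by (rule lmap_bij[OF ef])
  have img: "emb ` (lmap e f ` S) = R ` (emb ` S)" by (simp add: image_image emb)
  have mem: "emb (lmap e f g) \<in> convex hull (emb ` (lmap e f ` S)) \<longleftrightarrow> emb g \<in> convex hull (emb ` S)" for g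
    unfolding img convex_hull_linear_image[OF lin, symmetric] emb by (rule inj_image_mem_iff[OF inj])
  have mem': "lmap e f g \<in> lmap e f ` S \<longleftrightarrow> g \<in> S" for g
    using bij by (intro inj_image_mem_iff bij_is_inj)
  have all: "(\<forall>g. Q g) \<longleftrightarrow> (\<forall>g. Q (lmap e f g))" for Q
    using bij_is_surj[OF bij] by (metis surjD)
  show ?thesis unfolding hull_convex_def
    by (subst all) (simp only: mem mem')
qed

lemma card_patterns_lmap:
  assumes "bij L"
  shows "card (patterns ((\<lambda>x. x \<circ> L) ` M) S) = card (patterns M (L ` S))"
proof -
  define \<phi> where "\<phi> = (\<lambda>p::config. restrict (p \<circ> L) S)"
  have phi: "\<phi> (restrict x (L ` S)) = restrict (x \<circ> L) S" for x
    by (auto simp: \<phi>_def restrict_def fun_eq_iff)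
  have img: "patterns ((\<lambda>x. x \<circ> L) ` M) S = \<phi> ` patterns M (L ` S)"
    by (simp only: patterns_def image_image phi)
  moreover have "inj_on \<phi> (patterns M (L ` S))"
  proof (rule inj_onI)
    fix p q assume "p \<in> patterns M (L ` S)" "q \<in> patterns M (L ` S)" and eq: "\<phi> p = \<phi> q"
    then obtain x y where xy: "p = restrict x (L ` S)" "q = restrict y (L ` S)" by (auto simp: patterns_def)
    have "agree_on S (x \<circ> L) (y \<circ> L)" using eq by (simp only: xy phi restrict_eq_iff_agree)
    then have "agree_on (L ` S) x y" by (simp add: agree_on_def)
    then show "p = q" by (simp only: xy restrict_eq_iff_agree)
  qed
  ultimately show ?thesis by (simp add: card_image)
qed

lemma minimal_window_lmap:
  assumes ef: "cross e f * cross e f = 1" and S: "minimal_window M (lmap e f ` S)"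
  shows "minimal_window ((\<lambda>x. x \<circ> lmap e f) ` M) S"
proof -
  have bij: "bij (lmap e f)" by (rule lmap_bij[OF ef])
  then have inj: "inj_on (lmap e f) T" for T by (meson bij_is_inj inj_on_subset subset_UNIV)
  have card: "card (lmap e f ` T) = card T" for T using inj by (rule card_image)
  have fin: "finite S" using S inj by (auto simp: minimal_window_def dest: finite_imageD)
  show ?thesis unfolding minimal_window_def card_patterns_lmap[OF bij]
  proof (intro conjI allI impI)
    show "S \<noteq> {}" "hull_convex S" "card (patterns M (lmap e f ` S)) \<le> card S"
      using S by (auto simp: minimal_window_def hull_convex_lmap[OF ef] card)
    fix T assume T: "T \<subset> S" "T \<noteq> {}" "hull_convex T"
    have "lmap e f ` T \<subset> lmap e f ` S" using T(1) bij by (simp add: inj_image_subset_iff bij_is_inj psubset_eq inj_image_eq_iff)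
    then have "card (lmap e f ` T) < card (patterns M (lmap e f ` T))"
      using S T by (auto simp: minimal_window_def hull_convex_lmap[OF ef])
    then show "card T < card (patterns M (lmap e f ` T))" by (simp add: card)
  qed (rule fin)
qed

lemma ambiguous_balanced_periodic:
  assumes A: "finite A" "\<And>x g. x \<in> M \<Longrightarrow> x g \<in> A" and inv: "\<And>x u. x \<in> M \<Longrightarrow> shift u x \<in> M"
    and S: "minimal_window M S" and ef: "cross e f = \<sigma>" "\<sigma> * \<sigma> = 1"
    and bal: "card {g \<in> S. \<sigma> * cross e g = Min ((\<lambda>g. \<sigma> * cross e g) ` S)}
      \<le> card {g \<in> S. \<sigma> * cross e g = Max ((\<lambda>g. \<sigma> * cross e g) ` S)}"
    and xy: "x \<in> M" "y \<in> M" "x \<noteq> y" "agree_on {g. \<sigma> * cross e g \<ge> 0} x y"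
  shows "periodic x"
proof -
  let ?L = "lmap e f"
  have ef1: "cross e f * cross e f = 1" using ef by simp
  have bij: "bij ?L" by (rule lmap_bij[OF ef1])
  define S' where "S' = inv ?L ` S"
  have LS: "?L ` S' = S" using bij by (simp add: S'_def image_image surj_f_inv_f bij_is_surj)
  have snd: "\<sigma> * cross e (?L g) = snd g" for g using ef by (simp add: cross_lmap)
  have c: "{g \<in> S. \<sigma> * cross e g = k} = ?L ` {g \<in> S'. snd g = k}" for k
    unfolding LS[symmetric] by (auto simp: snd)
  have card: "card {g \<in> S. \<sigma> * cross e g = k} = card {g \<in> S'. snd g = k}" for k
    unfolding c using bij by (intro card_image) (meson bij_is_inj inj_on_subset subset_UNIV)
  have im: "(\<lambda>g. \<sigma> * cross e g) ` S = snd ` S'"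
    unfolding LS[symmetric] image_image by (simp add: snd)
  have "\<exists>P>0. \<forall>g. (x \<circ> ?L) (g + (int P, 0)) = (x \<circ> ?L) g"
  proof (rule balanced_window_periodic[where A = A and M = "(\<lambda>x. x \<circ> ?L) ` M" and S = S' and y = "y \<circ> ?L"])
    show "shift u z \<in> (\<lambda>x. x \<circ> ?L) ` M" if z: "z \<in> (\<lambda>x. x \<circ> ?L) ` M" for z u
    proof -
      obtain w where w: "w \<in> M" "z = w \<circ> ?L" using z by (elim imageE)
      have "shift u z = shift (?L u) w \<circ> ?L" by (auto simp: shift_def w lmap_add)
      then show ?thesis using inv[OF w(1)] by blast
    qed
    show "minimal_window ((\<lambda>x. x \<circ> ?L) ` M) S'" by (rule minimal_window_lmap[OF ef1]) (simp add: LS S)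
    show "card {g \<in> S'. snd g = Min (snd ` S')} \<le> card {g \<in> S'. snd g = Max (snd ` S')}"
      using bal by (simp only: card im)
    show "x \<circ> ?L \<noteq> y \<circ> ?L"
      using xy(3) bij_is_surj[OF bij] by (metis fun.map_cong0 comp_assoc comp_id surj_iff)
    show "agree_on {g. 0 \<le> snd g} (x \<circ> ?L) (y \<circ> ?L)"
      using xy(4) by (auto simp: agree_on_def snd)
    show "z g \<in> A" if "z \<in> (\<lambda>x. x \<circ> ?L) ` M" for z g
      using that by (elim imageE) (simp add: A(2))
    show "finite A" "x \<circ> ?L \<in> (\<lambda>x. x \<circ> ?L) ` M" "y \<circ> ?L \<in> (\<lambda>x. x \<circ> ?L) ` M"
      using A(1) xy(1,2) by blast+
  qed
  then obtain P where P: "P > 0" "\<And>g. x (?L (g + (int P, 0))) = x (?L g)" by auto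
  have per: "x (g + int P *\<^sub>Z e) = x g" for g
  proof -
    obtain g' where g': "g = ?L g'" using bij_is_surj[OF bij] by (meson surjD)
    have "?L (g' + (int P, 0)) = g + int P *\<^sub>Z e" unfolding lmap_add g' by (simp add: lmap_def zero_prod_def)
    then show ?thesis using P(2)[of g'] by (simp add: g')
  qed
  have "e \<noteq> 0" using ef by (auto simp: cross_def)
  then have "is_period (int P *\<^sub>Z e) x" using P(1) per by (auto simp: is_period_def)
  then show ?thesis by (auto simp: periodic_def)
qed

text \<open>One of the two extreme rows of a window parallel to \<open>h\<close> is not longer than the other one. If the
  window is read with that row at the bottom, the theorem on balanced windows applies; ambiguity is
  needed for both orientations because the choice is made by the window.\<close>

lemma both_ambiguous_imp_periodic:
  assumes M: "subshift A M" and h: "h \<noteq> 0" and amb: "ambiguous_above M h" "ambiguous_above M (- h)"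
    and S: "minimal_window M S"
  shows "\<exists>x\<in>M. periodic x"
proof -
  define d where "d = gcd (fst h) (snd h)"
  have d: "d > 0" using h by (auto simp: d_def prod_eq_iff)
  define e where "e = (fst h div d, snd h div d)"
  have he: "h = d *\<^sub>Z e" by (auto simp: e_def d_def prod_eq_iff)
  have "coprime (fst e) (snd e)" using h unfolding e_def d_def
    by (auto intro: div_gcd_coprime simp: prod_eq_iff)
  then obtain u v where "u * fst e + v * snd e = 1"
    using bezout_int[of "fst e" "snd e"] by auto
  then have ef: "cross e (- v, u) = 1" "cross e (v, - u) = - 1" by (auto simp: cross_def algebra_simps)
  have sgn: "cross h g \<ge> 0 \<longleftrightarrow> 1 * cross e g \<ge> 0" "cross (- h) g \<ge> 0 \<longleftrightarrow> - 1 * cross e g \<ge> 0" for g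
    using d by (auto simp: he zero_le_mult_iff mult_le_0_iff)
  obtain x y where xy: "x \<in> M" "y \<in> M" "x \<noteq> y" "agree_on {g. 1 * cross e g \<ge> 0} x y"
    using amb(1) unfolding ambiguous_above_def sgn by blast
  obtain x' y' where xy': "x' \<in> M" "y' \<in> M" "x' \<noteq> y'" "agree_on {g. - 1 * cross e g \<ge> 0} x' y'"
    using amb(2) unfolding ambiguous_above_def sgn by blast
  have S': "finite S" "S \<noteq> {}" using S by (auto simp: minimal_window_def)
  have inv: "shift u x \<in> M" if "x \<in> M" for u x using that M by (rule subshiftD(4)[rotated])
  have A: "finite A" "x g \<in> A" if "x \<in> M" for x g using M that by (auto simp: subshiftD)
  have fA: "finite A" using M by (rule subshiftD)
  show ?thesis
  proof (cases "card {g \<in> S. 1 * cross e g = Min ((\<lambda>g. 1 * cross e g) ` S)}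
      \<le> card {g \<in> S. 1 * cross e g = Max ((\<lambda>g. 1 * cross e g) ` S)}")
    case True
    have "periodic x"
      by (rule ambiguous_balanced_periodic[of A M S e "(- v, u)" 1 x y])
        (use fA A inv S ef True xy in simp_all)
    then show ?thesis using xy by blast
  next
    case False
    have img: "(\<lambda>g. - 1 * cross e g) ` S = uminus ` ((\<lambda>g. 1 * cross e g) ` S)" by (simp add: image_image)
    have fin: "finite ((\<lambda>g. 1 * cross e g) ` S)" "(\<lambda>g. 1 * cross e g) ` S \<noteq> {}" using S' by auto
    have "card {g \<in> S. - 1 * cross e g = Min ((\<lambda>g. - 1 * cross e g) ` S)}
      \<le> card {g \<in> S. - 1 * cross e g = Max ((\<lambda>g. - 1 * cross e g) ` S)}"
      unfolding img minus_Max_eq_Min[OF fin, symmetric] minus_Min_eq_Max[OF fin, symmetric]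
      using False by simp
    then have "periodic x'"
      by (intro ambiguous_balanced_periodic[of A M S e "(v, - u)" "- 1" x' y'])
        (use fA A inv S ef xy' in simp_all)
    then show ?thesis using xy' by blast
  qed
qed

section \<open>Minimal subshifts and existence of periodic configurations\<close>

definition minimal_subshift :: "int set \<Rightarrow> config set \<Rightarrow> bool" where
  "minimal_subshift A M \<longleftrightarrow> subshift A M \<and> M \<noteq> {} \<and>
     (\<forall>N. closed N \<longrightarrow> N \<noteq> {} \<longrightarrow> N \<subseteq> M \<longrightarrow> (\<forall>x\<in>N. \<forall>u. shift u x \<in> N) \<longrightarrow> N = M)"

lemma exists_minimal_subshift:
  assumes X: "subshift A X" "X \<noteq> {}"
  shows "\<exists>M\<subseteq>X. minimal_subshift A M"
proof -
  have cl: "closed X" and fA: "finite A" using X by (auto simp: subshift_def)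
  have val: "x g \<in> A" and inv: "shift u x \<in> X" if "x \<in> X" for x g u
    using X(1) that by (auto simp: subshiftD)
  have "\<exists>M. closed M \<and> M \<noteq> {} \<and> M \<subseteq> X \<and> (\<forall>x\<in>M. \<forall>u\<in>UNIV. shift u x \<in> M) \<and>
    (\<forall>N. closed N \<longrightarrow> N \<noteq> {} \<longrightarrow> N \<subseteq> M \<longrightarrow> (\<forall>x\<in>N. \<forall>u\<in>UNIV. shift u x \<in> N) \<longrightarrow> N = M)"
    by (rule minimal_invariant[OF cl X(2) fA]) (auto intro: val inv)
  then obtain M where M: "closed M" "M \<noteq> {}" "M \<subseteq> X" "\<forall>x\<in>M. \<forall>u. shift u x \<in> M"
    "\<forall>N. closed N \<longrightarrow> N \<noteq> {} \<longrightarrow> N \<subseteq> M \<longrightarrow> (\<forall>x\<in>N. \<forall>u. shift u x \<in> N) \<longrightarrow> N = M"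
    by auto
  have "subshift A M"
    using M(1,3,4) X(1) unfolding subshift_def by blast
  then have "minimal_subshift A M" using M(2,5) unfolding minimal_subshift_def by blast
  then show ?thesis using M(3) by blast
qed

text \<open>The limits of translates \<open>T\<^sup>g x\<close> with \<open>g\<close> going down without bound form a closed invariant nonempty
  set, which in a minimal subshift must contain \<open>x\<close> itself.\<close>

lemma minimal_recurrent:
  assumes M: "minimal_subshift A M" and x: "x \<in> M" and h: "h \<noteq> 0"
  shows "\<exists>gs. (\<forall>n. cross h (gs n) \<le> - int n) \<and> converges (\<lambda>n. shift (gs n) x) x"
proof -
  have sub: "subshift A M" and min: "\<And>N. closed N \<Longrightarrow> N \<noteq> {} \<Longrightarrow> N \<subseteq> M \<Longrightarrow> (\<forall>x\<in>N. \<forall>u. shift u x \<in> N) \<Longrightarrow> N = M"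
    using M by (auto simp: minimal_subshift_def)
  have cl: "closed M" using sub by (rule subshiftD)
  have inv: "shift u y \<in> M" if "y \<in> M" for u y using sub that by (rule subshiftD)
  define T where "T = (\<lambda>k::nat. (\<lambda>g. shift g x) ` {g. cross h g \<le> - int k})"
  define N where "N = (\<Inter>k. closure (T k))"
  have TM: "T k \<subseteq> M" for k using inv[OF x] by (auto simp: T_def)
  have "closed N" by (auto simp: N_def)
  moreover have "N \<subseteq> M" using closure_minimal[OF TM cl] by (auto simp: N_def)
  moreover have "N \<noteq> {}"
  proof -
    obtain v where v: "cross h v > 0" using exists_nonparallel[OF h] .
    define xs where "xs = (\<lambda>n. shift (- int n *\<^sub>Z v) x)"
    have "xs n \<in> M" for n using inv[OF x] by (simp add: xs_def)
    then obtain r l where r: "strict_mono (r::nat \<Rightarrow> nat)" "converges (xs \<circ> r) l"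
      using subshift_limit[OF sub, of xs] by blast
    have "l \<in> closure (T k)" for k
    proof (rule approximable_in_closed[OF closed_closure])
      fix W :: "(int \<times> int) set" assume "finite W"
      then have "\<forall>\<^sub>F n in sequentially. \<forall>g\<in>W. (xs \<circ> r) n g = l g" by (rule converges_finite[OF r(2)])
      moreover have "\<forall>\<^sub>F n in sequentially. k \<le> n" by (rule eventually_ge_at_top)
      ultimately have "\<forall>\<^sub>F n in sequentially. agree_on W (xs (r n)) l \<and> k \<le> n"
        by eventually_elim (simp add: agree_on_def)
      then obtain n where n: "agree_on W (xs (r n)) l" "k \<le> n"
        by (auto simp: eventually_sequentially)
      have "k \<le> r n" using n(2) seq_suble[OF r(1), of n] by simp
      then have "int k \<le> int (r n) * cross h v"
        using mult_left_mono[of 1 "cross h v" "int (r n)"] v by simp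
      then have "xs (r n) \<in> T k" by (auto simp: xs_def T_def)
      then show "\<exists>y\<in>closure (T k). agree_on W y l" using n(1) closure_subset by blast
    qed
    then show ?thesis by (auto simp: N_def)
  qed
  moreover have "\<forall>w\<in>N. \<forall>u. shift u w \<in> N"
  proof (intro ballI allI)
    fix w u assume w: "w \<in> N"
    have "shift u w \<in> closure (T k)" for k
    proof -
      have "w \<in> closure (T (k + nat \<bar>cross h u\<bar>))" using w by (auto simp: N_def)
      then obtain ys where ys: "\<And>n. ys n \<in> T (k + nat \<bar>cross h u\<bar>)" "converges ys w"
        unfolding closure_sequential converges_iff_tendsto by blast
      have "shift u (ys n) \<in> T k" for n
      proof -
        obtain g where "ys n = shift g x" "cross h g \<le> - int (k + nat \<bar>cross h u\<bar>)"
          using ys(1)[of n] by (auto simp: T_def)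
        then show ?thesis by (auto simp: T_def)
      qed
      then have "shift u (ys n) \<in> closure (T k)" for n using closure_subset by blast
      then show ?thesis by (rule converges_in_closed[OF closed_closure _ converges_shift[OF ys(2)]])
    qed
    then show "shift u w \<in> N" by (auto simp: N_def)
  qed
  ultimately have "N = M" by (intro min)
  then have "x \<in> closure (T n)" for n using x by (auto simp: N_def)
  then have "\<forall>n. \<exists>g. cross h g \<le> - int n \<and> agree_on (window n) (shift g x) x"
    using closure_approximable[OF _ finite_window, of x] by (fastforce simp: T_def)
  from choice[OF this] obtain gs where
    gs: "\<forall>n. cross h (gs n) \<le> - int n \<and> agree_on (window n) (shift (gs n) x) x" ..
  then have "converges (\<lambda>n. shift (gs n) x) x" by (intro converges_windowI) auto
  then show ?thesis using gs by blast
qed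

lemma simultaneous_limits:
  assumes X: "subshift A X" and G: "finite G" "\<And>y n. y \<in> G \<Longrightarrow> F n y \<in> X"
  shows "\<exists>(r::nat \<Rightarrow> nat) l. strict_mono r \<and> (\<forall>y\<in>G. l y \<in> X \<and> converges (\<lambda>n. F (r n) y) (l y))"
  using G
proof (induction G rule: finite_induct)
  case empty
  then show ?case by (intro exI[of _ id]) (auto simp: strict_mono_def)
next
  case (insert y G)
  have "\<exists>(r::nat \<Rightarrow> nat) l. strict_mono r \<and> (\<forall>y\<in>G. l y \<in> X \<and> converges (\<lambda>n. F (r n) y) (l y))"
    using insert.prems by (intro insert.IH) auto
  then obtain r :: "nat \<Rightarrow> nat" and l where r: "strict_mono r" "\<forall>y\<in>G. l y \<in> X \<and> converges (\<lambda>n. F (r n) y) (l y)"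
    by (elim exE conjE) (rule that)
  have "F (r n) y \<in> X" for n using insert.prems by simp
  then obtain s z where s: "strict_mono (s::nat \<Rightarrow> nat)" "converges ((\<lambda>n. F (r n) y) \<circ> s) z" "z \<in> X"
    using subshift_limit[OF X, of "\<lambda>n. F (r n) y"] by blast
  have "strict_mono (r \<circ> s)" using r(1) s(1) by (rule strict_mono_o)
  moreover have "\<forall>w\<in>insert y G. (l(y := z)) w \<in> X \<and> converges (\<lambda>n. F ((r \<circ> s) n) w) ((l(y := z)) w)"
  proof
    fix w assume w: "w \<in> insert y G"
    show "(l(y := z)) w \<in> X \<and> converges (\<lambda>n. F ((r \<circ> s) n) w) ((l(y := z)) w)"
    proof (cases "w = y")
      case True then show ?thesis using s(2,3) by (simp add: o_def)
    next
      case False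
      then have "l w \<in> X" "converges (\<lambda>n. F (r n) w) (l w)" using r(2) w by auto
      then show ?thesis using converges_subseq[OF _ s(1), of "\<lambda>n. F (r n) w" "l w"] False by (simp add: o_def)
    qed
  qed
  ultimately show ?case by blast
qed

text \<open>In a minimal subshift, one-sided nonexpansiveness is symmetric. Suppose that \<open>N\<close> consecutive rows
  determine everything above. Then only boundedly many elements differ from a given \<open>x\<close> by an
  \<open>h\<close>-periodic configuration, since far below they already differ pairwise on every strip of
  width \<open>N\<close>. Moving far down along translates that bring \<open>x\<close> back to itself permutes this finite set, so
  its elements differ pairwise on all strips, and no two of them agree on an upper half plane. But two
  elements that agree on the upper half plane do differ by an \<open>h\<close>-periodic configuration, because the
  other operators of \<open>J\<close> are injective on configurations vanishing there.\<close>

lemma minimal_ambiguous_symmetric: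
  assumes M: "minimal_subshift A M" and J: "nonparallel J" "h \<in> J"
    and kill: "\<And>x g. x \<in> M \<Longrightarrow> act (diffprod J) x g = 0"
    and amb: "ambiguous_above M h"
  shows "ambiguous_above M (- h)"
proof (rule ccontr)
  assume na: "\<not> ambiguous_above M (- h)"
  have sub: "subshift A M" using M by (simp add: minimal_subshift_def)
  have inv: "shift u y \<in> M" if "y \<in> M" for u y using sub that by (rule subshiftD)
  have h0: "h \<noteq> 0" using J by (auto simp: nonparallel_def)
  obtain N where N: "N > 0" "\<forall>x\<in>M. \<forall>y\<in>M. \<forall>a g. agree_on {g. a < cross (- h) g \<and> cross (- h) g \<le> a + N} x y \<longrightarrow>
       cross (- h) g \<le> a + N \<longrightarrow> x g = y g"
    using strip_determines_below[OF sub na] h0 by (auto simp del: cross_simps)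
  have up: "x g = y g" if "x \<in> M" "y \<in> M" "\<And>g. b \<le> cross h g \<Longrightarrow> cross h g < b + N \<Longrightarrow> x g = y g" "b \<le> cross h g" for x y b g
    using N(2)[rule_format, of x y "- b - N" g] that by (auto simp: agree_on_def)
  obtain v where v: "cross h v > 0" using exists_nonparallel[OF h0] .
  obtain B where B: "finite B" "B \<subseteq> {g. 0 \<le> cross h g \<and> cross h g \<le> N - 1}"
    "\<forall>g. 0 \<le> cross h g \<longrightarrow> cross h g \<le> N - 1 \<longrightarrow> (\<exists>k. g + k *\<^sub>Z h \<in> B)"
    using strip_finite_mod[OF h0, of 0 "N - 1"] by blast
  \<comment> \<open>The elements of \<open>D x\<close> are compared by \<open>code k\<close>, which records one period of each of \<open>N\<close> rows at a
    depth growing with \<open>k\<close>.\<close>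
  define D where "D = (\<lambda>x. {y \<in> M. \<forall>g. y (g + h) - x (g + h) = y g - x g})"
  define code where "code = (\<lambda>k::nat. \<lambda>y. restrict (shift (- int k *\<^sub>Z v) y) B)"
  have code: "y g = y' g" if yy: "y \<in> D x" "y' \<in> D x" "code k y = code k y'" and g: "- int k * cross h v \<le> cross h g" for x y y' k g
  proof (rule up[of y y' "- int k * cross h v"])
    show "y \<in> M" "y' \<in> M" using yy by (auto simp: D_def)
    fix g assume g: "- int k * cross h v \<le> cross h g" "cross h g < - int k * cross h v + N"
    obtain i where i: "g + int k *\<^sub>Z v + i *\<^sub>Z h \<in> B" using B(3)[rule_format, of "g + int k *\<^sub>Z v"] g by auto
    have "y (g + i *\<^sub>Z h) = y' (g + i *\<^sub>Z h)"
      using fun_cong[OF yy(3), of "g + int k *\<^sub>Z v + i *\<^sub>Z h"] i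
      by (simp add: code_def shift_apply zscale_minus add_ac)
    moreover have "y (g + i *\<^sub>Z h) - y' (g + i *\<^sub>Z h) = y g - y' g"
    proof (rule period_multiple)
      fix g
      have "y (g + h) - x (g + h) = y g - x g" "y' (g + h) - x (g + h) = y' g - x g"
        using yy(1,2) by (auto simp: D_def)
      then show "y (g + h) - y' (g + h) = y g - y' g" by simp
    qed
    ultimately show "y g = y' g" by simp
  qed (rule g)
  have fPi: "finite (\<Pi>\<^sub>E b\<in>B. A)" using B(1) sub by (simp add: finite_PiE subshiftD)
  have codePi: "code k y \<in> (\<Pi>\<^sub>E b\<in>B. A)" if "y \<in> M" for k y
    using that sub by (auto simp: code_def shift_apply subshiftD)
  have finD: "finite (D x)" for x
  proof -
    have "card G \<le> card (\<Pi>\<^sub>E b\<in>B. A)" if G: "G \<subseteq> D x" "finite G" for G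
    proof -
      have "\<forall>\<^sub>F k in sequentially. code k y \<noteq> code k y'" if yy: "y \<in> G" "y' \<in> G" "y \<noteq> y'" for y y'
      proof -
        obtain g where g: "y g \<noteq> y' g" using yy(3) by (meson ext)
        have "code k y \<noteq> code k y'" if k: "k \<ge> nat \<bar>cross h g\<bar>" for k
        proof
          assume eq: "code k y = code k y'"
          have "\<bar>cross h g\<bar> \<le> int k * cross h v"
            using k mult_left_mono[of 1 "cross h v" "int k"] v by simp
          then have "- int k * cross h v \<le> cross h g" by simp
          then have "y g = y' g" by (intro code[OF _ _ eq]) (use yy G in auto)
          then show False using g by simp
        qed
        then show ?thesis by (auto simp: eventually_sequentially)
      qed
      then have "\<forall>\<^sub>F k in sequentially. \<forall>y\<in>G. \<forall>y'\<in>G. y \<noteq> y' \<longrightarrow> code k y \<noteq> code k y'"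
        using G(2) by (simp add: eventually_ball_finite_distrib)
      then obtain k where "\<forall>y\<in>G. \<forall>y'\<in>G. y \<noteq> y' \<longrightarrow> code k y \<noteq> code k y'"
        by (auto simp: eventually_sequentially)
      then have "inj_on (code k) G" by (meson inj_onI)
      then show ?thesis
      proof (rule card_inj_on_le[OF _ _ fPi])
        show "code k ` G \<subseteq> (\<Pi>\<^sub>E b\<in>B. A)"
          using G(1) by (intro image_subsetI codePi) (auto simp: D_def)
      qed
    qed
    then show ?thesis using finite_if_finite_subsets_card_bdd by blast
  qed
  obtain x y where xy: "x \<in> M" "y \<in> M" "x \<noteq> y" "agree_on {g. cross h g \<ge> 0} x y"
    using amb unfolding ambiguous_above_def by blast
  have xD: "x \<in> D x" using xy by (simp add: D_def)
  have yD: "y \<in> D x"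
  proof -
    have "act (diffop h) (\<lambda>g. x g - y g) g = 0" for g
    proof (rule zero_above_imp_zero[where J = "J - {h}" and h = h and c = 0])
      show "finite (J - {h})" "\<And>j. j \<in> J - {h} \<Longrightarrow> cross h j \<noteq> 0" using J by (auto simp: nonparallel_def)
      show "act (diffop h) (\<lambda>g. x g - y g) g = 0" if "0 \<le> cross h g" for g
        using xy(4) that by (simp add: act_diffop agree_on_def)
      have "act (diffprod J) (\<lambda>g. x g - y g) g = 0" for g
        using kill xy by (simp add: act_linear_diff)
      moreover have "diffprod J = diffprod (J - {h}) * diffop h"
        using J by (simp add: nonparallel_def prod.remove mult.commute)
      ultimately show "act (diffprod (J - {h})) (act (diffop h) (\<lambda>g. x g - y g)) g = 0" for g
        by (simp add: act_mult)
    qed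
    then have "x (g + h) - y (g + h) = x g - y g" for g by (simp add: act_diffop)
    then have "y (g + h) - x (g + h) = y g - x g" for g by (smt (verit))
    then show ?thesis using xy(2) by (simp add: D_def)
  qed
  obtain gs where gs: "\<And>n. cross h (gs n) \<le> - int n" "converges (\<lambda>n. shift (gs n) x) x"
    using minimal_recurrent[OF M xy(1) h0] by blast
  have "\<exists>(r::nat \<Rightarrow> nat) l. strict_mono r \<and> (\<forall>w\<in>D x. l w \<in> M \<and> converges (\<lambda>n. shift (gs (r n)) w) (l w))"
    by (rule simultaneous_limits[OF sub finD, of _ "\<lambda>n w. shift (gs n) w"]) (auto simp: D_def inv)
  then obtain r :: "nat \<Rightarrow> nat" and l where r: "strict_mono r"
    and l: "\<forall>w\<in>D x. l w \<in> M \<and> converges (\<lambda>n. shift (gs (r n)) w) (l w)"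
    by (elim exE conjE) (rule that)
  have x_lim: "converges (\<lambda>n. shift (gs (r n)) x) x"
    using converges_subseq[OF gs(2) r] by (simp add: o_def)
  have lD: "l w \<in> D x" if w: "w \<in> D x" for w
  proof -
    have "l w (g + h) - x (g + h) = l w g - x g" for g
    proof -
      have c: "converges (\<lambda>n. shift (gs (r n)) w) (l w)" using l w by blast
      have "\<forall>\<^sub>F n in sequentially. l w (g + h) - x (g + h) = l w g - x g"
        using convergesD[OF c, of g] convergesD[OF c, of "g + h"] convergesD[OF x_lim, of g] convergesD[OF x_lim, of "g + h"]
      proof eventually_elim
        case (elim n)
        have "w (g + gs (r n) + h) - x (g + gs (r n) + h) = w (g + gs (r n)) - x (g + gs (r n))"
          using w by (simp add: D_def)
        then show ?case using elim by (simp add: shift_apply add_ac)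
      qed
      then show ?thesis by simp
    qed
    then show ?thesis using l w by (simp add: D_def)
  qed
  \<comment> \<open>Translation by \<open>gs (r n)\<close> moves a deep strip to level \<open>0\<close>, so the limits differ there.\<close>
  have lcode: "code 0 (l w) \<noteq> code 0 (l w')" if w: "w \<in> D x" "w' \<in> D x" "w \<noteq> w'" for w w'
  proof
    assume eq: "code 0 (l w) = code 0 (l w')"
    have c: "converges (\<lambda>n. shift (gs (r n)) w) (l w)" "converges (\<lambda>n. shift (gs (r n)) w') (l w')"
      using l w by blast+
    obtain g where g: "w g \<noteq> w' g" using w(3) by (meson ext)
    have "\<forall>\<^sub>F n in sequentially. nat \<bar>cross h g\<bar> \<le> n" by (rule eventually_ge_at_top)
    then have "\<forall>\<^sub>F n in sequentially. False"
      using converges_finite[OF c(1) B(1)] converges_finite[OF c(2) B(1)]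
    proof eventually_elim
      case (elim n)
      have "code 0 (shift (gs (r n)) w) = code 0 (l w)" "code 0 (shift (gs (r n)) w') = code 0 (l w')"
        using elim by (auto simp: code_def restrict_def fun_eq_iff)
      then have ceq: "code 0 (shift (gs (r n)) w) = code 0 (shift (gs (r n)) w')" using eq by simp
      have inD: "shift u z \<in> D (shift u x)" if z: "z \<in> D x" for u z
      proof -
        have "z (g + u + h) - x (g + u + h) = z (g + u) - x (g + u)" for g
          using z by (simp add: D_def)
        then have "z (g + h + u) - x (g + h + u) = z (g + u) - x (g + u)" for g
          by (simp only: add.assoc add.commute[of h])
        then show ?thesis using z inv by (simp add: D_def shift_apply)
      qed
      have "n \<le> r n" by (rule seq_suble[OF r])
      then have "cross h (gs (r n)) \<le> cross h g" using gs(1)[of "r n"] elim(1) by linarith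
      then have "shift (gs (r n)) w (g - gs (r n)) = shift (gs (r n)) w' (g - gs (r n))"
        by (intro code[OF inD[OF w(1)] inD[OF w(2)] ceq]) simp
      then show False using g by (simp add: shift_apply)
    qed
    then show False by simp
  qed
  have inj: "inj_on l (D x)"
  proof (rule inj_onI, rule ccontr)
    fix w w' assume "w \<in> D x" "w' \<in> D x" "l w = l w'" "w \<noteq> w'"
    then show False using lcode[of w w'] by simp
  qed
  have "l ` D x \<subseteq> D x" using lD by (rule image_subsetI)
  then have surj: "l ` D x = D x" using inj by (rule endo_inj_surj[OF finD])
  have "x \<in> l ` D x" unfolding surj by (rule xD)
  then obtain w where w: "x = l w" "w \<in> D x" by (rule imageE)
  have "y \<in> l ` D x" unfolding surj by (rule yD)
  then obtain w' where w': "y = l w'" "w' \<in> D x" by (rule imageE)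
  have "code 0 x \<noteq> code 0 y" using lcode[OF w(2) w'(2)] xy(3) w(1) w'(1) by auto
  moreover have "code 0 x = code 0 y"
    using xy(4) B(2) by (auto simp: code_def restrict_def fun_eq_iff agree_on_def)
  ultimately show False by simp
qed

text \<open>Kari and Moutot's theorem. A minimal subshift inside \<open>X\<close> that has no periodic element is ambiguous
  in some direction of \<open>J\<close>, by symmetry in the opposite direction too, and a minimal window then gives a
  periodic element nevertheless.\<close>

lemma low_complexity_has_periodic:
  assumes X: "subshift A X" "X \<noteq> {}" and J: "nonparallel J"
    and kill: "\<And>x g. x \<in> X \<Longrightarrow> act (diffprod J) x g = 0"
    and S: "finite S" "S \<noteq> {}" "hull_convex S" "card (patterns X S) \<le> card S"
  shows "\<exists>x\<in>X. periodic x"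
proof -
  obtain M where M: "M \<subseteq> X" "minimal_subshift A M" using exists_minimal_subshift[OF X] by blast
  have sub: "subshift A M" "M \<noteq> {}" using M(2) by (auto simp: minimal_subshift_def)
  have killM: "act (diffprod J) x g = 0" if "x \<in> M" for x g using kill that M(1) by blast
  consider "\<exists>x\<in>M. periodic x" | j where "j \<in> J" "ambiguous_above M j \<or> ambiguous_above M (- j)"
    using periodic_or_ambiguous[OF sub J killM] by blast
  then have "\<exists>x\<in>M. periodic x"
  proof cases
    case 2
    have j0: "j \<noteq> 0" using 2 J by (auto simp: nonparallel_def)
    have both: "ambiguous_above M j \<and> ambiguous_above M (- j)"
    proof (cases "ambiguous_above M j")
      case True
      then show ?thesis using minimal_ambiguous_symmetric[OF M(2) J 2(1) killM] by blast
    next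
      case False
      have jj: "- j \<notin> J"
      proof
        assume "- j \<in> J"
        moreover have "- j \<noteq> j" using j0 by (auto simp: prod_eq_iff)
        ultimately have "cross (- j) j \<noteq> 0" using J 2(1) by (auto simp: nonparallel_def simp del: cross_simps)
        then show False by simp
      qed
      define J' where "J' = insert (- j) (J - {j})"
      have nonpar: "nonparallel J'"
        using J 2(1) j0 by (auto simp: nonparallel_def J'_def)
      have "act (diffprod J') x g = 0" if x: "x \<in> M" for x g
      proof (rule act_dvd_kills[OF _ killM[OF x]])
        have "diffop j dvd diffop (- j)" using diffop_multiple_dvd[of j "- 1"] by (simp add: zscale_minus)
        moreover have "- j \<notin> J - {j}" using jj by simp
        moreover have "finite J" using J by (simp add: nonparallel_def)
        ultimately show "diffprod J dvd diffprod J'"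
          using 2(1) by (simp add: J'_def prod.remove[of J j] mult_dvd_mono)
      qed
      moreover have "ambiguous_above M (- j)" using 2(2) False by blast
      ultimately have "ambiguous_above M (- (- j))"
        by (intro minimal_ambiguous_symmetric[OF M(2) nonpar, of "- j"]) (simp add: J'_def)
      then show ?thesis using False by simp
    qed
    have "card (patterns M S) \<le> card (patterns X S)"
      using M(1) X(1) S(1) by (intro card_mono finite_patterns[of A X S]) (auto simp: patterns_def subshiftD)
    then obtain S' where "minimal_window M S'"
      using exists_minimal_window[OF S(1-3), of M] S(4) by auto
    then show ?thesis using both_ambiguous_imp_periodic[OF sub(1) j0] both by blast
  qed
  then show ?thesis using M(1) by blast
qed

section \<open>Configurations that are periodic on a half plane\<close>

lemma forward_multiple:
  assumes per: "\<And>g. cross h g > 0 \<Longrightarrow> x (g + a) = (x g :: int)" and a: "cross h a \<ge> 0" and g: "cross h g > 0"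
  shows "x (g + int n *\<^sub>Z a) = x g"
proof (induction n)
  case (Suc n)
  have "cross h (g + int n *\<^sub>Z a) > 0" using a g by (simp add: add_pos_nonneg)
  then have "x (g + int n *\<^sub>Z a + a) = x (g + int n *\<^sub>Z a)" by (rule per)
  moreover have "g + int n *\<^sub>Z a + a = g + int (Suc n) *\<^sub>Z a" by (simp add: prod_eq_iff algebra_simps)
  ultimately show ?case using Suc by (simp only:)
qed simp

lemma level_multiple:
  assumes per: "\<And>g. cross h g > 0 \<Longrightarrow> x (g + a) = (x g :: int)" and a: "cross h a = 0" and g: "cross h g > 0"
  shows "x (g + k *\<^sub>Z a) = x g"
proof (cases "k \<ge> 0")
  case True
  then show ?thesis using forward_multiple[of h x a g "nat k"] per a g by simp
next
  case False
  have "x (g + k *\<^sub>Z a + int (nat (- k)) *\<^sub>Z a) = x (g + k *\<^sub>Z a)"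
    by (rule forward_multiple[of h x a]) (use per a g in auto)
  then show ?thesis using False by (simp add: zscale_minus)
qed

text \<open>By Cramer's rule a multiple of \<open>a\<close> is \<open>\<alpha> j + \<beta> k\<close> with integers \<open>\<alpha>\<close>, \<open>\<beta>\<close> of any sign. First moving
  up by \<open>n j + n k\<close> keeps all steps inside the half plane.\<close>

lemma half_plane_two_periods:
  assumes j: "\<And>g. cross h g > 0 \<Longrightarrow> t (g + j) = (t g :: int)" and k: "\<And>g. cross h g > 0 \<Longrightarrow> t (g + k) = t g"
    and pos: "cross h j > 0" "cross h k > 0" "cross h a > 0" and jk: "cross j k \<noteq> 0"
  shows "\<exists>q>0. \<forall>g. cross h g > 0 \<longrightarrow> t (g + int q *\<^sub>Z a) = t g"
proof -
  define \<sigma> where "\<sigma> = sgn (cross j k)"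
  define q where "q = nat \<bar>cross j k\<bar>"
  define \<alpha> \<beta> where "\<alpha> = \<sigma> * cross a k" and "\<beta> = \<sigma> * cross j a"
  have "int q = \<bar>cross j k\<bar>" by (simp add: q_def)
  also have "\<dots> = \<sigma> * cross j k" by (simp only: \<sigma>_def abs_sgn mult.commute)
  finally have q: "q > 0" "int q = \<sigma> * cross j k" using jk by (auto simp: q_def)
  have "int q *\<^sub>Z a = \<sigma> *\<^sub>Z (cross j k *\<^sub>Z a)" using q by simp
  also have "\<dots> = \<alpha> *\<^sub>Z j + \<beta> *\<^sub>Z k" by (subst cramer) (simp add: \<alpha>_def \<beta>_def zscale_add_right)
  finally have qa: "int q *\<^sub>Z a = \<alpha> *\<^sub>Z j + \<beta> *\<^sub>Z k" .
  define n where "n = nat (\<bar>\<alpha>\<bar> + \<bar>\<beta>\<bar>)"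
  have move: "t (g + int m *\<^sub>Z j + int l *\<^sub>Z k) = t g" if g: "cross h g > 0" for g m l
  proof -
    have "cross h (g + int m *\<^sub>Z j) > 0" using g pos(1) by (simp add: add_pos_nonneg)
    then have "t (g + int m *\<^sub>Z j + int l *\<^sub>Z k) = t (g + int m *\<^sub>Z j)"
      by (intro forward_multiple[of h t k]) (use k pos in auto)
    also have "\<dots> = t g" by (rule forward_multiple[of h t j]) (use j pos g in auto)
    finally show ?thesis .
  qed
  have "t (g + int q *\<^sub>Z a) = t g" if g: "cross h g > 0" for g
  proof -
    have "cross h (g + int q *\<^sub>Z a) > 0" using g pos(3) by (simp add: add_pos_nonneg)
    then have "t (g + int q *\<^sub>Z a) = t (g + int q *\<^sub>Z a + int n *\<^sub>Z j + int n *\<^sub>Z k)" by (rule move[symmetric])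
    also have "g + int q *\<^sub>Z a + int n *\<^sub>Z j + int n *\<^sub>Z k
      = g + int (nat (int n + \<alpha>)) *\<^sub>Z j + int (nat (int n + \<beta>)) *\<^sub>Z k"
    proof -
      have "int (nat (int n + \<alpha>)) = int n + \<alpha>" "int (nat (int n + \<beta>)) = int n + \<beta>" by (auto simp: n_def)
      then show ?thesis unfolding qa by (simp add: zscale_add add_ac)
    qed
    also have "t \<dots> = t g" using g by (rule move)
    finally show ?thesis .
  qed
  then show ?thesis using q(1) by blast
qed

lemma half_plane_double_difference:
  assumes bd: "\<And>g. \<bar>w g\<bar> \<le> B" and a: "cross h a > 0" and p: "p > 0" and q: "q > 0"
    and kill: "\<And>g. cross h g > 0 \<Longrightarrow> act (diffop (int p *\<^sub>Z a)) (act (diffop (int q *\<^sub>Z a)) w) g = 0"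
    and g: "cross h g > 0"
  shows "w (g + int (p * q) *\<^sub>Z a) = w g"
proof -
  have scale: "act (diffop (int (n * m) *\<^sub>Z a)) y g = 0"
    if y: "\<And>g. cross h g > 0 \<Longrightarrow> act (diffop (int m *\<^sub>Z a)) y g = 0" and g: "cross h g > 0" for m n y g
  proof -
    have "y (g + int n *\<^sub>Z (int m *\<^sub>Z a)) = y g"
      by (rule forward_multiple[of h y]) (use y a g in \<open>auto simp: act_diffop\<close>)
    then show ?thesis by (simp add: act_diffop)
  qed
  let ?D = "diffop (int (p * q) *\<^sub>Z a)"
  have 1: "act ?D (act (diffop (int q *\<^sub>Z a)) w) g = 0" if "cross h g > 0" for g
    using scale[where m = p and n = q, OF kill that] by (simp add: mult.commute)
  have "act (diffop (int q *\<^sub>Z a)) (act ?D w) g = 0" if "cross h g > 0" for g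
    using 1[OF that] by (simp add: act_mult_commute)
  then have 2: "act ?D (act ?D w) g = 0" if "cross h g > 0" for g
    using scale[where m = q and n = p and y = "act ?D w", OF _ that] by simp
  have "act ?D w g = 0"
  proof (rule bounded_double_difference[OF bd, where U = "{g. cross h g > 0}"])
    fix g assume "g \<in> {g. cross h g > 0}"
    then show "g + int (p * q) *\<^sub>Z a \<in> {g. cross h g > 0}" using a by (simp add: add_pos_nonneg)
  qed (use 2 g in auto)
  then show ?thesis by (simp add: act_diffop)
qed

text \<open>A bounded function killed, on a half plane, by all products of all but one operator of a
  nonparallel family is periodic there in every direction pointing into the half plane: by induction each
  single difference is periodic along \<open>a\<close>, so the difference along a multiple of \<open>a\<close> has two independent
  periods and is periodic along \<open>a\<close> itself, and boundedness removes one of the two differences.\<close>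

lemma corank_one_killed_periodic:
  assumes "finite J" "J \<noteq> {}" "\<And>j. j \<in> J \<Longrightarrow> cross h j > 0"
    and "\<And>j k. j \<in> J \<Longrightarrow> k \<in> J \<Longrightarrow> j \<noteq> k \<Longrightarrow> cross j k \<noteq> 0"
    and "\<And>g. \<bar>t g\<bar> \<le> B"
    and "\<And>k g. k \<in> J \<Longrightarrow> cross h g > 0 \<Longrightarrow> act (diffprod (J - {k})) t g = 0"
    and a: "cross h a > 0"
  shows "\<exists>p>0. \<forall>g. cross h g > 0 \<longrightarrow> t (g + int p *\<^sub>Z a) = t g"
  using assms(1-6)
proof (induction J arbitrary: t B rule: finite_psubset_induct)
  case (psubset J)
  obtain j where j: "j \<in> J" using psubset.prems(1) by blast
  show ?case
  proof (cases "J = {j}")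
    case True
    then have t0: "t g = 0" if "cross h g > 0" for g using psubset.prems(5)[OF j that] by simp
    have "t (g + int 1 *\<^sub>Z a) = t g" if "cross h g > 0" for g
      using t0[of g] t0[of "g + a"] that a by simp
    then show ?thesis by (intro exI[of _ 1]) simp
  next
    case False
    then obtain k where k: "k \<in> J" "k \<noteq> j" using j by blast
    have single: "\<exists>p>0. \<forall>g. cross h g > 0 \<longrightarrow> act (diffop l) t (g + int p *\<^sub>Z a) = act (diffop l) t g"
      if l: "l \<in> J" for l
    proof -
      obtain C where C: "\<And>g. \<bar>act (diffop l) t g\<bar> \<le> C" using act_bounded[of t B, OF psubset.prems(4)] by blast
      have ne: "J - {l} \<noteq> {}" using j k l by blast
      have killl: "act (diffprod (J - {l} - {i})) (act (diffop l) t) g = 0" if i: "i \<in> J - {l}" and g: "cross h g > 0" for i g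
      proof -
        have "J - {i} = insert l (J - {l} - {i})" using l i by auto
        then have "diffprod (J - {i}) = diffprod (J - {l} - {i}) * diffop l"
          using psubset.hyps by (simp add: mult.commute)
        then show ?thesis using psubset.prems(5)[of i g] i g by (simp add: act_mult)
      qed
      show ?thesis
        by (rule psubset.IH[of "J - {l}" "act (diffop l) t" C])
          (use l ne psubset.prems(2,3) C killl in auto)
    qed
    obtain p1 where p1: "p1 > 0" "\<forall>g. cross h g > 0 \<longrightarrow> act (diffop j) t (g + int p1 *\<^sub>Z a) = act (diffop j) t g"
      using single[OF j] by blast
    obtain p2 where p2: "p2 > 0" "\<forall>g. cross h g > 0 \<longrightarrow> act (diffop k) t (g + int p2 *\<^sub>Z a) = act (diffop k) t g"
      using single[OF k(1)] by blast
    define p where "p = p1 * p2"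
    define s where "s = act (diffop (int p *\<^sub>Z a)) t"
    have sper: "s (g + l) = s g"
      if l: "\<forall>g. cross h g > 0 \<longrightarrow> act (diffop l) t (g + int p' *\<^sub>Z a) = act (diffop l) t g" and p': "p = n * p'"
        and g: "cross h g > 0" for l g n p'
    proof -
      have "act (diffop l) t (g + int n *\<^sub>Z (int p' *\<^sub>Z a)) = act (diffop l) t g"
        by (rule forward_multiple[of h]) (use l a g in auto)
      then have "act (diffop (int p *\<^sub>Z a)) (act (diffop l) t) g = 0" by (simp add: act_diffop p')
      then have "act (diffop l) s g = 0" by (simp add: s_def act_mult_commute)
      then show ?thesis by (simp add: act_diffop)
    qed
    have "\<exists>q>0. \<forall>g. cross h g > 0 \<longrightarrow> s (g + int q *\<^sub>Z a) = s g"
    proof (rule half_plane_two_periods[of h s j k a])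
      show "s (g + j) = s g" if "cross h g > 0" for g
        by (rule sper[OF p1(2) _ that, of p2]) (simp add: p_def)
      show "s (g + k) = s g" if "cross h g > 0" for g
        by (rule sper[OF p2(2) _ that, of p1]) (simp add: p_def)
    qed (use j k psubset.prems(2,3) a in auto)
    then obtain q where q: "q > 0" "\<forall>g. cross h g > 0 \<longrightarrow> s (g + int q *\<^sub>Z a) = s g" by blast
    have "t (g + int (q * p) *\<^sub>Z a) = t g" if "cross h g > 0" for g
      by (rule half_plane_double_difference[of t B h a q p])
        (use psubset.prems(4) a q p1(1) p2(1) that in \<open>auto simp: p_def s_def act_diffop[of "int q *\<^sub>Z a"]\<close>)
    moreover have "q * p > 0" using q(1) p1(1) p2(1) by (simp add: p_def)
    ultimately show ?thesis by blast
  qed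
qed

text \<open>The product of all operators but that of \<open>k\<close> maps \<open>w\<close> to a configuration periodic along \<open>k\<close>, and by
  hypothesis along \<open>h\<close> unless \<open>k = a\<close>, so it is periodic along \<open>a\<close> in any case. Hence a difference of \<open>w\<close>
  along \<open>a\<close> is killed by all these products.\<close>

lemma killed_periodic_along:
  assumes J: "finite J" "\<And>j. j \<in> J \<Longrightarrow> cross h j > 0"
    "\<And>j k. j \<in> J \<Longrightarrow> k \<in> J \<Longrightarrow> j \<noteq> k \<Longrightarrow> cross j k \<noteq> 0"
    and a: "a \<in> J" and bd: "\<And>g. \<bar>w g\<bar> \<le> B"
    and kill: "\<And>g. cross h g > 0 \<Longrightarrow> act (diffprod J) w g = 0"
    and fp: "\<And>k. k \<in> J - {a} \<Longrightarrow> \<exists>q>0. \<forall>g. cross h g > 0 \<longrightarrow>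
      act (diffprod (J - {k})) w (g + int q *\<^sub>Z h) = act (diffprod (J - {k})) w g"
  shows "\<exists>p>0. \<forall>g. cross h g > 0 \<longrightarrow> w (g + int p *\<^sub>Z a) = w g"
proof -
  have ha: "cross h a > 0" using J a by blast
  have own: "act (diffprod (J - {k})) w (g + k) = act (diffprod (J - {k})) w g" if "k \<in> J" "cross h g > 0" for k g
  proof -
    have "diffprod J = diffop k * diffprod (J - {k})" using that J(1) by (simp add: prod.remove)
    then have "act (diffop k) (act (diffprod (J - {k})) w) g = 0" using kill[OF that(2)] by (simp add: act_mult)
    then show ?thesis by (simp add: act_diffop)
  qed
  have "\<forall>k\<in>J. \<exists>c>0. \<forall>g. cross h g > 0 \<longrightarrow>
      act (diffprod (J - {k})) w (g + int c *\<^sub>Z a) = act (diffprod (J - {k})) w g"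
  proof
    fix k assume k: "k \<in> J"
    show "\<exists>c>0. \<forall>g. cross h g > 0 \<longrightarrow>
      act (diffprod (J - {k})) w (g + int c *\<^sub>Z a) = act (diffprod (J - {k})) w g"
    proof (cases "k = a")
      case True
      then show ?thesis using own[OF k] by (intro exI[of _ 1]) simp
    next
      case False
      then obtain q where q: "q > 0" "\<forall>g. cross h g > 0 \<longrightarrow>
          act (diffprod (J - {k})) w (g + int q *\<^sub>Z h) = act (diffprod (J - {k})) w g"
        using fp[of k] k by blast
      define y where "y = act (diffprod (J - {k})) w"
      define c where "c = nat (int q * cross h k)"
      have hk: "cross h k > 0" using J k by blast
      have c: "int c = int q * cross h k" using hk by (simp add: c_def)
      have ca: "int c *\<^sub>Z a = cross a k *\<^sub>Z (int q *\<^sub>Z h) + int (nat (int q * cross h a)) *\<^sub>Z k"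
      proof -
        have "int c *\<^sub>Z a = int q *\<^sub>Z (cross h k *\<^sub>Z a)" by (simp add: c)
        also have "\<dots> = int q *\<^sub>Z (cross a k *\<^sub>Z h + cross h a *\<^sub>Z k)" by (subst cramer) simp
        finally show ?thesis using ha by (simp add: zscale_add_right mult.commute)
      qed
      have "y (g + int c *\<^sub>Z a) = y g" if g: "cross h g > 0" for g
      proof -
        have "y (g + cross a k *\<^sub>Z (int q *\<^sub>Z h) + int (nat (int q * cross h a)) *\<^sub>Z k)
          = y (g + cross a k *\<^sub>Z (int q *\<^sub>Z h))"
          by (rule forward_multiple[of h y k]) (use own[OF k] hk g in \<open>auto simp: y_def\<close>)
        also have "\<dots> = y g"
          by (rule level_multiple[of h y "int q *\<^sub>Z h"]) (use q(2) g in \<open>auto simp: y_def\<close>)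
        finally show ?thesis by (simp add: ca add.assoc)
      qed
      moreover have "c > 0" using q(1) hk by (simp add: c_def)
      ultimately show ?thesis unfolding y_def by blast
    qed
  qed
  from bchoice[OF this] obtain c where c: "\<forall>k\<in>J. c k > 0 \<and> (\<forall>g. cross h g > 0 \<longrightarrow>
      act (diffprod (J - {k})) w (g + int (c k) *\<^sub>Z a) = act (diffprod (J - {k})) w g)" ..
  define C where "C = (\<Prod>k\<in>J. c k)"
  have C: "C > 0" using c by (auto simp: C_def intro: prod_pos)
  define t where "t = act (diffop (int C *\<^sub>Z a)) w"
  obtain B' where B': "\<And>g. \<bar>t g\<bar> \<le> B'" unfolding t_def using act_bounded[of w B, OF bd] by blast
  have "\<exists>p>0. \<forall>g. cross h g > 0 \<longrightarrow> t (g + int p *\<^sub>Z a) = t g"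
  proof (rule corank_one_killed_periodic[of J h t B' a])
    fix k g assume k: "k \<in> J" and g: "cross h g > 0"
    have "c k dvd C" unfolding C_def using J(1) k by (rule dvd_prodI)
    then obtain n where n: "C = c k * n" by (rule dvdE)
    have "act (diffprod (J - {k})) w (g + int n *\<^sub>Z (int (c k) *\<^sub>Z a)) = act (diffprod (J - {k})) w g"
      by (rule forward_multiple[of h]) (use c k ha g in auto)
    then have "act (diffop (int C *\<^sub>Z a)) (act (diffprod (J - {k})) w) g = 0"
      by (simp add: act_diffop n mult.commute)
    then show "act (diffprod (J - {k})) t g = 0" by (simp add: t_def act_mult_commute)
  qed (use J a ha B' in auto)
  then obtain p where p: "p > 0" "\<forall>g. cross h g > 0 \<longrightarrow> t (g + int p *\<^sub>Z a) = t g" by blast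
  have "w (g + int (p * C) *\<^sub>Z a) = w g" if "cross h g > 0" for g
    by (rule half_plane_double_difference[of w B h a p C])
      (use bd ha p C that in \<open>auto simp: t_def act_diffop[of "int p *\<^sub>Z a"]\<close>)
  moreover have "p * C > 0" using p(1) C by simp
  ultimately show ?thesis by blast
qed

section \<open>The boundary of the zero set of a periodic configuration\<close>

text \<open>Take \<open>g1\<close> on the last nonzero row before the run of zero rows.\<close>

lemma run_boundary:
  assumes g0: "\<psi> g0 \<noteq> (0::int)" and run: "cross s g0 < r" "\<And>g. r \<le> cross s g \<Longrightarrow> cross s g \<le> r + int n \<Longrightarrow> \<psi> g = 0"
  shows "\<exists>g1. \<psi> g1 \<noteq> 0 \<and> (\<forall>g. 0 < cross s g \<longrightarrow> cross s g \<le> int n \<longrightarrow> \<psi> (g + g1) = 0)"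
proof -
  define Q where "Q = (\<lambda>k::nat. \<exists>g. \<psi> g \<noteq> 0 \<and> cross s g = r - 1 - int k)"
  have "Q (nat (r - 1 - cross s g0))" using g0 run(1) unfolding Q_def by (intro exI[of _ g0]) simp
  then obtain k where k: "Q k" "\<And>m. m < k \<Longrightarrow> \<not> Q m" using exists_least_iff[of Q] by blast
  obtain g1 where g1: "\<psi> g1 \<noteq> 0" "cross s g1 = r - 1 - int k" using k(1) unfolding Q_def by blast
  have "\<psi> (g + g1) = 0" if g: "0 < cross s g" "cross s g \<le> int n" for g
  proof (cases "cross s (g + g1) < r")
    case True
    define m where "m = nat (r - 1 - cross s (g + g1))"
    have "m < k" "cross s (g + g1) = r - 1 - int m" using True g(1) g1(2) by (auto simp: m_def)
    then show ?thesis using k(2)[of m] unfolding Q_def by blast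
  next
    case False
    then show ?thesis using g g1(2) by (intro run(2)) auto
  qed
  then show ?thesis using g1(1) by blast
qed

text \<open>As \<open>\<Phi> \<eta>\<close> is \<open>h\<close>-periodic, it vanishes on whole rows wherever \<open>\<eta>\<close> resembles \<open>x\<^sub>0\<close> on a large window, so
  it has arbitrarily long runs of zero rows. Translating the end of such runs to the origin gives \<open>w\<close> in
  the limit. The sign of \<open>s\<close> tells on which side of the runs the nonzero rows lie.\<close>

lemma boundary_configuration:
  assumes A: "finite A" "\<And>g. \<eta> g \<in> A" and h: "h \<noteq> 0"
    and per: "\<And>g. act \<Phi> \<eta> (g + h) = act \<Phi> \<eta> g" and g0: "act \<Phi> \<eta> g0 \<noteq> 0"
    and x0: "x0 \<in> orbit_closure \<eta>" "\<And>g. act \<Phi> x0 g = 0"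
  shows "\<exists>s\<in>{h, - h}. \<exists>w\<in>orbit_closure \<eta>. act \<Phi> w 0 \<noteq> 0 \<and> (\<forall>g. cross s g > 0 \<longrightarrow> act \<Phi> w g = 0)"
proof -
  let ?\<psi> = "act \<Phi> \<eta>"
  have X: "subshift A (orbit_closure \<eta>)" by (rule subshift_orbit_closure[of A \<eta>, OF A])
  define Q where "Q = (\<lambda>s n. \<exists>g1. ?\<psi> g1 \<noteq> 0 \<and> (\<forall>g. 0 < cross s g \<longrightarrow> cross s g \<le> int n \<longrightarrow> ?\<psi> (g + g1) = 0))"
  have run: "\<exists>r. \<forall>g. r \<le> cross h g \<longrightarrow> cross h g \<le> r + int n \<longrightarrow> ?\<psi> g = 0" for n
  proof -
    obtain B where B: "finite B" "\<forall>g. 0 \<le> cross h g \<longrightarrow> cross h g \<le> int n \<longrightarrow> (\<exists>k. g + k *\<^sub>Z h \<in> B)"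
      using strip_finite_mod[OF h, of 0 "int n"] by blast
    define W where "W = (\<Union>b\<in>B. (+) b ` Poly_Mapping.keys \<Phi>)"
    have "finite W" using B(1) by (simp add: W_def)
    then obtain u where u: "agree_on W (shift u \<eta>) x0" using orbit_closure_approx[OF x0(1)] by blast
    have zero: "?\<psi> (b + u) = 0" if b: "b \<in> B" for b
    proof -
      have "act \<Phi> (shift u \<eta>) b = act \<Phi> x0 b"
        using u b by (intro act_cong_on) (auto simp: agree_on_def W_def)
      then show ?thesis using x0(2) by (simp add: act_shift shift_apply)
    qed
    have "?\<psi> g = 0" if g: "cross h u \<le> cross h g" "cross h g \<le> cross h u + int n" for g
    proof -
      obtain k where "g - u + k *\<^sub>Z h \<in> B" using B(2)[rule_format, of "g - u"] g by auto
      then have "?\<psi> (g - u + k *\<^sub>Z h + u) = 0" by (rule zero)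
      moreover have "g - u + k *\<^sub>Z h + u = g + k *\<^sub>Z h" by simp
      ultimately show ?thesis using period_multiple[of ?\<psi> h g k] per by simp
    qed
    then show ?thesis by blast
  qed
  have "Q h n \<or> Q (- h) n" for n
  proof -
    obtain r where r: "\<forall>g. r \<le> cross h g \<longrightarrow> cross h g \<le> r + int n \<longrightarrow> ?\<psi> g = 0" using run by blast
    then have "\<not> (r \<le> cross h g0 \<and> cross h g0 \<le> r + int n)" using g0 by blast
    then consider "cross h g0 < r" | "cross (- h) g0 < - r - int n" by fastforce
    then show ?thesis
    proof cases
      case 1
      have "\<exists>g1. ?\<psi> g1 \<noteq> 0 \<and> (\<forall>g. 0 < cross h g \<longrightarrow> cross h g \<le> int n \<longrightarrow> ?\<psi> (g + g1) = 0)"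
      proof (rule run_boundary[of ?\<psi> g0 h r n, OF g0 1])
        show "?\<psi> g = 0" if "r \<le> cross h g" "cross h g \<le> r + int n" for g using r[rule_format, of g] that by simp
      qed
      then have "Q h n" unfolding Q_def .
      then show ?thesis by blast
    next
      case 2
      have "\<exists>g1. ?\<psi> g1 \<noteq> 0 \<and> (\<forall>g. 0 < cross (- h) g \<longrightarrow> cross (- h) g \<le> int n \<longrightarrow> ?\<psi> (g + g1) = 0)"
      proof (rule run_boundary[of ?\<psi> g0 "- h" "- r - int n" n, OF g0 2])
        show "?\<psi> g = 0" if "- r - int n \<le> cross (- h) g" "cross (- h) g \<le> - r - int n + int n" for g
          using r[rule_format, of g] that by simp
      qed
      then have "Q (- h) n" unfolding Q_def .
      then show ?thesis by blast
    qed
  qed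
  moreover have "Q s m" if Qn: "Q s n" and mn: "m \<le> n" for s m n
  proof -
    obtain g1 where g1: "?\<psi> g1 \<noteq> 0" "\<forall>g. 0 < cross s g \<longrightarrow> cross s g \<le> int n \<longrightarrow> ?\<psi> (g + g1) = 0"
      using Qn unfolding Q_def by (elim exE conjE) (rule that)
    have "?\<psi> (g + g1) = 0" if "0 < cross s g" "cross s g \<le> int m" for g
      using g1(2) that mn by simp
    then show ?thesis using g1(1) unfolding Q_def by blast
  qed
  ultimately have "(\<forall>n. Q h n) \<or> (\<forall>n. Q (- h) n)"
    by (meson linear)
  then obtain s where s: "s \<in> {h, - h}" "\<forall>n. Q s n" by blast
  have "\<forall>n. \<exists>g1. ?\<psi> g1 \<noteq> 0 \<and> (\<forall>g. 0 < cross s g \<longrightarrow> cross s g \<le> int n \<longrightarrow> ?\<psi> (g + g1) = 0)"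
    using s(2) unfolding Q_def .
  from choice[OF this] obtain gs where gs: "\<forall>n. ?\<psi> (gs n) \<noteq> 0 \<and>
    (\<forall>g. 0 < cross s g \<longrightarrow> cross s g \<le> int n \<longrightarrow> ?\<psi> (g + gs n) = 0)" ..
  define xs where "xs = (\<lambda>n. shift (gs n) \<eta>)"
  have xsX: "xs n \<in> orbit_closure \<eta>" for n
    unfolding xs_def by (rule subshiftD(4)[OF X in_orbit_closure])
  obtain r w where r: "strict_mono (r::nat \<Rightarrow> nat)" "converges (xs \<circ> r) w" "w \<in> orbit_closure \<eta>"
    by (rule subshift_limit[OF X, of xs, OF xsX])
  have psi: "act \<Phi> (xs n) g = ?\<psi> (g + gs n)" for n g by (simp add: xs_def act_shift shift_apply)
  have "act \<Phi> w 0 \<noteq> 0"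
  proof
    assume "act \<Phi> w 0 = 0"
    then have "\<forall>\<^sub>F n in sequentially. act \<Phi> ((xs \<circ> r) n) 0 = 0"
      using converges_act[OF r(2), of \<Phi> 0] by simp
    then show False using gs by (auto simp: psi eventually_sequentially)
  qed
  moreover have "act \<Phi> w g = 0" if g: "cross s g > 0" for g
  proof (rule converges_zero_on[OF r(2)])
    have "\<forall>\<^sub>F n in sequentially. nat (cross s g) \<le> n" by (rule eventually_ge_at_top)
    then show "\<forall>\<^sub>F n in sequentially. act \<Phi> ((xs \<circ> r) n) g = 0"
    proof eventually_elim
      case (elim n)
      then have "cross s g \<le> int (r n)" using seq_suble[OF r(1), of n] by linarith
      then show ?case using gs g by (simp add: psi)
    qed
  qed
  ultimately show ?thesis using s(1) r(3) by blast
qed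

text \<open>The elements with the same image \<open>\<phi> w\<^sub>0\<close> under the product \<open>\<phi>\<close> over \<open>J\<close> form a closed set invariant under
  translations along \<open>h\<close>; let \<open>w\<close> belong to a minimal invariant subset \<open>N\<close>. For \<open>k \<in> J\<close> the product \<open>\<psi>\<^sub>k\<close> of
  the other operators maps \<open>w\<close> to a configuration that is \<open>k\<close>-periodic on the half plane, and \<open>FP k w\<close> says
  that it also has a period along \<open>h\<close> there. Limits of \<open>w\<close> deep in the half plane are killed by \<open>\<phi>\<close>, hence
  periodic by the hypothesis \<open>order\<close>, and this leaves at most one direction \<open>a\<close> in \<open>J\<close> for which \<open>FP a w\<close>
  fails. So \<open>w\<close> agrees on the half plane with an element \<open>y\<close> of \<open>X\<close> that is periodic along \<open>a\<close>, and \<open>w - y\<close> is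
  \<open>h\<close>-periodic, since the operators of \<open>J\<close> are injective on configurations vanishing on the half plane.\<close>

lemma ambiguous_from_boundary:
  assumes X: "subshift A X" and J: "finite J" "J \<noteq> {}" and pos: "\<And>j. j \<in> J \<Longrightarrow> cross h j > 0"
    and nonpar: "\<And>j k. j \<in> J \<Longrightarrow> k \<in> J \<Longrightarrow> j \<noteq> k \<Longrightarrow> cross j k \<noteq> 0"
    and kill: "\<And>x g. x \<in> X \<Longrightarrow> act (diffop h * diffprod J) x g = 0"
    and order: "\<And>x. x \<in> X \<Longrightarrow> (\<And>g. act (diffprod J) x g = 0) \<Longrightarrow> periodic x"
    and w0: "w0 \<in> X" "act (diffprod J) w0 g0 \<noteq> 0" "\<And>g. cross h g > 0 \<Longrightarrow> act (diffprod J) w0 g = 0"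
  shows "ambiguous_above X h \<and> ambiguous_above X (- h)"
proof -
  let ?\<phi> = "diffprod J"
  let ?\<psi> = "\<lambda>k. diffprod (J - {k})"
  have inv: "shift u x \<in> X" if "x \<in> X" for u x using X that by (rule subshiftD)
  have clX: "closed X" using X by (rule subshiftD)
  have h0: "h \<noteq> 0" using J(2) pos cross_nonzeroD(1) by fastforce
  have phi_h: "act ?\<phi> x (g + i *\<^sub>Z h) = act ?\<phi> x g" if "x \<in> X" for x g i
  proof (rule period_multiple)
    show "act ?\<phi> x (g + h) = act ?\<phi> x g" for g using kill[OF that, of g] by (simp add: act_mult act_diffop)
  qed
  define K where "K = {x \<in> X. \<forall>g. act ?\<phi> x g = act ?\<phi> w0 g}"
  have "closed K" unfolding closed_iff_converges
  proof (intro allI impI)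
    fix xs l assume xs: "\<forall>n. xs n \<in> K" "converges xs l"
    have "l \<in> X" using xs by (intro converges_in_closed[OF clX _ xs(2)]) (auto simp: K_def)
    moreover have "act ?\<phi> l g = act ?\<phi> w0 g" for g
    proof -
      have "\<forall>\<^sub>F n in sequentially. act ?\<phi> l g = act ?\<phi> w0 g"
        using converges_act[OF xs(2), of ?\<phi> g] by eventually_elim (use xs(1) in \<open>auto simp: K_def\<close>)
      then show ?thesis by simp
    qed
    ultimately show "l \<in> K" by (simp add: K_def)
  qed
  moreover have "K \<noteq> {}" using w0(1) by (auto simp: K_def)
  moreover have "finite A" using X by (rule subshiftD)
  moreover have "x g \<in> A" if "x \<in> K" for x g using that X by (auto simp: K_def subshiftD)
  moreover have "shift u x \<in> K" if "x \<in> K" "u \<in> range (\<lambda>i. i *\<^sub>Z h)" for x u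
    using that inv phi_h[OF w0(1)] by (auto simp: K_def act_shift shift_apply)
  ultimately have "\<exists>N. closed N \<and> N \<noteq> {} \<and> N \<subseteq> K \<and> (\<forall>x\<in>N. \<forall>u\<in>range (\<lambda>i. i *\<^sub>Z h). shift u x \<in> N) \<and>
    (\<forall>N'. closed N' \<longrightarrow> N' \<noteq> {} \<longrightarrow> N' \<subseteq> N \<longrightarrow> (\<forall>x\<in>N'. \<forall>u\<in>range (\<lambda>i. i *\<^sub>Z h). shift u x \<in> N') \<longrightarrow> N' = N)"
    by (rule minimal_invariant)
  then obtain N where N: "closed N" "N \<noteq> {}" "N \<subseteq> K" "\<forall>x\<in>N. \<forall>u\<in>range (\<lambda>i. i *\<^sub>Z h). shift u x \<in> N"
    "\<forall>N'. closed N' \<longrightarrow> N' \<noteq> {} \<longrightarrow> N' \<subseteq> N \<longrightarrow> (\<forall>x\<in>N'. \<forall>u\<in>range (\<lambda>i. i *\<^sub>Z h). shift u x \<in> N') \<longrightarrow> N' = N"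
    by (elim exE conjE) (rule that)
  obtain w where wN: "w \<in> N" using N(2) by blast
  have wX: "w \<in> X" and wphi: "\<And>g. act ?\<phi> w g = act ?\<phi> w0 g" using wN N(3) by (auto simp: K_def)
  have wU: "act ?\<phi> w g = 0" if "cross h g > 0" for g using w0(3)[OF that] wphi by simp
  obtain B where B: "\<And>g. \<bar>w g\<bar> \<le> B" using subshift_bounded[OF X] wX by blast
  have split: "?\<phi> = diffop k * ?\<psi> k" if "k \<in> J" for k using that J(1) by (simp add: prod.remove)
  have own: "act (?\<psi> k) w (g + k) = act (?\<psi> k) w g" if "k \<in> J" "cross h g > 0" for k g
    using wU[OF that(2)] by (simp add: split[OF that(1)] act_mult act_diffop)
  have deep: "\<forall>\<^sub>F n in sequentially. cross h (g + int n *\<^sub>Z a) > 0" if a: "cross h a > 0" for g a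
  proof -
    have "cross h (g + int n *\<^sub>Z a) > 0" if n: "n \<ge> nat (\<bar>cross h g\<bar> + 1)" for n
    proof -
      have "\<bar>cross h g\<bar> + 1 \<le> int n * cross h a"
        using n mult_left_mono[of 1 "cross h a" "int n"] a by simp
      then show ?thesis by simp
    qed
    then show ?thesis by (auto simp: eventually_sequentially)
  qed
  define FP where "FP = (\<lambda>k x. \<exists>q>0. \<forall>g. cross h g > 0 \<longrightarrow> act (?\<psi> k) x (g + int q *\<^sub>Z h) = act (?\<psi> k) x g)"
  \<comment> \<open>The limit \<open>y\<close> of translates of \<open>w\<close> along \<open>j\<close> has, on the half plane, the same image under \<open>\<psi>\<^sub>j\<close> as \<open>w\<close>.
    As these translates can also be reached by moving along \<open>h\<close> and then along \<open>k\<close>, it has the same image under \<open>\<psi>\<^sub>k\<close> as a limit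
    \<open>w'\<close> of translates of \<open>w\<close> along \<open>h\<close>, and \<open>w' \<in> N\<close>. A period \<open>v\<close> of \<open>y\<close> is not parallel to one of \<open>j\<close>, \<open>k\<close>,
    which gives a period along \<open>h\<close> of the corresponding image; for \<open>k\<close> it is passed from \<open>w'\<close> to \<open>w\<close> by
    minimality of \<open>N\<close>.\<close>
  have two: False if jk: "j \<in> J" "k \<in> J" "j \<noteq> k" and nfp: "\<not> FP j w" "\<not> FP k w" for j k
  proof -
    define c where "c = cross h k"
    define \<alpha> where "\<alpha> = cross j k"
    define b where "b = cross h j"
    have c: "c > 0" and b: "b > 0" using pos jk by (auto simp: c_def b_def)
    have cj: "c *\<^sub>Z j = \<alpha> *\<^sub>Z h + b *\<^sub>Z k" unfolding c_def \<alpha>_def b_def by (rule cramer)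
    define xs ys where "xs = (\<lambda>n::nat. shift (int n *\<^sub>Z (c *\<^sub>Z j)) w)" and "ys = (\<lambda>n::nat. shift ((int n * \<alpha>) *\<^sub>Z h) w)"
    have ysN: "ys n \<in> N" for n using N(4) wN by (simp add: ys_def)
    have ysX: "ys n \<in> X" and xsX: "xs n \<in> X" for n using inv[OF wX] by (auto simp: xs_def ys_def)
    obtain r y where r: "strict_mono (r::nat \<Rightarrow> nat)" "converges (xs \<circ> r) y" "y \<in> X"
      by (rule subshift_limit[OF X, of xs, OF xsX])
    have "(ys \<circ> r) n \<in> X" for n using ysX by simp
    then obtain s w' where s: "strict_mono (s::nat \<Rightarrow> nat)" "converges ((ys \<circ> r) \<circ> s) w'" "w' \<in> X"
      by (rule subshift_limit[OF X, of "ys \<circ> r"])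
    define t where "t = r \<circ> s"
    have t: "strict_mono t" unfolding t_def using r(1) s(1) by (rule strict_mono_o)
    have xt: "converges (\<lambda>n. xs (t n)) y" using converges_subseq[OF r(2) s(1)] by (simp add: t_def o_def)
    have yt: "converges (\<lambda>n. ys (t n)) w'" using s(2) by (simp add: t_def o_def)
    have w'N: "w' \<in> N" by (rule converges_in_closed[OF N(1) _ yt]) (rule ysN)
    have y_phi: "act ?\<phi> y g = 0" for g
    proof (rule converges_zero_on[OF xt])
      have "cross h (c *\<^sub>Z j) > 0" using b c by (simp add: b_def[symmetric])
      then have "\<forall>\<^sub>F n in sequentially. cross h (g + int (t n) *\<^sub>Z (c *\<^sub>Z j)) > 0"
        by (intro eventually_subseq[OF t deep])
      then show "\<forall>\<^sub>F n in sequentially. act ?\<phi> (xs (t n)) g = 0"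
        by eventually_elim (simp add: xs_def act_shift shift_apply wU del: cross_simps)
    qed
    have y_j: "act (?\<psi> j) y g = act (?\<psi> j) w g" if g: "cross h g > 0" for g
    proof -
      have "act (?\<psi> j) (xs n) g = act (?\<psi> j) w g" for n
      proof -
        have "act (?\<psi> j) w (g + int (n * nat c) *\<^sub>Z j) = act (?\<psi> j) w g"
          by (rule forward_multiple[of h]) (use own[OF jk(1)] b g in \<open>auto simp: b_def[symmetric]\<close>)
        then show ?thesis using c by (simp add: xs_def act_shift shift_apply)
      qed
      then have "\<forall>\<^sub>F n in sequentially. act (?\<psi> j) y g = act (?\<psi> j) w g"
        using converges_act[OF xt, of "?\<psi> j" g] by simp
      then show ?thesis by simp
    qed
    have y_k: "act (?\<psi> k) y g = act (?\<psi> k) w' g" if g: "cross h g > 0" for g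
    proof -
      have eq: "act (?\<psi> k) (xs n) g = act (?\<psi> k) (ys n) g" for n
      proof -
        have "act (?\<psi> k) w (g + (int n * \<alpha>) *\<^sub>Z h + int (n * nat b) *\<^sub>Z k) = act (?\<psi> k) w (g + (int n * \<alpha>) *\<^sub>Z h)"
          by (rule forward_multiple[of h]) (use own[OF jk(2)] c g in \<open>auto simp: c_def[symmetric]\<close>)
        moreover have "g + (int n * \<alpha>) *\<^sub>Z h + int (n * nat b) *\<^sub>Z k = g + int n *\<^sub>Z (c *\<^sub>Z j)"
          unfolding cj using b by (simp add: zscale_add_right add.assoc)
        ultimately have "act (?\<psi> k) w (g + int n *\<^sub>Z (c *\<^sub>Z j)) = act (?\<psi> k) w (g + (int n * \<alpha>) *\<^sub>Z h)"
          by (simp only:)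
        then show ?thesis unfolding xs_def ys_def act_shift shift_apply .
      qed
      have "\<forall>\<^sub>F n in sequentially. act (?\<psi> k) y g = act (?\<psi> k) w' g"
        using converges_act[OF xt, of "?\<psi> k" g] converges_act[OF yt, of "?\<psi> k" g]
        by eventually_elim (simp add: eq)
      then show ?thesis by simp
    qed
    have "periodic y" by (rule order[OF r(3) y_phi])
    then obtain v where v: "v \<noteq> 0" "\<And>g. y (g + v) = y g" by (auto simp: periodic_def is_period_def)
    have y_l: "\<exists>q>0. \<forall>g. act (?\<psi> l) y (g + int q *\<^sub>Z h) = act (?\<psi> l) y g" if l: "l \<in> J" "cross v l \<noteq> 0" for l
    proof -
      let ?z = "act (?\<psi> l) y"
      have z1: "?z (g + l) = ?z g" for g using y_phi[of g] by (simp add: split[OF l(1)] act_mult act_diffop)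
      have z2: "?z (g + v) = ?z g" for g
      proof -
        have "shift v y = y" using v(2) by (auto simp: shift_apply)
        then show ?thesis using act_shift[of "?\<psi> l" v y] by (metis shift_apply)
      qed
      define q where "q = nat \<bar>cross v l\<bar>"
      have "int q = \<bar>cross v l\<bar>" by (simp add: q_def)
      also have "\<dots> = sgn (cross v l) * cross v l" by (simp only: abs_sgn mult.commute)
      finally have q: "int q = sgn (cross v l) * cross v l" .
      have qh: "int q *\<^sub>Z h = (sgn (cross v l) * cross h l) *\<^sub>Z v + (sgn (cross v l) * cross v h) *\<^sub>Z l"
      proof -
        have "int q *\<^sub>Z h = sgn (cross v l) *\<^sub>Z (cross v l *\<^sub>Z h)" by (simp add: q)
        also have "\<dots> = sgn (cross v l) *\<^sub>Z (cross h l *\<^sub>Z v + cross v h *\<^sub>Z l)" by (subst cramer) simp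
        finally show ?thesis by (simp add: zscale_add_right)
      qed
      have "?z (g + int q *\<^sub>Z h) = ?z g" for g
        unfolding qh add.assoc[symmetric]
        using period_multiple[of ?z l] period_multiple[of ?z v] z1 z2 by simp
      moreover have "q > 0" using l(2) by (simp add: q_def)
      ultimately show ?thesis by blast
    qed
    show False
    proof (cases "cross v j = 0")
      case False
      then obtain q where q: "q > 0" "\<forall>g. act (?\<psi> j) y (g + int q *\<^sub>Z h) = act (?\<psi> j) y g" using y_l[OF jk(1)] by blast
      have "act (?\<psi> j) w (g + int q *\<^sub>Z h) = act (?\<psi> j) w g" if g: "cross h g > 0" for g
        using y_j[of g] y_j[of "g + int q *\<^sub>Z h"] g q(2) by simp
      then have "FP j w" unfolding FP_def by (intro exI[of _ q] conjI allI impI q(1))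
      then show False using nfp(1) by simp
    next
      case True
      have "cross v k \<noteq> 0"
      proof
        assume vk: "cross v k = 0"
        have "cross j k = 0"
          by (rule cross_parallel_trans[OF _ v(1) vk]) (use True cross_commute[of j v] in simp)
        then show False using nonpar jk by blast
      qed
      then obtain q where q: "q > 0" "\<forall>g. act (?\<psi> k) y (g + int q *\<^sub>Z h) = act (?\<psi> k) y g" using y_l[OF jk(2)] by blast
      define N' where "N' = {x \<in> N. \<forall>g. cross h g > 0 \<longrightarrow> act (?\<psi> k) x (g + int q *\<^sub>Z h) = act (?\<psi> k) x g}"
      have "act (?\<psi> k) w' (g + int q *\<^sub>Z h) = act (?\<psi> k) w' g" if g: "cross h g > 0" for g
        using y_k[of g] y_k[of "g + int q *\<^sub>Z h"] g q(2) by simp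
      then have "w' \<in> N'" using w'N by (simp add: N'_def)
      then have N'ne: "N' \<noteq> {}" by blast
      have N'cl: "closed N'" unfolding closed_iff_converges
      proof (intro allI impI)
        fix zs l assume zs: "\<forall>n. zs n \<in> N'" "converges zs l"
        have "l \<in> N" using zs by (intro converges_in_closed[OF N(1) _ zs(2)]) (auto simp: N'_def)
        moreover have "act (?\<psi> k) l (g + int q *\<^sub>Z h) = act (?\<psi> k) l g" if g: "cross h g > 0" for g
        proof -
          have "\<forall>\<^sub>F n in sequentially. act (?\<psi> k) l (g + int q *\<^sub>Z h) = act (?\<psi> k) l g"
            using converges_act[OF zs(2), of "?\<psi> k" g] converges_act[OF zs(2), of "?\<psi> k" "g + int q *\<^sub>Z h"]
          proof eventually_elim
            case (elim n)
            have "act (?\<psi> k) (zs n) (g + int q *\<^sub>Z h) = act (?\<psi> k) (zs n) g"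
              using zs(1) g by (simp add: N'_def)
            then show ?case using elim by simp
          qed
          then show ?thesis by simp
        qed
        ultimately show "l \<in> N'" by (simp add: N'_def)
      qed
      have N'inv: "\<forall>x\<in>N'. \<forall>u\<in>range (\<lambda>i. i *\<^sub>Z h). shift u x \<in> N'"
      proof (intro ballI)
        fix x u assume x: "x \<in> N'" and "u \<in> range (\<lambda>i. i *\<^sub>Z h)"
        then obtain i where u: "u = i *\<^sub>Z h" by blast
        have "act (?\<psi> k) x (g + int q *\<^sub>Z h + u) = act (?\<psi> k) x (g + u)" if g: "cross h g > 0" for g
        proof -
          have "act (?\<psi> k) x (g + u + int q *\<^sub>Z h) = act (?\<psi> k) x (g + u)"
            using x g by (simp add: N'_def u)
          then show ?thesis by (simp add: add_ac)
        qed
        then show "shift u x \<in> N'" using x N(4) by (simp add: N'_def act_shift shift_apply u)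
      qed
      have N'sub: "N' \<subseteq> N" by (auto simp: N'_def)
      have "N' = N" by (rule N(5)[THEN spec, THEN mp, THEN mp, THEN mp, THEN mp, OF N'cl N'ne N'sub N'inv])
      then have "w \<in> N'" using wN by simp
      then have "\<forall>g. cross h g > 0 \<longrightarrow> act (?\<psi> k) w (g + int q *\<^sub>Z h) = act (?\<psi> k) w g"
        unfolding N'_def mem_Collect_eq by (rule conjunct2)
      then have "FP k w" unfolding FP_def by (intro exI[of _ q] conjI q(1))
      then show False using nfp(2) by simp
    qed
  qed
  obtain a where a: "a \<in> J" "\<And>k. k \<in> J - {a} \<Longrightarrow> FP k w"
  proof (cases "\<exists>a\<in>J. \<not> FP a w")
    case True
    then obtain a where aJ: "a \<in> J" "\<not> FP a w" by blast
    show thesis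
    proof (rule that[OF aJ(1)])
      show "FP k w" if "k \<in> J - {a}" for k using two[OF aJ(1), of k] aJ(2) that by blast
    qed
  next
    case False
    obtain a where aJ: "a \<in> J" using J(2) by blast
    show thesis by (rule that[OF aJ]) (use False in blast)
  qed
  have ha: "cross h a > 0" using pos a(1) .
  have "\<exists>p>0. \<forall>g. cross h g > 0 \<longrightarrow> w (g + int p *\<^sub>Z a) = w g"
    by (rule killed_periodic_along[of J h a w B]) (use J(1) pos nonpar a B wU in \<open>auto simp: FP_def\<close>)
  then obtain p where p: "p > 0" "\<forall>g. cross h g > 0 \<longrightarrow> w (g + int p *\<^sub>Z a) = w g" by blast
  define v where "v = int p *\<^sub>Z a"
  have hv: "cross h v > 0" using ha p(1) by (simp add: v_def)
  have wv: "w (g + int n *\<^sub>Z v) = w g" if "cross h g > 0" for g n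
    by (rule forward_multiple[of h w v]) (use p(2) hv that in \<open>auto simp: v_def\<close>)
  define xs where "xs = (\<lambda>n::nat. shift (int n *\<^sub>Z v) w)"
  have xsX: "xs n \<in> X" for n using inv[OF wX] by (simp add: xs_def)
  obtain r y where r: "strict_mono (r::nat \<Rightarrow> nat)" "converges (xs \<circ> r) y" "y \<in> X"
    by (rule subshift_limit[OF X, of xs, OF xsX])
  have deepr: "\<forall>\<^sub>F n in sequentially. cross h (g + int (r n) *\<^sub>Z v) > 0" for g
    by (rule eventually_subseq[OF r(1) deep[OF hv]])
  have yw: "y g = w g" if g: "cross h g > 0" for g
  proof -
    have "\<forall>\<^sub>F n in sequentially. y g = w g"
      using convergesD[OF r(2), of g] by eventually_elim (simp add: xs_def shift_apply wv[OF g])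
    then show ?thesis by simp
  qed
  have yv: "y (g + v) = y g" for g
  proof -
    have "\<forall>\<^sub>F n in sequentially. y (g + v) = y g"
      using convergesD[OF r(2), of g] convergesD[OF r(2), of "g + v"] deepr[of g]
    proof eventually_elim
      case (elim n)
      have "w (g + int (r n) *\<^sub>Z v + int 1 *\<^sub>Z v) = w (g + int (r n) *\<^sub>Z v)" by (rule wv[OF elim(3)])
      then show ?case using elim(1,2) by (simp add: xs_def shift_apply add_ac)
    qed
    then show ?thesis by simp
  qed
  have y_phi: "act ?\<phi> y g = 0" for g
  proof (rule converges_zero_on[OF r(2)])
    show "\<forall>\<^sub>F n in sequentially. act ?\<phi> ((xs \<circ> r) n) g = 0"
      using deepr[of g] by eventually_elim (simp add: xs_def act_shift shift_apply wU del: cross_simps)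
  qed
  \<comment> \<open>A multiple of \<open>v\<close> as a period would spread the zeros of \<open>z\<close> from the half plane to everything, so that
    \<open>w = y\<close>; but \<open>\<phi> y = 0\<close>.\<close>
  define z where "z = (\<lambda>g. w g - y g)"
  have zh: "z (g + h) = z g" for g
  proof -
    have "act (diffop h) z g = 0"
    proof (rule zero_above_imp_zero[where J = J and h = h and c = 1])
      show "cross h j \<noteq> 0" if "j \<in> J" for j using pos[OF that] by simp
      show "act (diffop h) z g = 0" if "1 \<le> cross h g" for g
        using yw[of g] yw[of "g + h"] that by (simp add: act_diffop z_def)
      have "act (diffop h * ?\<phi>) z g = 0" for g
        unfolding z_def by (simp add: act_linear_diff kill wX r(3))
      then show "act ?\<phi> (act (diffop h) z) g = 0" for g
        by (simp add: mult.commute flip: act_mult)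
    qed (rule J(1))
    then show ?thesis by (simp add: act_diffop)
  qed
  have zne: "\<exists>g. z (g + k *\<^sub>Z v) \<noteq> z g" if k: "k > 0" for k
  proof (rule ccontr)
    assume "\<not> ?thesis"
    then have per: "z (g + k *\<^sub>Z v) = z g" for g by blast
    have "z g = 0" for g
    proof -
      have "cross h (k *\<^sub>Z v) > 0" using hv k by simp
      then have "\<forall>\<^sub>F n in sequentially. cross h (g + int n *\<^sub>Z (k *\<^sub>Z v)) > 0" by (rule deep)
      then obtain n where "cross h (g + int n *\<^sub>Z (k *\<^sub>Z v)) > 0" by (auto simp: eventually_sequentially)
      then have "z (g + int n *\<^sub>Z (k *\<^sub>Z v)) = 0" using yw by (simp add: z_def)
      then show ?thesis using period_multiple[of z "k *\<^sub>Z v" g "int n"] per by simp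
    qed
    then have "w = y" by (auto simp: z_def)
    then show False using y_phi[of g0] wphi[of g0] w0(2) by simp
  qed
  obtain B' where B': "\<And>g. \<bar>y g\<bar> \<le> B'" using subshift_bounded[OF X] r(3) by blast
  have sum: "(\<lambda>g. y g + z g) \<in> X" using wX by (simp add: z_def)
  have "ambiguous_above X h"
    by (rule ambiguous_from_sum[OF X h0 _ yv B' zh sum zne]) (use hv in auto)
  moreover have "ambiguous_above X (- h)"
  proof (rule ambiguous_from_sum[OF X _ _ yv B' _ sum zne])
    show "z (g + - h) = z g" for g using zh[of "g - h"] by simp
  qed (use hv h0 in auto)
  ultimately show ?thesis by blast
qed

section \<open>The directions of a minimal decomposition are nonexpansive\<close>

lemma fully_periodicI:
  assumes "is_period h x" "is_period k x" "cross h k \<noteq> 0"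
  shows "fully_periodic x"
proof -
  have k0: "emb k \<noteq> 0" using cross_nonzeroD(2)[OF assms(3)] by (auto simp: emb_def prod_eq_iff)
  have nspan: "emb h \<notin> span {emb k}"
  proof
    assume "emb h \<in> span {emb k}"
    then obtain c where "emb h = c *\<^sub>R emb k" unfolding span_singleton by blast
    then have "real_of_int (fst h) = c * real_of_int (fst k)" "real_of_int (snd h) = c * real_of_int (snd k)"
      by (auto simp: emb_def)
    then have "real_of_int (cross h k) = 0" by (simp add: cross_def)
    then show False using assms(3) by simp
  qed
  then have "independent {emb h, emb k}" using k0
    by (simp add: independent_insert span_base)
  moreover have "h \<noteq> k" using assms(3) by auto
  ultimately show ?thesis using assms by (auto simp: fully_periodic_def)
qed

lemma ambiguous_above_scale:
  assumes "c > 0" shows "ambiguous_above X (c *\<^sub>Z h) \<longleftrightarrow> ambiguous_above X h"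
  using assms by (simp add: ambiguous_above_def zero_le_mult_iff)

text \<open>\<open>X\<^bsup>-j\<^esup> - 1 = - X\<^bsup>-j\<^esup> (X\<^sup>j - 1)\<close>, so reversing directions changes a product only by a sign and a
  translation.\<close>

lemma orient_differences:
  assumes "finite J" "\<And>j. j \<in> J \<Longrightarrow> o' j = j \<or> o' j = - j"
  shows "\<exists>u s. s \<noteq> 0 \<and> (\<forall>x g. act (\<Prod>j\<in>J. diffop (o' j)) x g = s * act (diffprod J) x (g + u))"
  using assms
proof (induction J rule: finite_induct)
  case empty
  show ?case by (intro exI[of _ 0] exI[of _ 1]) simp
next
  case (insert j J)
  then obtain u s where us: "s \<noteq> 0" "\<forall>x g. act (\<Prod>j\<in>J. diffop (o' j)) x g = s * act (diffprod J) x (g + u)"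
    by auto
  have ins: "act (\<Prod>j\<in>insert j J. diffop (o' j)) x g = s * act (diffprod J) (act (diffop (o' j)) x) (g + u)" for x g
    using insert.hyps us(2) by (simp add: mult.commute[of "diffop (o' j)"] act_mult)
  show ?case
  proof (cases "o' j = j")
    case True
    have "act (diffprod J) (act (diffop j) x) = act (diffprod (insert j J)) x" for x
      using insert.hyps by (simp add: mult.commute flip: act_mult)
    then show ?thesis using us(1) ins True by (intro exI[of _ u] exI[of _ s]) simp
  next
    case False
    then have oj: "o' j = - j" using insert.prems[of j] by simp
    have "diffop (- j) = - (frag_of (- j) * diffop j)"
      by (simp add: diffop_def right_diff_distrib mult_single)
    then have "act (diffprod J) (act (diffop (- j)) x) (g + u) = - act (diffprod (insert j J)) x (g + (u - j))" for x g
    proof -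
      have "act (diffprod J) (act (diffop (- j)) x) (g + u) = act (diffop (- j) * diffprod J) x (g + u)"
        by (simp add: mult.commute flip: act_mult)
      also have "\<dots> = - act (frag_of (- j) * diffprod (insert j J)) x (g + u)"
        using \<open>diffop (- j) = _\<close> insert.hyps by (simp add: act_uminus mult.assoc)
      also have "\<dots> = - act (diffprod (insert j J)) x (g + (u - j))"
        unfolding act_mult[of "frag_of (- j)"] act_frag_of by (simp add: algebra_simps)
      finally show ?thesis .
    qed
    then show ?thesis using us(1) ins oj by (intro exI[of _ "u - j"] exI[of _ "- s"]) simp
  qed
qed

lemma decomposition_order_le: "periodic_decomposition n e x \<Longrightarrow> decomposition_order x \<le> enat n"
  unfolding decomposition_order_def by (rule INF_lower) auto

lemma decomposition_order_minimal:
  assumes "minimal_decomposition m d x" shows "decomposition_order x \<ge> enat m"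
  unfolding decomposition_order_def
  using assms by (intro INF_greatest) (auto simp: minimal_decomposition_def)

text \<open>A non-periodic \<open>x\<close> would have smaller order than \<open>\<eta>\<close>, which is not periodic either, as its minimal
  decomposition has at least two terms.\<close>

lemma lower_order_periodic:
  assumes order: "\<forall>x\<in>X. \<forall>y\<in>X. \<not> periodic x \<longrightarrow> \<not> periodic y \<longrightarrow> decomposition_order x = decomposition_order y"
    and \<eta>: "\<eta> \<in> X" and min: "minimal_decomposition m d \<eta>"
    and J: "nonparallel J" "J \<noteq> {}" "card J < m" and x: "x \<in> X" "\<And>g. act (diffprod J) x g = 0"
  shows "periodic x"
proof (rule ccontr)
  assume np: "\<not> periodic x"
  obtain e where "periodic_decomposition (card J) e x"
    by (rule annihilator_imp_periodic_decomposition[OF J(1,2) x(2)])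
  then have 1: "decomposition_order x \<le> enat (card J)" by (rule decomposition_order_le)
  have "card J \<ge> 1" using J by (simp add: nonparallel_def Suc_leI card_gt_0_iff)
  then have "\<not> periodic \<eta>"
  proof (intro notI)
    assume "periodic \<eta>"
    then have "periodic_decomposition 1 (\<lambda>_. \<eta>) \<eta>" by (simp add: periodic_decomposition_def)
    then have "m \<le> 1" using min unfolding minimal_decomposition_def by blast
    then show False using J(3) \<open>card J \<ge> 1\<close> by simp
  qed
  then have "decomposition_order x = decomposition_order \<eta>" using order x(1) \<eta> np by blast
  then have "enat m \<le> enat (card J)" using 1 decomposition_order_minimal[OF min] by (metis order_trans)
  then show False using J(3) by simp
qed

text \<open>Let \<open>J\<close> consist of the periods of the other terms, so that the product over \<open>J\<close> maps all elements of the
  orbit closure \<open>X\<close> to \<open>h\<close>-periodic ones, and let \<open>x\<^sub>0 \<in> X\<close> be periodic. If all periods of \<open>x\<^sub>0\<close> are parallel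
  to \<open>h\<close>, then \<open>x\<^sub>0\<close> is a one-dimensional sequence and \<open>ambiguous_from_sum\<close> applies with \<open>y = 0\<close>. Otherwise
  the image of \<open>x\<^sub>0\<close> has two independent periods, hence one parallel to a given \<open>a \<in> J\<close>, and if \<open>a\<close> is
  replaced by a multiple of it, the product over the new set \<open>J'\<close> kills \<open>x\<^sub>0\<close>. It does not kill \<open>\<eta>\<close>, because
  \<open>J'\<close> has fewer elements than the decomposition has terms.\<close>

lemma decomposition_direction_ambiguous:
  assumes A: "finite A" "\<And>g. \<eta> g \<in> A" and low: "low_convex_complexity \<eta>" and nfp: "\<not> fully_periodic \<eta>"
    and order: "\<forall>x\<in>orbit_closure \<eta>. \<forall>y\<in>orbit_closure \<eta>.
           \<not> periodic x \<longrightarrow> \<not> periodic y \<longrightarrow> decomposition_order x = decomposition_order y"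
    and min: "minimal_decomposition m d \<eta>" and i: "i \<in> {1..m}" "is_period h (d i)"
  shows "ambiguous_above (orbit_closure \<eta>) h \<and> ambiguous_above (orbit_closure \<eta>) (- h)"
proof -
  define X where "X = orbit_closure \<eta>"
  have X: "subshift A X" unfolding X_def by (rule subshift_orbit_closure[of A \<eta>, OF A])
  have \<eta>X: "\<eta> \<in> X" unfolding X_def by (rule in_orbit_closure)
  have h0: "h \<noteq> 0" using i by (simp add: is_period_def)
  obtain B where B: "\<forall>x\<in>X. \<forall>g. \<bar>x g\<bar> \<le> B" using subshift_bounded[OF X] by blast
  have bd: "\<bar>\<eta> g\<bar> \<le> B" for g using B \<eta>X by blast
  have "\<forall>k\<in>{1..m}. \<exists>p. is_period p (d k)"
    using min by (simp add: minimal_decomposition_def periodic_decomposition_def periodic_def)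
  from bchoice[OF this] obtain H' where H': "\<forall>k\<in>{1..m}. is_period (H' k) (d k)" ..
  define H where "H = H'(i := h)"
  have H: "is_period (H k) (d k)" if "k \<in> {1..m}" for k using H' i that by (simp add: H_def)
  define J0 where "J0 = H ` {1..m}"
  have inj: "inj_on H {1..m}" and npJ0: "nonparallel J0" and killJ0: "\<And>g. act (diffprod J0) \<eta> g = 0"
    unfolding J0_def by (rule minimal_decomposition_nonparallel[OF min bd H]; assumption)+
  have hJ0: "h \<in> J0" using i(1) by (auto simp: J0_def H_def)
  have cJ0: "card J0 = m" using inj by (simp add: J0_def card_image)
  have finJ0: "finite J0" using npJ0 by (simp add: nonparallel_def)
  define J where "J = J0 - {h}"
  have cJ: "card J = m - 1" using hJ0 cJ0 finJ0 by (simp add: J_def)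
  have hJ: "cross h j \<noteq> 0" if "j \<in> J" for j using that npJ0 hJ0 by (auto simp: J_def nonparallel_def)
  have npJ: "nonparallel J" using npJ0 by (auto simp: J_def nonparallel_def)
  have splitJ0: "diffprod J0 = diffop h * diffprod J" using hJ0 finJ0 by (simp add: J_def prod.remove)
  have killX: "act (diffprod J0) x g = 0" if "x \<in> X" for x g
    using orbit_closure_kills[of "diffprod J0" \<eta> x g] killJ0 that by (simp add: X_def)
  \<comment> \<open>One-dimensional sequences of rows: \<open>ambiguous_from_sum\<close> with \<open>y = 0\<close>.\<close>
  have one_dim: "ambiguous_above X k \<and> ambiguous_above X (- k)"
    if z: "z \<in> X" "is_period k z" and nf: "\<And>p. is_period p z \<Longrightarrow> cross k p = 0" for z k
  proof -
    have k0: "k \<noteq> 0" and zk: "\<And>g. z (g + k) = z g" using z(2) by (auto simp: is_period_def)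
    obtain v where v: "cross k v > 0" using exists_nonparallel[OF k0] .
    have aper: "\<exists>g. z (g + n *\<^sub>Z v) \<noteq> z g" if n: "n > 0" for n
    proof (rule ccontr)
      assume "\<not> ?thesis"
      moreover have "v \<noteq> 0" using v by auto
      ultimately have "is_period (n *\<^sub>Z v) z" using n by (auto simp: is_period_def)
      then have "cross k (n *\<^sub>Z v) = 0" by (rule nf)
      then show False using n v by simp
    qed
    have "ambiguous_above X k"
      by (rule ambiguous_from_sum[OF X k0 _ _ _ zk _ aper, of "\<lambda>_. 0" 0]) (use v z in auto)
    moreover have "ambiguous_above X (- k)"
    proof (rule ambiguous_from_sum[OF X _ _ _ _ _ _ aper, of _ "\<lambda>_. 0" 0])
      show "z (g + - k) = z g" for g using zk[of "g - k"] by simp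
    qed (use v z k0 in auto)
    ultimately show ?thesis by blast
  qed
  have "ambiguous_above X h \<and> ambiguous_above X (- h)"
  proof (cases "m = 1")
    case True
    then have "J = {}" using cJ npJ by (simp add: nonparallel_def)
    then have "is_period h \<eta>" using killJ0 h0 by (simp add: splitJ0 act_diffop is_period_def)
    then show ?thesis
      by (intro one_dim[OF \<eta>X]) (use nfp fully_periodicI in blast)+
  next
    case False
    then have m2: "m \<ge> 2" using i(1) by auto
    obtain S where S: "finite S" "S \<noteq> {}" "lattice_convex S" "pattern_complexity \<eta> S \<le> card S"
      using low by (auto simp: low_convex_complexity_def)
    have "patterns X S = range (\<lambda>u. restrict (shift u \<eta>) S)"
    proof
      show "patterns X S \<subseteq> range (\<lambda>u. restrict (shift u \<eta>) S)"
      proof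
        fix p assume "p \<in> patterns X S"
        then obtain x where x: "x \<in> X" "p = restrict x S" by (auto simp: patterns_def)
        obtain u where "agree_on S (shift u \<eta>) x" using orbit_closure_approx[of x \<eta> S] x S(1) by (auto simp: X_def)
        then have "restrict (shift u \<eta>) S = restrict x S" by (simp add: restrict_eq_iff_agree)
        then have "p = restrict (shift u \<eta>) S" using x(2) by simp
        then show "p \<in> range (\<lambda>u. restrict (shift u \<eta>) S)" by blast
      qed
      show "range (\<lambda>u. restrict (shift u \<eta>) S) \<subseteq> patterns X S"
        using subshiftD(4)[OF X \<eta>X] by (auto simp: patterns_def)
    qed
    then have cS: "card (patterns X S) \<le> card S" using S(4) by (simp add: pattern_complexity_def)
    have "hull_convex S" using S(3) by (auto simp: lattice_convex_def hull_convex_def)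
    then have "\<exists>x\<in>X. periodic x"
      using low_complexity_has_periodic[OF X _ npJ0 killX S(1,2) _ cS] \<eta>X by blast
    then obtain x0 v where x0: "x0 \<in> X" "is_period v x0" by (auto simp: periodic_def)
    have v0: "v \<noteq> 0" and x0v: "\<And>g. x0 (g + v) = x0 g" using x0(2) by (auto simp: is_period_def)
    show ?thesis
    proof (cases "\<exists>p. is_period p x0 \<and> cross h p \<noteq> 0")
      case False
      then have hp: "cross h p = 0" if "is_period p x0" for p using that by blast
      obtain c e where ce: "c > 0" "e \<noteq> 0" "c *\<^sub>Z h = e *\<^sub>Z v"
        by (rule parallel_common_multiple[OF hp[OF x0(2)] h0 v0])
      have "is_period (c *\<^sub>Z h) x0"
        using ce v0 period_multiple[of x0 v _ e] x0v by (simp add: is_period_def)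
      then have "ambiguous_above X (c *\<^sub>Z h) \<and> ambiguous_above X (- (c *\<^sub>Z h))"
        by (intro one_dim[OF x0(1)]) (use hp in auto)
      then show ?thesis using ambiguous_above_scale[OF ce(1), of X h] ambiguous_above_scale[OF ce(1), of X "- h"]
        by (simp add: zscale_minus_right)
    next
      case True
      then obtain p where p: "is_period p x0" "cross h p \<noteq> 0" by blast
      have x0p: "\<And>g. x0 (g + p) = x0 g" using p(1) by (simp add: is_period_def)
      have "J \<noteq> {}" using cJ m2 by auto
      then obtain a where a: "a \<in> J" by blast
      have a0: "a \<noteq> 0" using npJ a by (auto simp: nonparallel_def)
      define q where "q = cross h p"
      define J' where "J' = insert (q *\<^sub>Z a) (J - {a})"
      have q0: "q \<noteq> 0" using p(2) by (simp add: q_def)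
      have finJ: "finite J" using npJ by (simp add: nonparallel_def)
      have cqa: "cross (q *\<^sub>Z a) l \<noteq> 0" "cross l (q *\<^sub>Z a) \<noteq> 0" if "l \<in> J - {a}" for l
      proof -
        have "cross a l \<noteq> 0" "cross l a \<noteq> 0" using that a npJ by (auto simp: nonparallel_def)
        then show "cross (q *\<^sub>Z a) l \<noteq> 0" "cross l (q *\<^sub>Z a) \<noteq> 0" using q0 by auto
      qed
      have qaJ: "q *\<^sub>Z a \<notin> J - {a}" using cqa(1) by fastforce
      have npJ': "nonparallel J'" using npJ cqa q0 a0 by (auto simp: nonparallel_def J'_def)
      have "card J' = Suc (card (J - {a}))"
        unfolding J'_def using finJ qaJ by (intro card_insert_disjoint) auto
      then have cJ': "card J' = m - 1" using card_Suc_Diff1[OF finJ a] cJ by simp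
      have J'ne: "J' \<noteq> {}" by (simp add: J'_def)
      have finJ': "finite J'" using finJ by (simp add: J'_def)
      have hJ': "cross h j \<noteq> 0" if "j \<in> J'" for j using that hJ[of j] hJ[of a] a q0 by (auto simp: J'_def)
      have dvdJ: "diffprod J dvd diffprod J'"
        unfolding J'_def using qaJ finJ a diffop_multiple_dvd[of a q] by (simp add: prod.remove[of J a] mult_dvd_mono)
      have x0_kill: "act (diffprod J') x0 g = 0" for g
      proof -
        let ?y = "act (diffprod J) x0"
        have yh: "?y (g + h) = ?y g" for g
          using killX[OF x0(1), of g] by (simp add: splitJ0 act_mult act_diffop)
        have yp: "?y (g + p) = ?y g" for g
        proof -
          have "shift p x0 = x0" using x0p by (auto simp: shift_apply)
          then show ?thesis using act_shift[of "diffprod J" p x0] by (metis shift_apply)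
        qed
        have "q *\<^sub>Z a = cross a p *\<^sub>Z h + cross h a *\<^sub>Z p" unfolding q_def by (rule cramer)
        then have "?y (g + q *\<^sub>Z a) = ?y g" for g
          using period_multiple[of ?y h, OF yh] period_multiple[of ?y p, OF yp] by (simp add: add.assoc[symmetric])
        then have "act (diffop (q *\<^sub>Z a) * diffprod J) x0 g = 0" for g by (simp add: act_mult act_diffop)
        moreover have "diffprod J = diffop a * diffprod (J - {a})" using finJ a by (simp add: prod.remove)
        ultimately have "act (diffop (q *\<^sub>Z a) * diffop a * diffprod (J - {a})) x0 g = 0" for g
          by (simp add: mult.assoc)
        then have "act (diffop (q *\<^sub>Z a) * diffprod (J - {a})) x0 g = 0"
          using merge_parallel_differences[of x0 B "q *\<^sub>Z a" 1 "q *\<^sub>Z a" q a "diffprod (J - {a})" g] B x0(1) by simp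
        then show ?thesis using qaJ finJ by (simp add: J'_def)
      qed
      have killJ': "act (diffop h * diffprod J') x g = 0" if "x \<in> X" for x g
        by (rule act_dvd_kills[OF _ killX[OF that]]) (simp add: splitJ0 dvdJ mult_dvd_mono)
      have \<eta>h: "act (diffprod J') \<eta> (g + h) = act (diffprod J') \<eta> g" for g
        using killJ'[OF \<eta>X, of g] by (simp add: act_mult act_diffop)
      have "\<exists>g0. act (diffprod J') \<eta> g0 \<noteq> 0"
      proof (rule ccontr)
        assume "\<not> ?thesis"
        then have "m \<le> max 1 (card J')" by (intro minimal_decomposition_le[OF min npJ']) blast
        then show False using cJ' m2 by simp
      qed
      then obtain g0 where g0: "act (diffprod J') \<eta> g0 \<noteq> 0" by blast
      have "\<exists>s\<in>{h, - h}. \<exists>w\<in>X. act (diffprod J') w 0 \<noteq> 0 \<and> (\<forall>g. cross s g > 0 \<longrightarrow> act (diffprod J') w g = 0)"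
        unfolding X_def
        by (rule boundary_configuration[of A \<eta> h "diffprod J'" g0 x0]) (use A h0 \<eta>h g0 x0(1) x0_kill X_def in auto)
      then obtain s w where sw: "s \<in> {h, - h}" "w \<in> X" "act (diffprod J') w 0 \<noteq> 0"
        "\<forall>g. cross s g > 0 \<longrightarrow> act (diffprod J') w g = 0" by blast
      have s0: "s \<noteq> 0" using sw(1) h0 by auto
      \<comment> \<open>Directions are reversed where necessary, so that all of them point into the half plane.\<close>
      define o' where "o' = (\<lambda>j. if cross s j > 0 then j else - j)"
      have sJ': "cross s j \<noteq> 0" if "j \<in> J'" for j using hJ'[OF that] sw(1) by auto
      have oj: "o' j = j \<or> o' j = - j" for j by (simp add: o'_def)
      have inj_o: "inj_on o' J'"
      proof (rule inj_onI, rule ccontr)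
        fix j k assume jk: "j \<in> J'" "k \<in> J'" "o' j = o' k" "j \<noteq> k"
        then have "k = j \<or> k = - j" using oj[of j] oj[of k] by force
        then have "cross j k = 0" by auto
        then show False using npJ' jk by (auto simp: nonparallel_def)
      qed
      define J2 where "J2 = o' ` J'"
      have prodJ2: "diffprod J2 = (\<Prod>j\<in>J'. diffop (o' j))"
        unfolding J2_def prod.reindex[OF inj_o] o_def ..
      have "\<exists>u c. c \<noteq> 0 \<and> (\<forall>x g. act (diffprod J2) x g = c * act (diffprod J') x (g + u))"
        unfolding prodJ2 by (rule orient_differences[OF finJ' oj])
      then obtain u c where uc: "c \<noteq> 0" "\<forall>x g. act (diffprod J2) x g = c * act (diffprod J') x (g + u)"
        by (elim exE conjE) (rule that)
      \<comment> \<open>Translate so that the oriented product vanishes above level \<open>0\<close>.\<close>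
      obtain v' where v': "cross s v' > 0" using exists_nonparallel[OF s0] .
      define t where "t = (\<bar>cross s u\<bar>) *\<^sub>Z v'"
      have st: "cross s t + cross s u \<ge> 0"
        using mult_left_mono[of 1 "cross s v'" "\<bar>cross s u\<bar>"] v' by (simp add: t_def)
      have "ambiguous_above X s \<and> ambiguous_above X (- s)"
      proof (rule ambiguous_from_boundary[OF X, of J2 s "shift t w" "- u - t"])
        show "finite J2" "J2 \<noteq> {}" using finJ' J'ne by (auto simp: J2_def)
        show "cross s j > 0" if j: "j \<in> J2" for j
        proof -
          obtain j' where j': "j' \<in> J'" "j = o' j'" using j by (auto simp: J2_def)
          then show ?thesis using sJ'[OF j'(1)] by (auto simp: o'_def)
        qed
        show "cross j k \<noteq> 0" if jk: "j \<in> J2" "k \<in> J2" "j \<noteq> k" for j k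
        proof -
          obtain j' k' where j': "j' \<in> J'" "j = o' j'" "k' \<in> J'" "k = o' k'" using jk by (auto simp: J2_def)
          then have "cross j' k' \<noteq> 0" using npJ' jk(3) by (auto simp: nonparallel_def)
          then show ?thesis using j' by (auto simp: o'_def)
        qed
        show "act (diffop s * diffprod J2) x g = 0" if x: "x \<in> X" for x g
        proof -
          have e: "act (diffprod J') x (g + h) = act (diffprod J') x g" for g
            using killJ'[OF x, of g] by (simp add: act_mult act_diffop)
          have "act (diffprod J') x (g + s) = act (diffprod J') x g" for g
            using sw(1) e[of g] e[of "g - h"] by auto
          then have "act (diffprod J') x (g + s + u) = act (diffprod J') x (g + u)"
            by (metis add.assoc add.commute)
          then show ?thesis using uc(2) by (simp add: act_mult act_diffop)
        qed
        show "periodic x" if x: "x \<in> X" "\<And>g. act (diffprod J2) x g = 0" for x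
        proof (rule lower_order_periodic[OF _ \<eta>X min npJ' J'ne _ x(1)])
          show "\<forall>x\<in>X. \<forall>y\<in>X. \<not> periodic x \<longrightarrow> \<not> periodic y \<longrightarrow> decomposition_order x = decomposition_order y"
            using order unfolding X_def .
          show "card J' < m" using cJ' m2 by simp
          show "act (diffprod J') x g = 0" for g using x(2)[of "g - u"] uc by simp
        qed
        show "shift t w \<in> X" by (rule subshiftD(4)[OF X sw(2)])
        show "act (diffprod J2) (shift t w) (- u - t) \<noteq> 0"
          using uc sw(3) by (simp add: act_shift shift_apply)
        show "act (diffprod J2) (shift t w) g = 0" if "cross s g > 0" for g
        proof -
          have "cross s (g + t + u) > 0" using that st by simp
          then show ?thesis using uc(2) sw(4) by (simp add: act_shift shift_apply del: cross_simps)
        qed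
      qed
      then show ?thesis using sw(1) by auto
    qed
  qed
  then show ?thesis by (simp add: X_def)
qed

section \<open>Real lines\<close>

lemma line_unit_vector:
  assumes "line_through_origin L"
  obtains u where "norm u = 1" "L = span {u}"
proof -
  have L: "subspace L" "dim L = 1" using assms by (auto simp: line_through_origin_def)
  obtain B where B: "B \<subseteq> L" "independent B" "L \<subseteq> span B" "card B = 1"
    using basis_exists[of L] L(2) by metis
  then obtain b where b: "B = {b}" using card_1_singletonE by blast
  have b0: "b \<noteq> 0" using B(2) b dependent_zero by blast
  have Lb: "L = span {b}" using B(1,3) L(1) b by (metis span_minimal subset_antisym)
  define u where "u = (1 / norm b) *\<^sub>R b"
  have "norm u = 1" using b0 by (simp add: u_def)
  moreover have "span {u} = span {b}"
  proof -
    have "u \<in> span {b}" unfolding u_def by (intro span_scale span_base) simp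
    moreover have "b = norm b *\<^sub>R u" using b0 by (simp add: u_def)
    then have "b \<in> span {u}" by (metis span_scale span_base insertI1)
    ultimately show ?thesis by (intro span_eq[THEN iffD2]) simp
  qed
  ultimately show ?thesis using that Lb by simp
qed

lemma orthonormal_decomposition:
  fixes u p :: "real \<times> real"
  assumes u: "norm u = 1"
  shows "p = (p \<bullet> u) *\<^sub>R u + (p \<bullet> (- snd u, fst u)) *\<^sub>R (- snd u, fst u)"
proof -
  have 1: "fst u * fst u + snd u * snd u = 1"
    using u by (simp add: norm_eq_1 inner_prod_def)
  have "fst p = (fst p * fst u + snd p * snd u) * fst u + (fst p * (- snd u) + snd p * fst u) * (- snd u)"
  proof -
    have "(fst p * fst u + snd p * snd u) * fst u + (fst p * (- snd u) + snd p * fst u) * (- snd u)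
      = fst p * (fst u * fst u + snd u * snd u)" by (simp add: algebra_simps)
    then show ?thesis using 1 by simp
  qed
  moreover have "snd p = (fst p * fst u + snd p * snd u) * snd u + (fst p * (- snd u) + snd p * fst u) * fst u"
  proof -
    have "(fst p * fst u + snd p * snd u) * snd u + (fst p * (- snd u) + snd p * fst u) * fst u
      = snd p * (fst u * fst u + snd u * snd u)" by (simp add: algebra_simps)
    then show ?thesis using 1 by simp
  qed
  ultimately show ?thesis by (simp add: prod_eq_iff inner_prod_def)
qed

lemma infdist_line:
  fixes u p :: "real \<times> real"
  assumes u: "norm u = 1"
  shows "infdist p (span {u}) = \<bar>p \<bullet> (- snd u, fst u)\<bar>"
proof -
  let ?n = "(- snd u, fst u)"
  have n1: "norm ?n = 1" using u by (simp add: norm_Pair norm_prod_def add.commute)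
  have un: "u \<bullet> ?n = 0" by (simp add: inner_prod_def)
  show ?thesis
  proof (rule antisym)
    have "(p \<bullet> u) *\<^sub>R u \<in> span {u}" by (intro span_scale span_base) simp
    then have "infdist p (span {u}) \<le> dist p ((p \<bullet> u) *\<^sub>R u)" by (rule infdist_le)
    also have "dist p ((p \<bullet> u) *\<^sub>R u) = norm ((p \<bullet> ?n) *\<^sub>R ?n)"
    proof -
      have "p - (p \<bullet> u) *\<^sub>R u = (p \<bullet> ?n) *\<^sub>R ?n"
        by (rule diff_eq_eq[THEN iffD2, OF trans[OF orthonormal_decomposition[OF u] add.commute]])
      then show ?thesis by (simp only: dist_norm)
    qed
    also have "\<dots> = \<bar>p \<bullet> ?n\<bar>" using n1 by (simp only: norm_scaleR mult_1_right real_norm_def)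
    finally show "infdist p (span {u}) \<le> \<bar>p \<bullet> ?n\<bar>" .
    have ne: "span {u} \<noteq> {}" using span_zero by blast
    show "\<bar>p \<bullet> ?n\<bar> \<le> infdist p (span {u})"
      unfolding infdist_notempty[OF ne]
    proof (rule cINF_greatest[OF ne])
      fix q assume "q \<in> span {u}"
      then obtain c where "q = c *\<^sub>R u" unfolding span_singleton by blast
      then have "p \<bullet> ?n = (p - q) \<bullet> ?n" using un by (simp add: inner_diff_left)
      also have "\<bar>\<dots>\<bar> \<le> norm (p - q) * norm ?n" by (rule Cauchy_Schwarz_ineq2)
      finally show "\<bar>p \<bullet> ?n\<bar> \<le> dist p q" using n1 by (simp add: dist_norm)
    qed
  qed
qed

text \<open>The difference of two elements that agree on a wide strip along \<open>L\<close> is killed by difference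
  operators that all move the levels parallel to \<open>L\<close>.\<close>

lemma expansive_unless_direction:
  assumes X: "subshift A X" and J: "nonparallel J" and kill: "\<And>x g. x \<in> X \<Longrightarrow> act (diffprod J) x g = 0"
    and L: "line_through_origin L" and notin: "\<And>j. j \<in> J \<Longrightarrow> emb j \<notin> L"
  shows "expansive_on X L"
proof -
  obtain u where u: "norm u = 1" "L = span {u}" by (rule line_unit_vector[OF L])
  let ?lam = "\<lambda>g. emb g \<bullet> (- snd u, fst u)"
  have strip: "strip L t = {g. \<bar>?lam g\<bar> \<le> t}" for t
    unfolding strip_def u(2) infdist_line[OF u(1)] ..
  have lamJ: "?lam j \<noteq> 0" if "j \<in> J" for j
  proof
    assume "?lam j = 0"
    have "emb j = (emb j \<bullet> u) *\<^sub>R u + ?lam j *\<^sub>R (- snd u, fst u)"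
      by (rule orthonormal_decomposition[OF u(1)])
    also have "\<dots> = (emb j \<bullet> u) *\<^sub>R u" by (simp only: \<open>?lam j = 0\<close> scaleR_zero_left add_0_right)
    finally have "emb j \<in> L" unfolding u(2) by (metis span_scale span_base insertI1)
    then show False using notin[OF that] by blast
  qed
  define t where "t = 1 + (\<Sum>j\<in>J. \<bar>?lam j\<bar>)"
  have t: "t > 0" unfolding t_def by (simp add: add_pos_nonneg sum_nonneg)
  have "x = y" if xy: "x \<in> X" "y \<in> X" "agree_on (strip L t) x y" for x y
  proof
    fix g
    have "x g - y g = 0"
    proof (rule zero_on_strip_imp_zero[where lam = ?lam and J = J and a = "- t" and b = t and x = "\<lambda>g. x g - y g"])
      show "?lam (g + h) = ?lam g + ?lam h" for g h
      proof -
        have "emb (g + h) = emb g + emb h" by (simp add: emb_def)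
        then show ?thesis by (simp only: inner_add_left)
      qed
      show "x g - y g = 0" if "- t \<le> ?lam g" "?lam g \<le> t" for g
        using xy(3) that by (simp add: agree_on_def strip abs_le_iff)
      show "(\<Sum>j\<in>J. \<bar>?lam j\<bar>) \<le> t - - t"
        using t by (simp add: t_def)
      show "act (diffprod J) (\<lambda>g. x g - y g) g = 0" for g using kill xy by (simp add: act_linear_diff)
    qed (use lamJ J in \<open>auto simp: nonparallel_def\<close>)
    then show "x g = y g" by simp
  qed
  then show ?thesis using t by (auto simp: expansive_on_def)
qed

text \<open>A half plane contains a translate of every strip parallel to its boundary.\<close>

lemma expansive_imp_one_sided_expansive:
  assumes X: "subshift A X" and L: "line_through_origin L" and ex: "expansive_on X L" and v: "v \<in> L" "v \<noteq> 0"
  shows "one_sided_expansive_on X v"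
proof -
  obtain u where u: "norm u = 1" "L = span {u}" by (rule line_unit_vector[OF L])
  obtain c where c: "v = c *\<^sub>R u" using v(1) unfolding u(2) span_singleton by blast
  let ?lam = "\<lambda>g. emb g \<bullet> (- snd u, fst u)"
  let ?n = "(- snd v, fst v)"
  have n: "emb g \<bullet> ?n = c * ?lam g" for g by (simp add: c inner_prod_def algebra_simps)
  obtain t where t: "t > 0" "\<forall>x\<in>X. \<forall>y\<in>X. agree_on (strip L t) x y \<longrightarrow> x = y"
    using ex by (auto simp: expansive_on_def)
  have far: "\<exists>g. emb g \<bullet> ?n \<ge> K" for K
  proof (cases "fst v = 0")
    case True
    then have s: "snd v \<noteq> 0" using v(2) by (auto simp: prod_eq_iff)
    obtain k :: nat where "K / \<bar>snd v\<bar> < real k" using reals_Archimedean2 by blast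
    then have k: "K \<le> real k * \<bar>snd v\<bar>" using s by (simp add: pos_divide_less_eq)
    show ?thesis
      by (rule exI[of _ "(if snd v > 0 then - int k else int k, 0)"]) (use k s in \<open>auto simp: emb_def\<close>)
  next
    case False
    obtain k :: nat where "K / \<bar>fst v\<bar> < real k" using reals_Archimedean2 by blast
    then have k: "K \<le> real k * \<bar>fst v\<bar>" using False by (simp add: pos_divide_less_eq)
    show ?thesis
      by (rule exI[of _ "(0, if fst v > 0 then int k else - int k)"]) (use k False in \<open>auto simp: emb_def\<close>)
  qed
  obtain g0 where g0: "emb g0 \<bullet> ?n \<ge> \<bar>c\<bar> * t" using far by blast
  show ?thesis unfolding one_sided_expansive_on_def
  proof (intro ballI impI)
    fix x y assume xy: "x \<in> X" "y \<in> X" "agree_on (half_plane v) x y"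
    have "agree_on (strip L t) (shift g0 x) (shift g0 y)" unfolding agree_on_def
    proof
      fix g assume "g \<in> strip L t"
      then have "\<bar>?lam g\<bar> \<le> t" unfolding strip_def u(2) infdist_line[OF u(1)] by simp
      then have "\<bar>c * ?lam g\<bar> \<le> \<bar>c\<bar> * t" by (simp add: abs_mult mult_left_mono)
      then have "emb g \<bullet> ?n \<ge> - (\<bar>c\<bar> * t)" unfolding n by linarith
      moreover have "emb (g + g0) = emb g + emb g0" by (simp add: emb_def)
      ultimately have "emb (g + g0) \<bullet> ?n \<ge> 0" using g0 by (simp only: inner_add_left)
      then have "g + g0 \<in> half_plane v" by (simp add: half_plane_def)
      then show "shift g0 x g = shift g0 y g" using xy(3) by (simp add: agree_on_def shift_apply)
    qed
    then have "shift g0 x = shift g0 y" using t(2) subshiftD(4)[OF X] xy(1,2) by blast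
    then show "x = y" by simp
  qed
qed

lemma ambiguous_imp_ONED:
  assumes amb: "ambiguous_above (orbit_closure \<eta>) h" "ambiguous_above (orbit_closure \<eta>) (- h)"
    and L: "line_through_origin L" and h: "h \<noteq> 0" "emb h \<in> L" and v: "v \<in> L" "v \<noteq> 0"
  shows "v \<in> ONED \<eta>"
proof -
  obtain u where u: "norm u = 1" "L = span {u}" by (rule line_unit_vector[OF L])
  obtain c where c: "v = c *\<^sub>R u" using v(1) unfolding u(2) span_singleton by blast
  obtain b where b: "emb h = b *\<^sub>R u" using h(2) unfolding u(2) span_singleton by blast
  have b0: "b \<noteq> 0" using b h(1) by (auto simp: emb_def prod_eq_iff)
  define e where "e = c / b"
  have ve: "v = e *\<^sub>R emb h" using b0 by (simp add: c b e_def)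
  have e0: "e \<noteq> 0" using ve v(2) by auto
  have ip: "emb g \<bullet> (- snd v, fst v) = e * real_of_int (cross h g)" for g
    by (simp add: ve emb_def cross_def inner_prod_def algebra_simps)
  have "\<exists>k\<in>{h, - h}. half_plane v = {g. cross k g \<ge> 0}"
  proof (cases "e > 0")
    case True
    then have "half_plane v = {g. cross h g \<ge> 0}" by (simp add: half_plane_def ip zero_le_mult_iff)
    then show ?thesis by blast
  next
    case False
    then have "half_plane v = {g. cross (- h) g \<ge> 0}" using e0 by (simp add: half_plane_def ip zero_le_mult_iff)
    then show ?thesis by blast
  qed
  then have "\<not> one_sided_expansive_on (orbit_closure \<eta>) v"
    using amb unfolding ambiguous_above_def one_sided_expansive_on_def by fastforce
  then show ?thesis using v(2) by (simp add: ONED_def)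
qed

lemma exists_minimal_decomposition:
  assumes A: "finite A" "\<And>g. \<eta> g \<in> A" and low: "low_convex_complexity \<eta>"
  obtains m d where "minimal_decomposition m d \<eta>"
proof -
  obtain hs where hs: "0 \<notin> set hs" "\<And>g. act (prod_list (map diffop hs)) \<eta> g = 0"
    by (rule low_complexity_difference_annihilator[of A \<eta>, OF A low]) (rule that)
  have bd: "\<bar>\<eta> g\<bar> \<le> Max (abs ` A)" for g using A by (intro Max_ge) auto
  have "\<exists>J. nonparallel J \<and> card J \<le> length hs \<and> (\<forall>g. act (diffprod J) \<eta> g = 0)"
    by (rule nonparallel_annihilator[of \<eta> "Max (abs ` A)" hs]) (use bd hs in auto)
  then obtain J where J: "nonparallel J" "\<And>g. act (diffprod J) \<eta> g = 0" by blast
  have "\<exists>n d. periodic_decomposition n d \<eta>"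
  proof (cases "J = {}")
    case True
    then have "\<eta> g = 0" for g using J(2) by simp
    then have "periodic_decomposition 1 (\<lambda>_. \<eta>) \<eta>"
      by (auto simp: periodic_decomposition_def periodic_def is_period_def prod_eq_iff intro!: exI[of _ "(1, 0)"])
    then show ?thesis by blast
  next
    case False
    then show ?thesis using annihilator_imp_periodic_decomposition[OF J(1) _ J(2)] by blast
  qed
  then have ex: "\<exists>n. \<exists>d. periodic_decomposition n d \<eta>" .
  define m where "m = (LEAST n. \<exists>d. periodic_decomposition n d \<eta>)"
  have "\<exists>d. periodic_decomposition m d \<eta>" unfolding m_def by (rule LeastI_ex[OF ex])
  then obtain d where d: "periodic_decomposition m d \<eta>" ..
  have "m \<le> n" if "periodic_decomposition n e \<eta>" for n e
    unfolding m_def by (rule Least_le) (use that in blast)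
  then show ?thesis using d by (intro that[of m d]) (simp add: minimal_decomposition_def)
qed

theorem theorem1p15:
  fixes A :: "int set" and \<eta> :: config
  assumes "finite A" and "card A \<ge> 2"
    and "\<forall>g. \<eta> g \<in> A"
    and "low_convex_complexity \<eta>"
    and "\<not> fully_periodic \<eta>"
    and "\<forall>x\<in>orbit_closure \<eta>. \<forall>y\<in>orbit_closure \<eta>.
           \<not> periodic x \<longrightarrow> \<not> periodic y \<longrightarrow> decomposition_order x = decomposition_order y"
  shows "(\<forall>m d L. minimal_decomposition m d \<eta> \<longrightarrow> line_through_origin L \<longrightarrow>
            ((\<exists>i\<in>{1..m}. \<exists>h. is_period h (d i) \<and> emb h \<in> L) \<longleftrightarrow> L \<in> NEL \<eta>))
       \<and> (\<forall>L u. line_through_origin L \<longrightarrow> u \<in> L \<longrightarrow> u \<noteq> 0 \<longrightarrow>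
            (L \<in> NEL \<eta> \<longleftrightarrow> u \<in> ONED \<eta> \<and> - u \<in> ONED \<eta>))"
proof -
  have A: "finite A" "\<And>g. \<eta> g \<in> A" using assms(1,3) by auto
  have X: "subshift A (orbit_closure \<eta>)" by (rule subshift_orbit_closure[of A \<eta>, OF A])
  have bd: "\<bar>\<eta> g\<bar> \<le> Max (abs ` A)" for g using A by (intro Max_ge) auto
  have NEL_if_ONED: "L \<in> NEL \<eta>" if "line_through_origin L" "u \<in> L" "u \<in> ONED \<eta>" for L u
    using that expansive_imp_one_sided_expansive[OF X that(1) _ that(2)] by (auto simp: NEL_def ONED_def)
  have ONED_if_period: "u \<in> ONED \<eta>"
    if min: "minimal_decomposition m d \<eta>" and L: "line_through_origin L"
      and i: "i \<in> {1..m}" "is_period h (d i)" "emb h \<in> L" and u: "u \<in> L" "u \<noteq> 0" for m d L i h u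
  proof -
    have "ambiguous_above (orbit_closure \<eta>) h \<and> ambiguous_above (orbit_closure \<eta>) (- h)"
      by (rule decomposition_direction_ambiguous[of A \<eta> m d i h, OF A assms(4,5,6) min i(1,2)])
    then show ?thesis
      using ambiguous_imp_ONED[OF _ _ L _ i(3) u] i(2) by (auto simp: is_period_def)
  qed
  have period_if_NEL: "\<exists>i\<in>{1..m}. \<exists>h. is_period h (d i) \<and> emb h \<in> L"
    if min: "minimal_decomposition m d \<eta>" and L: "L \<in> NEL \<eta>" for m d L
  proof (rule ccontr)
    assume no: "\<not> ?thesis"
    have "\<forall>k\<in>{1..m}. \<exists>p. is_period p (d k)"
      using min by (simp add: minimal_decomposition_def periodic_decomposition_def periodic_def)
    from bchoice[OF this] obtain H where H: "\<forall>k\<in>{1..m}. is_period (H k) (d k)" ..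
    have J: "nonparallel (H ` {1..m})" and kill: "\<And>g. act (diffprod (H ` {1..m})) \<eta> g = 0"
      by (rule minimal_decomposition_nonparallel[OF min bd bspec[OF H]]; assumption)+
    have "expansive_on (orbit_closure \<eta>) L"
    proof (rule expansive_unless_direction[OF X J])
      show "act (diffprod (H ` {1..m})) x g = 0" if "x \<in> orbit_closure \<eta>" for x g
        by (rule orbit_closure_kills[OF kill that])
      show "line_through_origin L" using L by (simp add: NEL_def)
      show "emb j \<notin> L" if "j \<in> H ` {1..m}" for j using no H that by blast
    qed
    then show False using L by (simp add: NEL_def)
  qed
  have nonzero: "\<exists>u\<in>L. u \<noteq> 0" if L: "line_through_origin L" for L
  proof -
    obtain u where "norm u = 1" "L = span {u}" by (rule line_unit_vector[OF L])
    then show ?thesis by (intro bexI[of _ u]) (auto intro: span_base)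
  qed
  show ?thesis
  proof (intro conjI allI impI)
    fix m d L assume min: "minimal_decomposition m d \<eta>" and L: "line_through_origin L"
    obtain u where u: "u \<in> L" "u \<noteq> 0" using nonzero[OF L] by blast
    show "(\<exists>i\<in>{1..m}. \<exists>h. is_period h (d i) \<and> emb h \<in> L) \<longleftrightarrow> L \<in> NEL \<eta>"
    proof
      assume "\<exists>i\<in>{1..m}. \<exists>h. is_period h (d i) \<and> emb h \<in> L"
      then have "u \<in> ONED \<eta>" using ONED_if_period[OF min L] u by blast
      then show "L \<in> NEL \<eta>" by (rule NEL_if_ONED[OF L u(1)])
    next
      assume "L \<in> NEL \<eta>"
      then show "\<exists>i\<in>{1..m}. \<exists>h. is_period h (d i) \<and> emb h \<in> L" by (rule period_if_NEL[OF min])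
    qed
  next
    fix L :: "(real \<times> real) set" and u
    assume L: "line_through_origin L" and u: "u \<in> L" "u \<noteq> 0"
    obtain m d where min: "minimal_decomposition m d \<eta>"
      by (rule exists_minimal_decomposition[of A \<eta>, OF A assms(4)])
    show "L \<in> NEL \<eta> \<longleftrightarrow> u \<in> ONED \<eta> \<and> - u \<in> ONED \<eta>"
    proof
      assume "L \<in> NEL \<eta>"
      then obtain i h where ih: "i \<in> {1..m}" "is_period h (d i)" "emb h \<in> L" using period_if_NEL[OF min] by blast
      have "- u \<in> L" using L u(1) by (simp add: line_through_origin_def subspace_neg)
      then show "u \<in> ONED \<eta> \<and> - u \<in> ONED \<eta>" using ONED_if_period[OF min L ih] u by simp
    next
      assume "u \<in> ONED \<eta> \<and> - u \<in> ONED \<eta>"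
      then show "L \<in> NEL \<eta>" using NEL_if_ONED[OF L u(1)] by blast
    qed
  qed
qed

end
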